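(* Let $W=\sum_k\delta_{(x_k,y_k)}\in\mathcal T'$ and let $u:\mathbb R\to[0,\infty)$ be continuous with compact support and of bounded variation on $\mathbb R$. Then $u_W(t,x)$ is the unique function $v:[0,\infty)\times\mathbb R\to\mathbb R$ with the following properties: (i) $v(0,x)=u(x)$ for all $x\in\mathbb R$. (ii) $\sup_{t\ge0,\,x\in\mathbb R}|v(t,x)|<\infty$. (iii) For every fixed $t>0$, the function $x\mapsto v(t,x)$ is right-continuous with left limits and of bounded variation on $\mathbb R$; moreover the (signed Lebesgue–Stieltjes) measure $v(t,dx)$ is absolutely continuous with respect to $\sigma_W(dx)$. (iv) For every fixed $x_k\in\mathcal J_W$, $t\mapsto v(t,x_k)$ is differentiable on $[0,\infty)$ (one-sided at $t=0$), with $$-\frac{\partial}{\partial t}v(t,x_k)=\begin{cases}0&\text{if }t=0,\\ \dfrac{dv(t,\cdot)}{d\sigma_W}(x_k)&\text{if }t>0,\end{cases}$$ and $$\sup_{t\ge0}\int_{\mathbb R}\Big|\frac{\partial}{\partial t}v(t,x)\Big|\,\sigma_W(dx)<\infty.$$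
   Context: $\mathcal T$ is the set of point processes $W=\sum_k\delta_{(x_k,y_k)}$ on $\mathbb R\times(0,\infty]$ (Radon point measures; sets $[-L,L]\times[\varepsilon,\infty]$ are compact) such that: (1) $W(\mathbb R\times\{\infty\})=0$; (2) $\sup_xW(\{x\}\times(0,\infty])=1$; (3) there is $\varepsilon_0>0$ with $W((-\infty,-L]\times[\varepsilon_0,\infty))=W([L,\infty)\times[\varepsilon_0,\infty))=\infty$ for all $L<\infty$; (4) $\iint_{[-L,L]\times(0,\varepsilon)}y\,W(dx\,dy)<\infty$ for all $\varepsilon>0$, $L<\infty$. $\mathcal J_W=\{x_k\}_k=\{x:W(\{x\}\times(0,\infty))>0\}$, and $\mathcal T'$ is the set of $W\in\mathcal T$ with $\mathcal J_W$ dense in $\mathbb R$. $\sigma_W=\sum_ky_k\delta_{x_k}$ is the trap measure, a Radon measure carried by $\mathcal J_W$; thus densities with respect to $\sigma_W$ are defined pointwise on $\mathcal J_W$ and integrals against $\sigma_W$ only involve $x\in\mathcal J_W$. Let $\{\zeta_k\}$ be i.i.d. Exp(1), $\tau_W=\sum_ky_k\zeta_k\delta_{x_k}$ (a.s. a Radon measure), $Z_W^*(t;x)=\inf\{x':\tau_W((x',x])\le t\}$, and $u_W(t,x)=\mathbf E[u(Z_W^*(t;x))]$. A function $f$ is of bounded variation on $\mathbb R$ if its total variation $\lim_{a\to-\infty,b\to\infty}\sup_{a=x_0<\dots<x_n=b}\sum_i|f(x_i)-f(x_{i-1})|$ is finite. *)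

theory Defs
  imports "HOL-Probability.Probability"
begin

section \<open>Functions of bounded variation\<close>

definition variation :: "(real \<Rightarrow> real) \<Rightarrow> real \<Rightarrow> real \<Rightarrow> ennreal" where
  "variation f a b =
     (SUP (n, p) \<in> {(n, p). p 0 = a \<and> p n = b \<and> (\<forall>i<n. p i < p (Suc i))}.
        \<Sum>i<n. ennreal \<bar>f (p (Suc i)) - f (p i)\<bar>)"

definition total_variation :: "(real \<Rightarrow> real) \<Rightarrow> ennreal" where
  "total_variation f = Lim (at_bot \<times>\<^sub>F at_top) (\<lambda>(a, b). variation f a b)"

definition bounded_variation :: "(real \<Rightarrow> real) \<Rightarrow> bool" where
  "bounded_variation f \<longleftrightarrow> total_variation f < \<infinity>"

definition right_cont_left_limits :: "(real \<Rightarrow> real) \<Rightarrow> bool" where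
  "right_cont_left_limits f \<longleftrightarrow>
     (\<forall>x. continuous (at_right x) f \<and> (\<exists>l. (f \<longlongrightarrow> l) (at_left x)))"


section \<open>Finite signed measures\<close>

text \<open>A finite signed measure is a real-valued set function; only its values on
  \<open>sets M\<close> are meaningful.\<close>

definition signed_measure :: "'a measure \<Rightarrow> ('a set \<Rightarrow> real) \<Rightarrow> bool" where
  "signed_measure M \<mu> \<longleftrightarrow>
     \<mu> {} = 0 \<and>
     (\<forall>A. range A \<subseteq> sets M \<longrightarrow> disjoint_family A \<longrightarrow>
        (\<lambda>n::nat. \<mu> (A n)) sums \<mu> (\<Union>n. A n))"

text \<open>For a right-continuous \<open>f\<close> of bounded variation the chosen set function exists and is
  unique on the Borel sets.  For other \<open>f\<close> the value is unspecified.\<close>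

definition stieltjes_measure :: "(real \<Rightarrow> real) \<Rightarrow> real set \<Rightarrow> real" where
  "stieltjes_measure f =
     (SOME \<mu>. signed_measure borel \<mu> \<and> (\<forall>a b. a \<le> b \<longrightarrow> \<mu> {a<..b} = f b - f a))"

definition signed_absolutely_continuous :: "'a measure \<Rightarrow> ('a set \<Rightarrow> real) \<Rightarrow> bool" where
  "signed_absolutely_continuous M \<mu> \<longleftrightarrow> (\<forall>A\<in>null_sets M. \<mu> A = 0)"

text \<open>The signed counterpart of \<open>RN_deriv\<close>: it is determined up to \<open>M\<close>-null sets, hence
  its value at every atom of \<open>M\<close> of finite mass is determined.\<close>

definition signed_RN_deriv :: "'a measure \<Rightarrow> ('a set \<Rightarrow> real) \<Rightarrow> 'a \<Rightarrow> real" where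
  "signed_RN_deriv M \<mu> =
     (SOME g. integrable M g \<and> (\<forall>A\<in>sets M. \<mu> A = (LINT x:A|M. g x)))"


section \<open>Point processes and trap measures\<close>

text \<open>The sum of the unit masses at \<open>(x k, y k)\<close>, \<open>k \<in> K\<close>, on the space of all \<open>(x, y)\<close> with
  \<open>0 < y \<le> \<infinity>\<close>.\<close>

definition point_process ::
    "nat set \<Rightarrow> (nat \<Rightarrow> real) \<Rightarrow> (nat \<Rightarrow> ennreal) \<Rightarrow> (real \<times> ennreal) measure" where
  "point_process K x y =
     distr (count_space K) (restrict_space borel (UNIV \<times> {0<..})) (\<lambda>k. (x k, y k))"

definition trap_processes :: "(real \<times> ennreal) measure set" where
  "trap_processes = {W.
     (\<exists>K x y. (\<forall>k\<in>K. 0 < y k) \<and> W = point_process K x y) \<and>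
     (\<forall>C. compact C \<longrightarrow> C \<subseteq> UNIV \<times> {0<..} \<longrightarrow> emeasure W C < \<infinity>) \<and>
     emeasure W (UNIV \<times> {\<infinity>}) = 0 \<and>
     (SUP x. emeasure W ({x} \<times> {0<..})) = 1 \<and>
     (\<exists>\<epsilon>\<^sub>0::real. 0 < \<epsilon>\<^sub>0 \<and>
        (\<forall>L::real. emeasure W ({..-L} \<times> {ennreal \<epsilon>\<^sub>0..<\<infinity>}) = \<infinity> \<and>
                   emeasure W ({L..} \<times> {ennreal \<epsilon>\<^sub>0..<\<infinity>}) = \<infinity>)) \<and>
     (\<forall>\<epsilon>>0. \<forall>L::real.
        (\<integral>\<^sup>+p\<in>{-L..L} \<times> {0<..<ennreal \<epsilon>}. snd p \<partial>W) < \<infinity>)}"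

definition trap_locations :: "(real \<times> ennreal) measure \<Rightarrow> real set" where
  "trap_locations W = {x. emeasure W ({x} \<times> {0<..<\<infinity>}) > 0}"

definition dense_trap_processes :: "(real \<times> ennreal) measure set" where
  "dense_trap_processes = {W \<in> trap_processes. closure (trap_locations W) = UNIV}"

text \<open>The sum of the masses \<open>w k\<close> at \<open>x k\<close>, \<open>k \<in> K\<close>.\<close>

definition atomic_measure ::
    "nat set \<Rightarrow> (nat \<Rightarrow> real) \<Rightarrow> (nat \<Rightarrow> ennreal) \<Rightarrow> real measure" where
  "atomic_measure K x w = distr (density (count_space K) w) borel x"

definition trap_measure ::
    "nat set \<Rightarrow> (nat \<Rightarrow> real) \<Rightarrow> (nat \<Rightarrow> ennreal) \<Rightarrow> real measure" where
  "trap_measure K x y = atomic_measure K x y"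

definition random_trap_measure ::
    "nat set \<Rightarrow> (nat \<Rightarrow> real) \<Rightarrow> (nat \<Rightarrow> ennreal) \<Rightarrow> (nat \<Rightarrow> 'w \<Rightarrow> real) \<Rightarrow> 'w \<Rightarrow> real measure"
  where
  "random_trap_measure K x y \<zeta> \<omega> = atomic_measure K x (\<lambda>k. y k * ennreal (\<zeta> k \<omega>))"

text \<open>The infimum is taken in the reals.  The set contains \<open>x\<close>, and for the random trap measure
  of a trap process it is almost surely bounded below.\<close>

definition inverse_process :: "real measure \<Rightarrow> real \<Rightarrow> real \<Rightarrow> real" where
  "inverse_process \<tau> t x = Inf {x'. emeasure \<tau> {x'<..x} \<le> ennreal t}"

definition trap_expectation ::
    "'w measure \<Rightarrow> nat set \<Rightarrow> (nat \<Rightarrow> real) \<Rightarrow> (nat \<Rightarrow> ennreal) \<Rightarrow> (nat \<Rightarrow> 'w \<Rightarrow> real) \<Rightarrow>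
     (real \<Rightarrow> real) \<Rightarrow> real \<Rightarrow> real \<Rightarrow> real" where
  "trap_expectation M K x y \<zeta> u t z =
     prob_space.expectation M (\<lambda>\<omega>. u (inverse_process (random_trap_measure K x y \<zeta> \<omega>) t z))"


section \<open>The evolution equation\<close>

text \<open>A function on \<open>[0,\<infinity>) \<times> \<real>\<close> is a total function \<open>v\<close> whose values at negative times are
  ignored; accordingly time derivatives are taken within \<open>{0..}\<close>, so they are one-sided at 0.\<close>

definition time_deriv :: "(real \<Rightarrow> real \<Rightarrow> real) \<Rightarrow> real \<Rightarrow> real \<Rightarrow> real" where
  "time_deriv v t x = vector_derivative (\<lambda>s. v s x) (at t within {0..})"

text \<open>In the last clause \<open>time_deriv v t x\<close> is meaningful only for \<open>x \<in> J\<close>, whose complement is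
  \<open>\<sigma>\<close>-null when \<open>J\<close> is the set of atoms of \<open>\<sigma>\<close>.\<close>

definition trap_evolution ::
    "real set \<Rightarrow> real measure \<Rightarrow> (real \<Rightarrow> real) \<Rightarrow> (real \<Rightarrow> real \<Rightarrow> real) \<Rightarrow> bool" where
  "trap_evolution J \<sigma> u v \<longleftrightarrow>
     (\<forall>x. v 0 x = u x) \<and>
     bounded {v t x | t x. 0 \<le> t} \<and>
     (\<forall>t>0. right_cont_left_limits (v t) \<and> bounded_variation (v t) \<and>
        signed_absolutely_continuous \<sigma> (stieltjes_measure (v t))) \<and>
     (\<forall>x\<in>J. (\<lambda>t. v t x) differentiable_on {0..} \<and>
        (\<forall>t\<ge>0. - time_deriv v t x =
           (if t = 0 then 0 else signed_RN_deriv \<sigma> (stieltjes_measure (v t)) x))) \<and>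
     (SUP t\<in>{0..}. \<integral>\<^sup>+x\<in>J. ennreal \<bar>time_deriv v t x\<bar> \<partial>\<sigma>) < \<infinity>"

end

theory Submission
  imports Defs
begin

text \<open>Existence. Write \<open>u w = m\<^sub>1 {..<w} - m\<^sub>2 {..<w}\<close> with finite measures. As
  \<open>Z\<^sup>*(t;b) > z\<close> iff \<open>\<tau>((z,b]) > t\<close>, the expectation is
  \<open>\<integral> P(\<tau>((z,b]) > t) (m\<^sub>1 - m\<^sub>2)(dz)\<close>. For fixed \<open>z\<close> and \<open>t > 0\<close> the pure jump path
  \<open>b \<mapsto> \<tau>((z,b])\<close> almost surely crosses the level \<open>t\<close> at an atom: the levels missed by the
  other atoms form a Lebesgue null set, and resampling a single atom close to \<open>z\<close> shifts the
  level by a variable with a density. Hence \<open>b \<mapsto> P(\<tau>((z,b]) > t)\<close> is a sum of jumps at the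
  traps, of total mass at most 1. Integrating out \<open>\<zeta>\<^sub>k\<close> represents \<open>v(\<cdot>,x\<^sub>k)\<close> as an exponential
  average of its left limit \<open>v(\<cdot>,x\<^sub>k-)\<close>, which is continuous in time, and differentiating this
  average gives \<open>y\<^sub>k \<partial>\<^sub>t v(t,x\<^sub>k) = v(t,x\<^sub>k-) - v(t,x\<^sub>k)\<close>.

  Uniqueness. For the difference \<open>w\<close> of two solutions, convexity of the square gives
  \<open>w(t,b)\<^sup>2 - w(t,a)\<^sup>2 \<le> - \<Sum> y\<^sub>k \<partial>\<^sub>t w(t,x\<^sub>k)\<^sup>2\<close>, the sum being over the traps in \<open>(a,b]\<close>.
  Integrating twice in time, \<open>\<integral>\<^sub>0\<^sup>S w(t,b)\<^sup>2 dt\<close> times the trap mass of \<open>(a,b]\<close> is bounded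
  uniformly in \<open>a\<close>, while this mass tends to infinity as \<open>a \<rightarrow> -\<infinity>\<close>.\<close>

section \<open>Functions of bounded variation and their Stieltjes measures\<close>

text \<open>The obstacle to existence is absolute continuity: a priori
  \<open>b \<mapsto> P(\<tau>((z,b]) > t)\<close> could have a continuous part or a jump off the
  traps. At \<open>t = 0\<close> it does jump at \<open>z\<close>, whether or not \<open>z\<close>
  is a trap. For \<open>t > 0\<close> there is always a trap so close to \<open>z\<close> that its
  contribution ends below the level, and this is the atom to resample. Half-lines
  \<open>{..<w}\<close> represent \<open>u\<close> because they match the strict inequality
  \<open>Z\<^sup>* > z\<close>; continuity of \<open>u\<close> permits this choice.

  Density of the traps enters the time regularity twice. Another trap lies between \<open>z\<close>
  and \<open>x\<^sub>k\<close>, so the law of \<open>\<tau>((z,x\<^sub>k))\<close> has no atoms, and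
  the left limit is continuous in time. At \<open>t = 0\<close> that mass is almost surely positive,
  which makes the initial time derivative vanish.

  In the uniqueness part, one time integration bounds
  \<open>\<Sum> y\<^sub>k w(T,x\<^sub>k)\<^sup>2\<close> at a fixed time \<open>T\<close>. The
  squares at a fixed time are not known to be monotone in space, but their time integrals are. The
  second integration therefore allows every term to be compared with the value at one trap.\<close>

lemma variation_append:
  assumes "a \<le> b" "b \<le> c"
  shows "variation f a b + ennreal \<bar>f c - f b\<bar> \<le> variation f a c"
proof (cases "b = c")
  case True
  then show ?thesis by simp
next
  case False
  have "(\<Sum>i<n. ennreal \<bar>f (p (Suc i)) - f (p i)\<bar>) + ennreal \<bar>f c - f b\<bar> \<le> variation f a c"
    if p: "p 0 = a" "p n = b" "\<forall>i<n. p i < p (Suc i)" for n p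
  proof -
    let ?q = "p(Suc n := c)"
    have "(Suc n, ?q) \<in> {(n, p). p 0 = a \<and> p n = c \<and> (\<forall>i<n. p i < p (Suc i))}"
      using p False assms by (auto simp: less_Suc_eq)
    then have "(\<Sum>i<Suc n. ennreal \<bar>f (?q (Suc i)) - f (?q i)\<bar>) \<le> variation f a c"
      unfolding variation_def by (rule SUP_upper2) simp
    then show ?thesis using p by simp
  qed
  \<comment> \<open>Adding a constant under a supremum requires a nonempty index set, so some
    partition from \<open>a\<close> to \<open>b\<close> is exhibited, the trivial one when
    \<open>a = b\<close>.\<close>
  moreover obtain p0 :: "nat \<Rightarrow> real" and n0
    where "(n0, p0) \<in> {(n, p). p 0 = a \<and> p n = b \<and> (\<forall>i<n. p i < p (Suc i))}"
  proof (cases "a = b")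
    case True
    then show ?thesis by (intro that[of 0 "\<lambda>_. a"]) auto
  next
    case False
    then show ?thesis
      using assms by (intro that[of "Suc 0" "\<lambda>i. if i = 0 then a else b"]) auto
  qed
  ultimately show ?thesis
    unfolding variation_def
    by (subst ennreal_SUP_add_left[symmetric]) (auto intro!: SUP_least)
qed

lemma variation_prepend:
  assumes "a \<le> b"
  shows "variation f b c \<le> variation f a c"
proof (cases "a = b")
  case False
  have "(\<Sum>i<n. ennreal \<bar>f (p (Suc i)) - f (p i)\<bar>) \<le> variation f a c"
    if p: "p 0 = b" "p n = c" "\<forall>i<n. p i < p (Suc i)" for n p
  proof -
    let ?q = "\<lambda>i. case i of 0 \<Rightarrow> a | Suc j \<Rightarrow> p j"
    have "(Suc n, ?q) \<in> {(n, p). p 0 = a \<and> p n = c \<and> (\<forall>i<n. p i < p (Suc i))}"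
      using p False assms by (auto simp: less_Suc_eq_0_disj)
    then have "(\<Sum>i<Suc n. ennreal \<bar>f (?q (Suc i)) - f (?q i)\<bar>) \<le> variation f a c"
      unfolding variation_def by (rule SUP_upper2) simp
    moreover have "(\<Sum>i<n. ennreal \<bar>f (p (Suc i)) - f (p i)\<bar>) \<le> (\<Sum>i<Suc n. ennreal \<bar>f (?q (Suc i)) - f (?q i)\<bar>)"
      by (subst sum.lessThan_Suc_shift) simp
    ultimately show ?thesis by simp
  qed
  then show ?thesis
    unfolding variation_def[of f b] by (auto intro!: SUP_least)
qed simp

lemma variation_mono:
  assumes "a' \<le> a" "a \<le> b" "b \<le> b'"
  shows "variation f a b \<le> variation f a' b'"
proof -
  have "variation f a b \<le> variation f a b'"
    using variation_append[of a b b' f] assms by (auto intro: order_trans[rotated])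
  also have "\<dots> \<le> variation f a' b'" using assms by (intro variation_prepend)
  finally show ?thesis .
qed

text \<open>Enlarging the interval at either end increases \<open>variation\<close>, so the limit
  along \<open>at_bot \<times>\<^sub>F at_top\<close> is a supremum and bounds the variation over
  each interval.\<close>

lemma total_variation_eq_SUP:
  "total_variation f = (SUP (a, b) \<in> {(a, b). a \<le> b}. variation f a b)" (is "_ = ?S")
proof -
  have ev: "\<forall>\<^sub>F p in at_bot \<times>\<^sub>F at_top. fst p \<le> a \<and> b \<le> snd p" for a b :: real
    unfolding eventually_prod_filter
    by (intro exI[of _ "\<lambda>x. x \<le> a"] exI[of _ "\<lambda>x. b \<le> x"])
       (auto intro: eventually_le_at_bot eventually_ge_at_top)
  have "((\<lambda>(a, b). variation f a b) \<longlongrightarrow> ?S) (at_bot \<times>\<^sub>F at_top)"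
  proof (rule increasing_tendsto)
    show "\<forall>\<^sub>F p in at_bot \<times>\<^sub>F at_top. (case p of (a, b) \<Rightarrow> variation f a b) \<le> ?S"
      using ev[of 0 0]
    proof eventually_elim
      case (elim p)
      then show ?case
        by (cases p) (auto intro!: SUP_upper2[of "(fst p, snd p)"])
    qed
  next
    fix c assume "c < ?S"
    then obtain a b where ab: "a \<le> b" "c < variation f a b"
      by (auto simp: less_SUP_iff)
    show "\<forall>\<^sub>F p in at_bot \<times>\<^sub>F at_top. c < (case p of (a, b) \<Rightarrow> variation f a b)"
      using ev[of a b]
    proof eventually_elim
      case (elim p)
      then show ?case
        using ab variation_mono[of "fst p" a b "snd p" f]
        by (auto simp: case_prod_unfold intro: less_le_trans)
    qed
  qed
  then show ?thesis
    unfolding total_variation_def by (intro tendsto_Lim) (auto simp: prod_filter_eq_bot)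
qed

text \<open>The sums telescope against \<open>N\<close>, so every partition contributes at most the
  oscillation of \<open>N\<close>, which is at most \<open>2 * C\<close>. For a difference of
  distribution functions, \<open>N\<close> is their sum.\<close>

lemma bounded_variationI:
  fixes f N :: "real \<Rightarrow> real"
  assumes incr: "\<And>a b. a \<le> b \<Longrightarrow> \<bar>f b - f a\<bar> \<le> N b - N a"
    and bdd: "\<And>a. \<bar>N a\<bar> \<le> C"
  shows "bounded_variation f"
proof -
  have "(\<Sum>i<n. ennreal \<bar>f (p (Suc i)) - f (p i)\<bar>) \<le> ennreal (2 * C)"
    if p: "\<forall>i<n. p i < p (Suc i)" for n and p :: "nat \<Rightarrow> real"
  proof -
    have "(\<Sum>i<n. \<bar>f (p (Suc i)) - f (p i)\<bar>) \<le> (\<Sum>i<n. N (p (Suc i)) - N (p i))"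
      using p by (intro sum_mono incr) (auto intro: less_imp_le)
    also have "\<dots> = N (p n) - N (p 0)" by (rule sum_lessThan_telescope)
    also have "\<dots> \<le> 2 * C" using bdd[of "p n"] bdd[of "p 0"] by linarith
    finally show ?thesis by (simp add: sum_ennreal ennreal_leI)
  qed
  then have "total_variation f \<le> ennreal (2 * C)"
    unfolding total_variation_eq_SUP variation_def
    by (intro SUP_least) (auto intro!: SUP_least)
  then show ?thesis
    unfolding bounded_variation_def by (rule le_less_trans) simp
qed

section \<open>Right limits of monotone functions and the Jordan decomposition\<close>

definition right_limit :: "(real \<Rightarrow> real) \<Rightarrow> real \<Rightarrow> real" where
  "right_limit V x = Inf (V ` {x<..})"

lemma right_limit_of_mono:
  fixes V :: "real \<Rightarrow> real"
  assumes mono: "\<And>x y. x \<le> y \<Longrightarrow> V x \<le> V y"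
  shows "\<And>x. (V \<longlongrightarrow> right_limit V x) (at_right x)"
    and "\<And>x y. x \<le> y \<Longrightarrow> right_limit V x \<le> right_limit V y"
    and "\<And>x. continuous (at_right x) (right_limit V)"
    and "\<And>x. V x \<le> right_limit V x"
    and "\<And>x y. x < y \<Longrightarrow> right_limit V x \<le> V y"
proof -
  have bdd: "bdd_below (V ` {x<..})" for x
    by (intro bdd_belowI[of _ "V x"]) (auto intro: mono)
  have le: "right_limit V x \<le> V y" if "x < y" for x y
    unfolding right_limit_def using that bdd by (intro cInf_lower) auto
  have ge: "V x \<le> right_limit V x" for x
    unfolding right_limit_def by (intro cInf_greatest) (auto intro: mono)
  have approx: "\<exists>d>x. \<forall>y\<in>{x<..<d}. V y < right_limit V x + e" if "e > 0" for x e
  proof -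
    have "\<exists>y\<in>V ` {x<..}. y < right_limit V x + e"
      using that unfolding right_limit_def by (intro cInf_lessD) auto
    then obtain d where d: "d > x" "V d < right_limit V x + e" by auto
    have "V y \<le> V d" if "y < d" for y using that by (intro mono) simp
    then show ?thesis using d by (intro exI[of _ d]) (auto intro: le_less_trans[OF _ d(2)])
  qed
  have lim: "(V \<longlongrightarrow> right_limit V x) (at_right x)" for x
    unfolding tendsto_iff dist_real_def
  proof safe
    fix e :: real assume "e > 0"
    from approx[OF this, of x] obtain d where "d > x" "\<forall>y\<in>{x<..<d}. V y < right_limit V x + e" by auto
    moreover have "\<bar>V y - right_limit V x\<bar> < e" if "x < y" "y < d" for y
    proof -
      have "V y < right_limit V x + e" using calculation(2) that by auto
      then show ?thesis using le[OF that(1)] \<open>e > 0\<close> by linarith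
    qed
    ultimately show "\<forall>\<^sub>F y in at_right x. \<bar>V y - right_limit V x\<bar> < e"
      unfolding eventually_at_right_field by blast
  qed
  have Fmono: "right_limit V x \<le> right_limit V y" if "x \<le> y" for x y
    using that le[of x y] ge[of y] by (cases "x = y") auto
  have cont: "continuous (at_right x) (right_limit V)" for x
    unfolding continuous_within tendsto_iff dist_real_def
  proof safe
    fix e :: real assume "e > 0"
    from approx[OF this, of x] obtain d where d: "d > x" "\<forall>y\<in>{x<..<d}. V y < right_limit V x + e" by auto
    have "\<bar>right_limit V y - right_limit V x\<bar> < e" if y: "x < y" "y < d" for y
    proof -
      \<comment> \<open>The midpoint lies strictly to the right of \<open>y\<close>, so its value
        bounds the right limit there, and it is still covered by the choice of
        \<open>d\<close>.\<close>
      have "right_limit V y \<le> V ((y + d) / 2)" using y by (intro le) auto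
      also have "\<dots> < right_limit V x + e" using y d by auto
      finally show ?thesis using Fmono[of x y] y by auto
    qed
    then show "\<forall>\<^sub>F y in at_right x. \<bar>right_limit V y - right_limit V x\<bar> < e"
      unfolding eventually_at_right_field using d(1) by auto
  qed
  show "\<And>x. (V \<longlongrightarrow> right_limit V x) (at_right x)"
    "\<And>x y. x \<le> y \<Longrightarrow> right_limit V x \<le> right_limit V y"
    "\<And>x. continuous (at_right x) (right_limit V)" "\<And>x. V x \<le> right_limit V x"
    "\<And>x y. x < y \<Longrightarrow> right_limit V x \<le> V y"
    by fact+
qed

lemma finite_borel_measure_interval_measure:
  fixes F :: "real \<Rightarrow> real"
  assumes mono: "\<And>x y. x \<le> y \<Longrightarrow> F x \<le> F y" and rc: "\<And>a. continuous (at_right a) F"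
    and bdd: "\<And>x. \<bar>F x\<bar> \<le> C"
  shows "finite_borel_measure (interval_measure F)"
proof (intro finite_borel_measure.intro finite_measureI finite_borel_measure_axioms.intro)
  have "emeasure (interval_measure F) UNIV = (SUP n. emeasure (interval_measure F) {- real n<..real n})"
    by (subst SUP_emeasure_incseq) (auto simp: incseq_def UN_Ioc_eq_UNIV)
  also have "\<dots> \<le> ennreal (2 * C)"
  proof (rule SUP_least)
    fix n
    show "emeasure (interval_measure F) {- real n<..real n} \<le> ennreal (2 * C)"
      using bdd[of n] bdd[of "-n"] by (subst emeasure_interval_measure_Ioc) (auto intro!: ennreal_leI mono rc)
  qed
  finally show "emeasure (interval_measure F) (space (interval_measure F)) \<noteq> \<infinity>"
    by (auto simp: top_unique)
qed simp

text \<open>Replacing the monotone functions \<open>V\<close> and \<open>V - f\<close> by their right limits keeps their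
  difference, as \<open>f\<close> is right-continuous; so no right-continuity of the variation is needed.\<close>

lemma bounded_variation_decomposition:
  assumes bv: "bounded_variation f" and rc: "\<And>x. continuous (at_right x) f"
  obtains m\<^sub>1 m\<^sub>2 where "finite_borel_measure m\<^sub>1" "finite_borel_measure m\<^sub>2"
    "\<And>a b. a \<le> b \<Longrightarrow> f b - f a = measure m\<^sub>1 {a<..b} - measure m\<^sub>2 {a<..b}"
proof -
  define TV where "TV = enn2real (total_variation f)"
  have TV: "total_variation f = ennreal TV"
    using bv by (simp add: TV_def bounded_variation_def)
  have le_TV: "variation f a b \<le> ennreal TV" if "a \<le> b" for a b
    unfolding TV[symmetric] total_variation_eq_SUP using that by (intro SUP_upper2[of "(a, b)"]) auto
  define v where "v a b = enn2real (variation f a b)" for a b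
  have v: "variation f a b = ennreal (v a b)" if "a \<le> b" for a b
    unfolding v_def using le_TV[OF that] by (simp add: le_less_trans[OF _ ennreal_less_top])
  have v_le: "v a b \<le> TV" if "a \<le> b" for a b
    using le_TV[OF that] unfolding v[OF that] by (simp add: TV_def)
  have v_nonneg: "0 \<le> v a b" for a b by (simp add: v_def)
  have v_append: "v a b + \<bar>f c - f b\<bar> \<le> v a c" if "a \<le> b" "b \<le> c" for a b c
    using variation_append[OF that, of f] that
    by (simp add: v v_nonneg flip: ennreal_plus)
  \<comment> \<open>The variation over \<open>(-\<infinity>, x]\<close>. Applying
    \<open>variation_append\<close> before the supremum over \<open>a\<close> is taken makes both
    \<open>V\<close> and \<open>V - f\<close> nondecreasing.\<close>
  define V where "V x = (SUP a\<in>{..x}. v a x)" for x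
  have bddV: "bdd_above ((\<lambda>a. v a x) ` {..x})" for x
    by (intro bdd_aboveI[of _ TV]) (auto intro: v_le)
  have V_incr: "V b + \<bar>f c - f b\<bar> \<le> V c" if "b \<le> c" for b c
  proof -
    have "V b \<le> V c - \<bar>f c - f b\<bar>" unfolding V_def[of b]
    proof (rule cSUP_least)
      fix a assume "a \<in> {..b}"
      then have "v a b + \<bar>f c - f b\<bar> \<le> v a c" "v a c \<le> V c"
        using that bddV unfolding V_def by (auto intro!: v_append cSUP_upper)
      then show "v a b \<le> V c - \<bar>f c - f b\<bar>" by linarith
    qed simp
    then show ?thesis by linarith
  qed
  have V_nonneg: "0 \<le> V x" for x
    unfolding V_def by (rule cSUP_upper2[OF bddV, of x]) (auto simp: v_nonneg)
  have V_le: "V x \<le> TV" for x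
    unfolding V_def by (intro cSUP_least) (auto intro: v_le)
  have V_mono: "V x \<le> V y" and Vf_mono: "V x - f x \<le> V y - f y" if "x \<le> y" for x y
    using V_incr[OF that] by linarith+
  have f_bdd: "\<bar>f x\<bar> \<le> \<bar>f 0\<bar> + TV" for x
    using V_incr[of x 0] V_incr[of 0 x] V_nonneg[of x] V_nonneg[of 0] V_le[of x] V_le[of 0] by (cases "x \<le> 0") linarith+
  define F where "F = right_limit V"
  define G where "G = right_limit (\<lambda>x. V x - f x)"
  note F = right_limit_of_mono[of V, OF V_mono, folded F_def]
  note G = right_limit_of_mono[of "\<lambda>x. V x - f x", OF Vf_mono, folded G_def]
  have F_bdd: "\<bar>F x\<bar> \<le> TV" for x
    using F(4)[of x] F(5)[of x "x + 1"] V_nonneg[of x] V_le[of "x + 1"] by auto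
  have G_bdd: "\<bar>G x\<bar> \<le> \<bar>f 0\<bar> + 2 * TV" for x
    using G(4)[of x] G(5)[of x "x + 1"] V_nonneg[of x] V_le[of "x + 1"]
      V_nonneg[of "x + 1"] f_bdd[of x] f_bdd[of "x + 1"] by auto
  have eq: "f x = F x - G x" for x
  proof (rule tendsto_unique[of "at_right x"])
    show "(f \<longlongrightarrow> f x) (at_right x)" using rc[of x] by (simp add: continuous_within)
    have "((\<lambda>x. V x - (V x - f x)) \<longlongrightarrow> F x - G x) (at_right x)"
      by (intro tendsto_diff F G)
    then show "(f \<longlongrightarrow> F x - G x) (at_right x)" by simp
  qed simp
  show ?thesis
  proof (rule that[of "interval_measure F" "interval_measure G"])
    show "f b - f a = measure (interval_measure F) {a<..b} - measure (interval_measure G) {a<..b}"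
      if "a \<le> b" for a b
      using that by (simp add: measure_interval_measure_Ioc F(2,3) G(2,3) eq)
  qed (rule finite_borel_measure_interval_measure[OF F(2,3) F_bdd]
      finite_borel_measure_interval_measure[OF G(2,3) G_bdd]; assumption)+
qed

section \<open>Finite signed Borel measures and Stieltjes measures\<close>

lemma signed_measure_diff:
  assumes "finite_borel_measure m\<^sub>1" "finite_borel_measure m\<^sub>2"
  shows "signed_measure borel (\<lambda>A. measure m\<^sub>1 A - measure m\<^sub>2 A)"
proof -
  interpret m1: finite_borel_measure m\<^sub>1 by fact
  interpret m2: finite_borel_measure m\<^sub>2 by fact
  show ?thesis
    unfolding signed_measure_def
    by (auto intro!: sums_diff m1.finite_measure_UNION m2.finite_measure_UNION
        simp: m1.M_is_borel m2.M_is_borel)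
qed

lemma signed_measure_Un:
  assumes \<mu>: "signed_measure M \<mu>" and AB: "A \<in> sets M" "B \<in> sets M" "A \<inter> B = {}"
  shows "\<mu> (A \<union> B) = \<mu> A + \<mu> B"
proof -
  have emp: "\<mu> {} = 0" using \<mu> by (simp add: signed_measure_def)
  have "disjoint_family (binaryset A B)" "range (binaryset A B) \<subseteq> sets M"
    using AB by (auto simp: disjoint_family_on_def binaryset_def)
  then have "(\<lambda>n. \<mu> (binaryset A B n)) sums \<mu> (\<Union>n. binaryset A B n)"
    using \<mu> unfolding signed_measure_def by blast
  moreover have "(\<lambda>n. \<mu> (binaryset A B n)) sums (\<mu> A + \<mu> B)"
    using emp by (rule binaryset_sums[where f = \<mu>])
  ultimately show ?thesis by (simp add: UN_binaryset_eq sums_iff)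
qed

text \<open>A Dynkin argument over the half-open intervals, which are stable under intersection. Its
  complement step needs agreement on \<open>UNIV\<close>, which is not among the generators; the
  disjoint unit intervals \<open>?D\<close>, indexed by the integers, tile the line and give it by
  countable additivity.\<close>

lemma signed_measure_eqI:
  fixes \<mu> \<nu> :: "real set \<Rightarrow> real"
  assumes \<mu>: "signed_measure borel \<mu>" and \<nu>: "signed_measure borel \<nu>"
    and eq: "\<And>a b. a \<le> b \<Longrightarrow> \<mu> {a<..b} = \<nu> {a<..b}"
    and A: "A \<in> sets borel"
  shows "\<mu> A = \<nu> A"
proof -
  let ?E = "range (\<lambda>(a, b). {a<..b::real})"
  have emp: "\<mu> {} = 0" "\<nu> {} = 0" using \<mu> \<nu> by (auto simp: signed_measure_def)
  have eqE: "\<mu> X = \<nu> X" if "X \<in> ?E" for X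
  proof -
    obtain a b where X: "X = {a<..b}" using \<open>X \<in> ?E\<close> by auto
    show ?thesis using eq[of a b] emp by (cases "a \<le> b") (auto simp: X)
  qed
  have A': "A \<in> sigma_sets UNIV ?E"
    using A by (simp add: borel_sigma_sets_Ioc)
  have borel: "sigma_sets UNIV ?E = sets borel" by (simp add: borel_sigma_sets_Ioc)
  have E: "Int_stable ?E"
    by (auto simp: Int_stable_def)
  have union: "\<mu> (\<Union>i. A i) = \<nu> (\<Union>i. A i)"
    if "disjoint_family A" "range A \<subseteq> sets borel" "\<And>i::nat. \<mu> (A i) = \<nu> (A i)" for A
  proof -
    have "(\<lambda>n. \<mu> (A n)) sums \<mu> (\<Union>n. A n)" "(\<lambda>n. \<nu> (A n)) sums \<nu> (\<Union>n. A n)"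
      using that(1,2) \<mu> \<nu> unfolding signed_measure_def by blast+
    then show ?thesis using that(3) by (simp add: sums_iff)
  qed
  let ?D = "\<lambda>i::nat. {real_of_int (int_decode i)<..real_of_int (int_decode i + 1)}"
  have disj: "disjoint_family ?D"
  unfolding disjoint_family_on_def
  proof safe
    fix m n :: nat and r :: real assume "m \<noteq> n"
    then have "int_decode m \<noteq> int_decode n" by (metis int_decode_inverse)
    moreover assume "r \<in> ?D m" "r \<in> ?D n"
    ultimately show "r \<in> {}" by auto
  qed
  have UN: "(\<Union>i. ?D i) = UNIV"
  proof safe
    fix r :: real
    have "r \<in> ?D (int_encode (\<lceil>r\<rceil> - 1))" by (simp add: ceiling_less_iff) linarith
    then show "r \<in> (\<Union>i. ?D i)" by blast
  qed simp
  have UNIV: "\<mu> UNIV = \<nu> UNIV"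
    using union[OF disj] eqE unfolding UN by fastforce
  show ?thesis
  proof (rule sigma_sets_induct_disjoint[OF E _ A', where P = "\<lambda>A. \<mu> A = \<nu> A"])
    show "\<mu> (UNIV - A) = \<nu> (UNIV - A)" if "A \<in> sigma_sets UNIV ?E" "\<mu> A = \<nu> A" for A
      using signed_measure_Un[OF \<mu>, of A "UNIV - A"] signed_measure_Un[OF \<nu>, of A "UNIV - A"] that UNIV
      unfolding borel by (auto simp: Un_Diff_cancel)
    show "\<mu> (\<Union>i. A i) = \<nu> (\<Union>i. A i)"
      if "disjoint_family A" "range A \<subseteq> sigma_sets UNIV ?E" "\<And>i. \<mu> (A i) = \<nu> (A i)" for A :: "nat \<Rightarrow> real set"
      using union[of A] that unfolding borel by blast
  qed (auto simp: emp eqE)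
qed

text \<open>The difference of the two measures of the decomposition is a witness for the
  \<open>SOME\<close>, so the chosen set function has its two defining properties.\<close>

lemma stieltjes_measure:
  assumes "right_cont_left_limits f" "bounded_variation f"
  shows "signed_measure borel (stieltjes_measure f)"
    and "a \<le> b \<Longrightarrow> stieltjes_measure f {a<..b} = f b - f a"
proof -
  obtain m\<^sub>1 m\<^sub>2 where m: "finite_borel_measure m\<^sub>1" "finite_borel_measure m\<^sub>2"
    "\<And>a b. a \<le> b \<Longrightarrow> f b - f a = measure m\<^sub>1 {a<..b} - measure m\<^sub>2 {a<..b}"
  proof (rule bounded_variation_decomposition[OF assms(2)])
    show "continuous (at_right x) f" for x
      using assms(1) by (simp add: right_cont_left_limits_def)
  qed (rule that)
  let ?P = "\<lambda>\<mu>. signed_measure borel \<mu> \<and> (\<forall>a b. a \<le> b \<longrightarrow> \<mu> {a<..b} = f b - f a)"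
  have "\<exists>\<mu>. ?P \<mu>"
    using signed_measure_diff[OF m(1,2)] m(3)
    by (intro exI[of _ "\<lambda>A. measure m\<^sub>1 A - measure m\<^sub>2 A"]) simp
  from someI_ex[OF this] have P: "?P (stieltjes_measure f)"
    unfolding stieltjes_measure_def .
  show "signed_measure borel (stieltjes_measure f)"
    by (rule conjunct1[OF P])
  show "a \<le> b \<Longrightarrow> stieltjes_measure f {a<..b} = f b - f a"
    using conjunct2[OF P] by blast
qed

text \<open>At a fixed positive time the solution will be a difference of two distribution
  functions; the regularity in clause (iii) and the value of \<open>v(t,dx)\<close> are then read
  off from here.\<close>

lemma cdf_diff_properties:
  assumes "finite_borel_measure m\<^sub>1" "finite_borel_measure m\<^sub>2"
  shows "right_cont_left_limits (\<lambda>x. cdf m\<^sub>1 x - cdf m\<^sub>2 x)" (is "right_cont_left_limits ?f")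
    and "bounded_variation (\<lambda>x. cdf m\<^sub>1 x - cdf m\<^sub>2 x)"
    and "A \<in> sets borel \<Longrightarrow>
      stieltjes_measure (\<lambda>x. cdf m\<^sub>1 x - cdf m\<^sub>2 x) A = measure m\<^sub>1 A - measure m\<^sub>2 A"
proof -
  interpret m1: finite_borel_measure m\<^sub>1 by fact
  interpret m2: finite_borel_measure m\<^sub>2 by fact
  show 1: "right_cont_left_limits ?f"
    unfolding right_cont_left_limits_def
  proof (intro allI conjI)
    fix x
    show "continuous (at_right x) ?f"
      by (intro continuous_diff m1.cdf_is_right_cont m2.cdf_is_right_cont)
    show "\<exists>l. (?f \<longlongrightarrow> l) (at_left x)"
      by (rule exI, rule tendsto_diff[OF m1.cdf_at_left m2.cdf_at_left])
  qed
  show 2: "bounded_variation ?f"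
  proof (rule bounded_variationI)
    fix a b :: real assume "a \<le> b"
    then show "\<bar>?f b - ?f a\<bar> \<le> (cdf m\<^sub>1 b + cdf m\<^sub>2 b) - (cdf m\<^sub>1 a + cdf m\<^sub>2 a)"
      using m1.cdf_nondecreasing[of a b] m2.cdf_nondecreasing[of a b] by linarith
  next
    fix a
    show "\<bar>cdf m\<^sub>1 a + cdf m\<^sub>2 a\<bar> \<le> measure m\<^sub>1 (space m\<^sub>1) + measure m\<^sub>2 (space m\<^sub>2)"
      using m1.cdf_bounded[of a] m2.cdf_bounded[of a] m1.cdf_nonneg[of a] m2.cdf_nonneg[of a] by linarith
  qed
  show "stieltjes_measure ?f A = measure m\<^sub>1 A - measure m\<^sub>2 A" if A: "A \<in> sets borel"
  proof (rule signed_measure_eqI[OF stieltjes_measure(1)[OF 1 2] signed_measure_diff[OF assms] _ A])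
    fix a b :: real assume ab: "a \<le> b"
    show "stieltjes_measure ?f {a<..b} = measure m\<^sub>1 {a<..b} - measure m\<^sub>2 {a<..b}"
    proof (cases "a = b")
      case False
      then show ?thesis
        using m1.cdf_diff_eq[of a b] m2.cdf_diff_eq[of a b] ab
        unfolding stieltjes_measure(2)[OF 1 2 ab] by linarith
    qed (use stieltjes_measure(2)[OF 1 2 ab] in simp)
  qed
qed

section \<open>Purely atomic measures on the line\<close>

lemma nn_integral_atomic_measure:
  assumes [measurable]: "f \<in> borel_measurable borel"
  shows "(\<integral>\<^sup>+z. f z \<partial>atomic_measure K x w) = (\<Sum>k. if k \<in> K then w k * f (x k) else 0)"
proof -
  have "(\<integral>\<^sup>+z. f z \<partial>atomic_measure K x w) = (\<integral>\<^sup>+k. w k * f (x k) \<partial>count_space K)"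
    unfolding atomic_measure_def by (simp add: nn_integral_distr nn_integral_density)
  also have "\<dots> = (\<Sum>k. w k * f (x k) * indicator K k)"
    by (subst nn_integral_count_space_indicator) (auto simp: nn_integral_count_space_nat)
  also have "\<dots> = (\<Sum>k. if k \<in> K then w k * f (x k) else 0)"
    by (intro suminf_cong) auto
  finally show ?thesis .
qed

lemma sets_atomic_measure [simp, measurable_cong]: "sets (atomic_measure K x w) = sets borel"
  by (simp add: atomic_measure_def)

lemma space_atomic_measure [simp]: "space (atomic_measure K x w) = UNIV"
  by (simp add: atomic_measure_def)

lemma emeasure_atomic_measure:
  assumes [measurable]: "A \<in> sets borel"
  shows "emeasure (atomic_measure K x w) A = (\<Sum>k. if k \<in> K \<and> x k \<in> A then w k else 0)"
proof -
  have "emeasure (atomic_measure K x w) A = (\<integral>\<^sup>+z. indicator A z \<partial>atomic_measure K x w)"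
    by simp
  also have "\<dots> = (\<Sum>k. if k \<in> K \<and> x k \<in> A then w k else 0)"
    by (subst nn_integral_atomic_measure) (auto intro!: suminf_cong)
  finally show ?thesis .
qed

lemma atomic_measure_integral:
  fixes g :: "real \<Rightarrow> real"
  assumes [measurable]: "g \<in> borel_measurable borel" and fin: "\<And>k. k \<in> K \<Longrightarrow> w k < \<infinity>"
  shows "integrable (atomic_measure K x w) g \<longleftrightarrow>
      summable (\<lambda>k. if k \<in> K then \<bar>enn2real (w k) * g (x k)\<bar> else 0)" (is "_ \<longleftrightarrow> ?S")
    and "integrable (atomic_measure K x w) g \<Longrightarrow>
      integral\<^sup>L (atomic_measure K x w) g = (\<Sum>k. if k \<in> K then enn2real (w k) * g (x k) else 0)"
proof -
  have d: "density (count_space K) w = density (count_space K) (\<lambda>k. ennreal (enn2real (w k)))"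
    using fin by (intro density_cong) (auto simp: AE_count_space)
  have "integrable (atomic_measure K x w) g \<longleftrightarrow> integrable (count_space K) (\<lambda>k. enn2real (w k) * g (x k))"
    unfolding atomic_measure_def d
    by (subst integrable_distr_eq) (auto simp: integrable_density)
  also have "\<dots> \<longleftrightarrow> integrable (count_space UNIV) (\<lambda>k. indicator K k *\<^sub>R (enn2real (w k) * g (x k)))"
    by (subst integrable_restrict_space[symmetric]) (auto simp: restrict_count_space)
  finally have int: "integrable (atomic_measure K x w) g \<longleftrightarrow>
      integrable (count_space UNIV) (\<lambda>k. indicator K k *\<^sub>R (enn2real (w k) * g (x k)))" .
  have eq: "(\<lambda>k. norm (indicator K k *\<^sub>R (enn2real (w k) * g (x k))))
      = (\<lambda>k. if k \<in> K then \<bar>enn2real (w k) * g (x k)\<bar> else 0)"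
    by (auto simp: fun_eq_iff indicator_def)
  show "integrable (atomic_measure K x w) g \<longleftrightarrow> ?S"
    unfolding int integrable_count_space_nat_iff eq ..
  assume "integrable (atomic_measure K x w) g"
  then have I: "integrable (count_space UNIV) (\<lambda>k. indicator K k *\<^sub>R (enn2real (w k) * g (x k)))"
    by (simp only: int)
  have "integral\<^sup>L (atomic_measure K x w) g = (\<integral>k. enn2real (w k) * g (x k) \<partial>count_space K)"
    unfolding atomic_measure_def d
    by (subst integral_distr) (auto simp: integral_density)
  also have "\<dots> = (\<integral>k. indicator K k *\<^sub>R (enn2real (w k) * g (x k)) \<partial>count_space UNIV)"
    by (subst integral_restrict_space[symmetric]) (auto simp: restrict_count_space)
  also have "\<dots> = (\<Sum>k. indicator K k *\<^sub>R (enn2real (w k) * g (x k)))"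
    by (rule integral_count_space_nat[OF I])
  also have "\<dots> = (\<Sum>k. if k \<in> K then enn2real (w k) * g (x k) else 0)"
    by (intro suminf_cong) (auto simp: indicator_def)
  finally show "integral\<^sup>L (atomic_measure K x w) g = (\<Sum>k. if k \<in> K then enn2real (w k) * g (x k) else 0)" .
qed

lemma finite_borel_measure_atomic_measure:
  assumes "(\<Sum>k. if k \<in> K then w k else 0) < \<infinity>"
  shows "finite_borel_measure (atomic_measure K x w)"
  using assms
  by (intro finite_borel_measure.intro finite_measureI finite_borel_measure_axioms.intro)
     (auto simp: emeasure_atomic_measure)

text \<open>Countable additivity on the positive and on the negative atoms separately makes the sum of
  all atoms absolutely convergent.\<close>

lemma signed_measure_summable_atoms:
  fixes \<mu> :: "real set \<Rightarrow> real"
  assumes \<mu>: "signed_measure borel \<mu>" and inj: "inj_on x K"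
  shows "summable (\<lambda>k::nat. if k \<in> K then \<bar>\<mu> {x k}\<bar> else 0)"
proof -
  have emp: "\<mu> {} = 0" using \<mu> by (simp add: signed_measure_def)
  have *: "summable (\<lambda>k. if k \<in> K' then \<mu> {x k} else 0)" if "K' \<subseteq> K" for K'
  proof -
    let ?A = "\<lambda>k. if k \<in> K' then {x k} else {}"
    have "disjoint_family ?A" "range ?A \<subseteq> sets borel"
      using inj that by (auto simp: disjoint_family_on_def inj_on_def)
    then have "(\<lambda>k. \<mu> (?A k)) sums \<mu> (\<Union>k. ?A k)"
      using \<mu> unfolding signed_measure_def by blast
    then have "summable (\<lambda>k. \<mu> (?A k))" by (simp add: sums_iff)
    also have "(\<lambda>k. \<mu> (?A k)) = (\<lambda>k. if k \<in> K' then \<mu> {x k} else 0)"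
      by (auto simp: emp)
    finally show ?thesis .
  qed
  have "summable (\<lambda>k. (if k \<in> {k\<in>K. \<mu> {x k} \<ge> 0} then \<mu> {x k} else 0) -
      (if k \<in> {k\<in>K. \<mu> {x k} < 0} then \<mu> {x k} else 0))"
    by (intro summable_diff *) auto
  also have "\<dots> = (\<lambda>k. if k \<in> K then \<bar>\<mu> {x k}\<bar> else 0)" by auto
  finally show ?thesis .
qed

text \<open>The deterministic content of a dense trap process, in terms of one enumeration of its
  points. \<open>left_infinite\<close> has two roles: it makes the random mass of every left
  half-line infinite, so that the infimum defining \<open>Z\<^sup>*\<close> is over a set bounded
  below, and it forces the difference of two solutions to vanish.\<close>

locale trap_config =
  fixes K :: "nat set" and x :: "nat \<Rightarrow> real" and y :: "nat \<Rightarrow> ennreal"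
  assumes inj: "inj_on x K"
    and y_pos: "\<And>k. k \<in> K \<Longrightarrow> 0 < y k"
    and y_fin: "\<And>k. k \<in> K \<Longrightarrow> y k < \<infinity>"
    and dense: "\<And>a b. a < b \<Longrightarrow> \<exists>k\<in>K. a < x k \<and> x k < b"
    and locally_finite: "\<And>a b. emeasure (trap_measure K x y) {a..b} < \<infinity>"
    and left_infinite: "\<exists>e>0. \<forall>L. infinite {k\<in>K. x k \<le> L \<and> ennreal e \<le> y k}"
begin

definition mass :: "nat \<Rightarrow> real" where "mass k = enn2real (y k)"

lemma ennreal_mass: "k \<in> K \<Longrightarrow> ennreal (mass k) = y k"
  using y_fin[of k] by (simp add: mass_def)

lemma mass_pos: "k \<in> K \<Longrightarrow> 0 < mass k"
  using y_pos[of k] y_fin[of k] by (simp add: mass_def enn2real_positive_iff)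

text \<open>The complement of the traps is null for the trap measure, so absolute continuity leaves
  only the atoms, and countable additivity sums them.\<close>

lemma trap_measure_absolutely_continuous:
  assumes \<mu>: "signed_measure borel \<mu>" and ac: "signed_absolutely_continuous (trap_measure K x y) \<mu>"
    and A: "A \<in> sets borel"
  shows "(\<lambda>k. if k \<in> K \<and> x k \<in> A then \<mu> {x k} else 0) sums \<mu> A"
proof -
  have emp: "\<mu> {} = 0" using \<mu> by (simp add: signed_measure_def)
  let ?J = "x ` K"
  have J: "countable ?J" by auto
  have J': "A \<inter> ?J \<in> sets borel"
    by (rule sets.countable[rotated]) (auto intro: countable_subset[OF _ J])
  have AJ: "A - ?J \<in> sets borel" using sets.Diff[OF A J'] by (simp add: Diff_Int)
  have "emeasure (trap_measure K x y) (A - ?J) = (\<Sum>k. 0)"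
    unfolding trap_measure_def emeasure_atomic_measure[OF AJ] by (intro suminf_cong) auto
  then have "A - ?J \<in> null_sets (trap_measure K x y)"
    using AJ by (auto simp: trap_measure_def null_sets_def)
  then have 0: "\<mu> (A - ?J) = 0"
    using ac unfolding signed_absolutely_continuous_def by blast
  let ?A = "\<lambda>k. if k \<in> K \<and> x k \<in> A then {x k} else {}"
  have "disjoint_family ?A" "range ?A \<subseteq> sets borel"
    using inj by (auto simp: disjoint_family_on_def inj_on_def)
  then have "(\<lambda>k. \<mu> (?A k)) sums \<mu> (\<Union>k. ?A k)"
    using \<mu> unfolding signed_measure_def by blast
  also have "(\<Union>k. ?A k) = A \<inter> ?J" by auto
  also have "(\<lambda>k. \<mu> (?A k)) = (\<lambda>k. if k \<in> K \<and> x k \<in> A then \<mu> {x k} else 0)"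
    by (auto simp: emp)
  also have "\<mu> (A \<inter> ?J) = \<mu> ((A \<inter> ?J) \<union> (A - ?J))"
    using 0 by (subst signed_measure_Un[OF \<mu> J' AJ]) auto
  also have "(A \<inter> ?J) \<union> (A - ?J) = A" by auto
  finally show ?thesis .
qed

text \<open>The explicit density \<open>g\<close> shows that the \<open>SOME\<close> is satisfiable.
  Whatever density is chosen, its integral over the singleton \<open>{x k}\<close> is its value
  there times the positive mass of the atom, which determines that value.\<close>

lemma signed_RN_deriv_trap_measure:
  assumes \<mu>: "signed_measure borel \<mu>" and ac: "signed_absolutely_continuous (trap_measure K x y) \<mu>"
    and k: "k \<in> K"
  shows "signed_RN_deriv (trap_measure K x y) \<mu> (x k) = \<mu> {x k} / mass k"
proof -
  let ?\<sigma> = "trap_measure K x y"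
  \<comment> \<open>A density is a function of the position, so the index of the trap is recovered
    by \<open>the_inv_into\<close>; off the countable set of traps the value is 0, which also yields
    measurability.\<close>
  define g where "g z = (if z \<in> x ` K then \<mu> {z} / mass (the_inv_into K x z) else 0)" for z
  have g_x: "g (x k) = \<mu> {x k} / mass k" if "k \<in> K" for k
    using that inj by (simp add: g_def the_inv_into_f_f)
  have g_meas [measurable]: "g \<in> borel_measurable borel"
    by (rule measurable_discrete_difference[of "\<lambda>_. 0" _ _ "x ` K"]) (auto simp: g_def)
  have mg: "mass k * g (x k) = \<mu> {x k}" if "k \<in> K" for k
    using mass_pos[OF that] by (simp add: g_x that)
  have set_lint: "integrable ?\<sigma> (\<lambda>z. indicator A z * g z) \<and>
      (LINT z:A|?\<sigma>. g z) = \<mu> A" if A: "A \<in> sets borel" for A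
  proof -
    have meas: "(\<lambda>z. indicator A z * g z) \<in> borel_measurable borel" using A by measurable
    have "summable (\<lambda>k. if k \<in> K then \<bar>enn2real (y k) * (indicator A (x k) * g (x k))\<bar> else 0)"
      by (rule summable_comparison_test'[OF signed_measure_summable_atoms[OF \<mu> inj], of 0])
         (auto simp: mg mass_def[symmetric] indicator_def)
    then have I: "integrable ?\<sigma> (\<lambda>z. indicator A z * g z)"
      unfolding trap_measure_def using atomic_measure_integral(1)[OF meas, of K y x] y_fin by simp
    have "(LINT z:A|?\<sigma>. g z) = (\<Sum>k. if k \<in> K then enn2real (y k) * (indicator A (x k) * g (x k)) else 0)"
      unfolding set_lebesgue_integral_def
      using atomic_measure_integral(2)[OF meas, of K y x] y_fin I by (simp add: trap_measure_def)
    also have "\<dots> = (\<Sum>k. if k \<in> K \<and> x k \<in> A then \<mu> {x k} else 0)"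
      by (intro suminf_cong) (auto simp: mg mass_def[symmetric])
    also have "\<dots> = \<mu> A"
      using trap_measure_absolutely_continuous[OF \<mu> ac A] by (simp add: sums_iff)
    finally show ?thesis using I by simp
  qed
  have "integrable ?\<sigma> g" using set_lint[of UNIV] by simp
  then have "\<exists>g. integrable ?\<sigma> g \<and> (\<forall>A\<in>sets ?\<sigma>. \<mu> A = (LINT z:A|?\<sigma>. g z))"
    using set_lint by (intro exI[of _ g] conjI ballI) (auto simp: trap_measure_def)
  then have h: "integrable ?\<sigma> (signed_RN_deriv ?\<sigma> \<mu>) \<and>
      (\<forall>A\<in>sets ?\<sigma>. \<mu> A = (LINT z:A|?\<sigma>. signed_RN_deriv ?\<sigma> \<mu> z))"
    unfolding signed_RN_deriv_def by (rule someI_ex)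
  have "{x k} \<in> sets ?\<sigma>" by (simp add: trap_measure_def)
  note h = conjunct1[OF h] bspec[OF conjunct2[OF h] this]
  let ?h = "signed_RN_deriv ?\<sigma> \<mu>"
  have [measurable]: "?h \<in> borel_measurable borel"
    using borel_measurable_integrable[OF h(1)] by (simp add: trap_measure_def cong: measurable_cong_sets)
  have I: "integrable ?\<sigma> (\<lambda>z. indicator {x k} z * ?h z)"
    using integrable_mult_indicator[OF _ h(1), of "{x k}"] by (simp add: trap_measure_def)
  have "\<mu> {x k} = (\<Sum>j. if j \<in> K then enn2real (y j) * (indicator {x k} (x j) * ?h (x j)) else 0)"
    using h(2) unfolding set_lebesgue_integral_def
    using atomic_measure_integral(2)[of "\<lambda>z. indicator {x k} z * ?h z" K y x] y_fin I
    by (simp add: trap_measure_def)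
  also have "\<dots> = (\<Sum>j. if j = k then mass k * ?h (x k) else 0)"
    using inj_onD[OF inj _ _ k] k by (intro suminf_cong) (auto simp: mass_def indicator_def)
  also have "\<dots> = mass k * ?h (x k)"
    using sums_single[of k "\<lambda>_. mass k * ?h (x k)"] by (simp add: sums_iff)
  finally show ?thesis using mass_pos[OF k] by simp
qed

end

section \<open>Uniqueness\<close>

lemma summable_restrict:
  fixes e :: "nat \<Rightarrow> real"
  assumes "summable (\<lambda>k. \<bar>e k\<bar>)"
  shows "summable (\<lambda>k. \<bar>if P k then e k else 0\<bar>)" "summable (\<lambda>k. if P k then e k else 0)"
proof -
  show 1: "summable (\<lambda>k. \<bar>if P k then e k else 0\<bar>)"
    by (rule summable_comparison_test'[OF assms, of 0]) auto
  show "summable (\<lambda>k. if P k then e k else 0)"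
    by (rule summable_norm_cancel) (use 1 in simp)
qed

text \<open>Expand the square over ordered pairs. By \<open>dist\<close>, two distinct indices with
  nonzero jumps satisfy exactly one of \<open>x l \<le> x k\<close> and
  \<open>x k \<le> x l\<close>, so twice the ordered sum exceeds the square by the diagonal
  \<open>\<Sum>k<n. e k * e k\<close>, which is nonnegative.\<close>

lemma sum_mult_sum_le_ordered:
  fixes e :: "nat \<Rightarrow> real" and x :: "nat \<Rightarrow> real"
  assumes dist: "\<And>k l. e k \<noteq> 0 \<Longrightarrow> e l \<noteq> 0 \<Longrightarrow> x k = x l \<Longrightarrow> k = l"
  shows "(\<Sum>k<n. e k)\<^sup>2 \<le> 2 * (\<Sum>k<n. e k * (\<Sum>l<n. if x l \<le> x k then e l else 0))"
proof -
  let ?A = "\<Sum>k<n. \<Sum>l<n. if x l \<le> x k then e k * e l else 0"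
  have split: "e k * e l = (if x l \<le> x k then e k * e l else 0)
      + (if x k \<le> x l then e k * e l else 0) - (if k = l then e k * e l else 0)" for k l
    using dist[of k l] by (cases "k = l"; cases "e k * e l = 0") (auto simp: not_le)
  have "(\<Sum>k<n. e k)\<^sup>2 = (\<Sum>k<n. \<Sum>l<n. e k * e l)"
    by (simp add: power2_eq_square sum_product)
  also have "\<dots> = (\<Sum>k<n. \<Sum>l<n. (if x l \<le> x k then e k * e l else 0)
      + (if x k \<le> x l then e k * e l else 0) - (if k = l then e k * e l else 0))"
    by (intro sum.cong refl split)
  also have "\<dots> = ?A + (\<Sum>k<n. \<Sum>l<n. if x k \<le> x l then e k * e l else 0)
      - (\<Sum>k<n. \<Sum>l<n. if k = l then e k * e l else 0)"
    by (simp only: sum.distrib sum_subtractf)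
  also have "(\<Sum>k<n. \<Sum>l<n. if x k \<le> x l then e k * e l else 0) = ?A"
    by (subst sum.swap) (auto intro!: sum.cong simp: mult.commute)
  also have "(\<Sum>k<n. \<Sum>l<n. if k = l then e k * e l else 0) = (\<Sum>k<n. e k * e k)"
    by (intro sum.cong refl) simp
  also have "?A + ?A - (\<Sum>k<n. e k * e k) \<le> 2 * ?A"
    by (simp add: sum_nonneg)
  also have "?A = (\<Sum>k<n. e k * (\<Sum>l<n. if x l \<le> x k then e l else 0))"
    unfolding sum_distrib_left by (intro sum.cong refl) simp
  finally show ?thesis .
qed

text \<open>The convexity inequality \<open>f(p)\<^sup>2 - f(p-)\<^sup>2 \<le> 2 f(p) (f(p) - f(p-))\<close> at every jump \<open>p\<close>,
  summed over the jumps of a pure jump function.\<close>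

lemma pure_jump_square_increment_le:
  fixes e f x :: "nat \<Rightarrow> real" and A B :: real
  assumes summ: "summable (\<lambda>k. \<bar>e k\<bar>)"
    and dist: "\<And>k l. e k \<noteq> 0 \<Longrightarrow> e l \<noteq> 0 \<Longrightarrow> x k = x l \<Longrightarrow> k = l"
    and f: "\<And>k. e k \<noteq> 0 \<Longrightarrow> (\<lambda>l. if x l \<le> x k then e l else 0) sums (f k - A)"
    and B: "e sums (B - A)"
    and ef: "summable (\<lambda>k. e k * f k)"
  shows "B\<^sup>2 - A\<^sup>2 \<le> 2 * (\<Sum>k. e k * f k)"
proof -
  \<comment> \<open>\<open>S n k\<close> stands for \<open>f k - A\<close> when only the first
    \<open>n\<close> jumps are present. The error is at most the tail \<open>R n\<close>, uniformly
    in \<open>k\<close>, so the finite inequality survives the limit.\<close>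
  define S where "S n k = (\<Sum>l<n. if x l \<le> x k then e l else 0)" for n k
  define R where "R n = (\<Sum>l. \<bar>e (l + n)\<bar>)" for n
  define E where "E = (\<Sum>k. \<bar>e k\<bar>)"
  have E: "(\<Sum>k<n. \<bar>e k\<bar>) \<le> E" for n
    unfolding E_def by (intro sum_le_suminf summ) auto
  have R0: "R \<longlonglongrightarrow> 0"
    unfolding R_def by (rule suminf_exist_split2[OF summ])
  have RE: "(\<lambda>n. E * R n) \<longlonglongrightarrow> 0"
    using tendsto_mult_left[OF R0, of E] by simp
  have R_nonneg: "0 \<le> R n" for n
    unfolding R_def by (intro suminf_nonneg summable_ignore_initial_segment[OF summ]) auto
  have tail: "\<bar>S n k - (f k - A)\<bar> \<le> R n" if k: "e k \<noteq> 0" for n k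
  proof -
    let ?g = "\<lambda>l. if x l \<le> x k then e l else 0"
    have g: "summable (\<lambda>l. \<bar>?g l\<bar>)" "summable ?g" using summable_restrict[OF summ] by auto
    have "f k - A = (\<Sum>l. ?g (l + n)) + S n k"
      using f[OF k] suminf_split_initial_segment[OF g(2), of n] by (simp add: sums_iff S_def)
    then have "\<bar>S n k - (f k - A)\<bar> = \<bar>\<Sum>l. ?g (l + n)\<bar>" by simp
    also have "\<dots> \<le> (\<Sum>l. \<bar>?g (l + n)\<bar>)"
      by (rule summable_rabs[OF summable_ignore_initial_segment[OF g(1)]])
    also have "\<dots> \<le> R n"
      unfolding R_def
      by (intro suminf_le summable_ignore_initial_segment[OF g(1)] summable_ignore_initial_segment[OF summ]) auto
    finally show ?thesis .
  qed
  have fin: "(\<Sum>k<n. e k)\<^sup>2 \<le> 2 * (\<Sum>k<n. e k * f k) - 2 * A * (\<Sum>k<n. e k) + 2 * (E * R n)" for n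
  proof -
    have "(\<Sum>k<n. e k)\<^sup>2 \<le> 2 * (\<Sum>k<n. e k * S n k)"
      unfolding S_def by (rule sum_mult_sum_le_ordered[OF dist])
    also have "(\<Sum>k<n. e k * S n k) = (\<Sum>k<n. e k * (f k - A)) + (\<Sum>k<n. e k * (S n k - (f k - A)))"
      by (simp add: sum.distrib[symmetric] algebra_simps)
    also have "(\<Sum>k<n. e k * (S n k - (f k - A))) \<le> (\<Sum>k<n. \<bar>e k\<bar> * R n)"
    proof (rule sum_mono)
      fix k
      have "e k * (S n k - (f k - A)) \<le> \<bar>e k\<bar> * \<bar>S n k - (f k - A)\<bar>"
        unfolding abs_mult[symmetric] by (rule abs_ge_self)
      also have "\<dots> \<le> \<bar>e k\<bar> * R n"
        using tail[of k n] by (cases "e k = 0") (auto intro!: mult_left_mono)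
      finally show "e k * (S n k - (f k - A)) \<le> \<bar>e k\<bar> * R n" .
    qed
    also have "\<dots> \<le> E * R n"
      unfolding sum_distrib_right[symmetric] using E R_nonneg by (intro mult_right_mono)
    also have "(\<Sum>k<n. e k * (f k - A)) = (\<Sum>k<n. e k * f k) - A * (\<Sum>k<n. e k)"
      by (simp add: algebra_simps sum_subtractf sum_distrib_left)
    finally show ?thesis by (simp add: algebra_simps)
  qed
  have "(B - A)\<^sup>2 \<le> 2 * (\<Sum>k. e k * f k) - 2 * A * (B - A) + 2 * 0"
  proof (rule LIMSEQ_le)
    show "(\<lambda>n. (\<Sum>k<n. e k)\<^sup>2) \<longlonglongrightarrow> (B - A)\<^sup>2"
      using B unfolding sums_def by (intro tendsto_power)
    show "(\<lambda>n. 2 * (\<Sum>k<n. e k * f k) - 2 * A * (\<Sum>k<n. e k) + 2 * (E * R n))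
        \<longlonglongrightarrow> 2 * (\<Sum>k. e k * f k) - 2 * A * (B - A) + 2 * 0"
      using B summable_LIMSEQ[OF ef] RE unfolding sums_def
      by (intro tendsto_add tendsto_diff tendsto_mult tendsto_const) auto
  qed (use fin in auto)
  \<comment> \<open>\<open>(B - A)^2 + 2 * A * (B - A) = B^2 - A^2\<close>.\<close>
  then show ?thesis by (simp add: power2_eq_square algebra_simps)
qed

context trap_config
begin

text \<open>\<open>H T z = \<integral>\<^sub>0\<^sup>T w(t,z)\<^sup>2 dt\<close> is nonincreasing in \<open>z\<close>, and its decrease controls the
  energy at time \<open>T\<close>; the infinite trap mass on the left then forces \<open>H = 0\<close>.\<close>

lemma zero_of_zero_initial_value:
  fixes w :: "real \<Rightarrow> real \<Rightarrow> real" and d :: "real \<Rightarrow> nat \<Rightarrow> real"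
  assumes w0: "\<And>z. w 0 z = 0"
    and bd: "\<And>t z. t \<ge> 0 \<Longrightarrow> \<bar>w t z\<bar> \<le> B"
    and incr: "\<And>t a b. t > 0 \<Longrightarrow> a \<le> b \<Longrightarrow>
      (\<lambda>k. if k \<in> K \<and> x k \<in> {a<..b} then mass k * d t k else 0) sums (w t b - w t a)"
    and dsum: "\<And>t n. t \<ge> 0 \<Longrightarrow> (\<Sum>k<n. if k \<in> K then mass k * \<bar>d t k\<bar> else 0) \<le> C"
    and der: "\<And>k t. k \<in> K \<Longrightarrow> t \<ge> 0 \<Longrightarrow>
      ((\<lambda>s. w s (x k)) has_vector_derivative - d t k) (at t within {0..})"
    and k: "k \<in> K" and t: "t \<ge> 0"
  shows "w t (x k) = 0"
proof -
  define H where "H T z = integral {0..T} (\<lambda>t. (w t z)\<^sup>2)" for T z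
  have B: "0 \<le> B" using bd[of 0 0] by simp
  have cont: "continuous_on {0..T} (\<lambda>t. w t (x k))" if "k \<in> K" for k T
  proof (rule continuous_on_subset)
    show "continuous_on {0..} (\<lambda>t. w t (x k))"
      using der[OF that] by (intro continuous_on_vector_derivative) auto
  qed auto
  have int2: "(\<lambda>t. (w t (x k))\<^sup>2) integrable_on {0..T}" if "k \<in> K" for k T
    by (intro integrable_continuous_real continuous_on_power cont that)
  have sq_le: "(w t z)\<^sup>2 \<le> B\<^sup>2" if "t \<ge> 0" for t z
    using bd[OF that, of z] B by (simp add: abs_le_square_iff[symmetric])
  have dsummable: "summable (\<lambda>k. \<bar>if k \<in> K then mass k * d t k else 0\<bar>)" if "t \<ge> 0" for t
  proof (rule summableI_nonneg_bounded)
    show "(\<Sum>k<n. \<bar>if k \<in> K then mass k * d t k else 0\<bar>) \<le> C" for n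
      using dsum[OF that, of n] mass_pos
      by (simp add: abs_mult if_distrib less_imp_le cong: if_cong sum.cong)
  qed auto
  \<comment> \<open>The square inequality is integrated over \<open>{0..T}\<close> term by term.
    Since \<open>d t k\<close> is minus the time derivative, each term \<open>r t k\<close> is the
    derivative of \<open>- mass k * (w t (x k))^2\<close>, and the contribution of time 0
    vanishes.\<close>
  have energy: "(\<Sum>k<n. if k \<in> K \<and> x k \<in> {x i<..x j} then mass k * (w T (x k))\<^sup>2 else 0)
      \<le> H T (x i) - H T (x j)"
    if ij: "i \<in> K" "j \<in> K" "x i \<le> x j" and T: "T \<ge> 0" for i j n T
  proof -
    let ?I = "\<lambda>k. k \<in> K \<and> x k \<in> {x i<..x j}"
    define r where "r t k = (if ?I k then 2 * (mass k * d t k * w t (x k)) else 0)" for t k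
    have r_le: "\<bar>r t k\<bar> \<le> 2 * B * \<bar>if k \<in> K then mass k * d t k else 0\<bar>" if "t \<ge> 0" for t k
    proof -
      have "\<bar>mass k * d t k\<bar> * \<bar>w t (x k)\<bar> \<le> \<bar>mass k * d t k\<bar> * B"
        by (intro mult_left_mono bd that) auto
      then show ?thesis by (simp add: r_def abs_mult mult_ac B)
    qed
    have r_summable: "summable (r t)" if "t \<ge> 0" for t
    proof (rule summable_norm_cancel, rule summable_comparison_test'[where N = 0])
      show "summable (\<lambda>k. 2 * B * \<bar>if k \<in> K then mass k * d t k else 0\<bar>)"
        by (intro summable_mult dsummable that)
    qed (use r_le[OF that] in auto)
    have sq: "(w t (x j))\<^sup>2 - (w t (x i))\<^sup>2 \<le> (\<Sum>k. r t k)" if "t \<in> {0..T}" for t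
    proof (cases "t = 0")
      case True
      then show ?thesis by (simp add: w0 r_def cong: if_cong)
    next
      case False
      with that have t: "t > 0" by simp
      let ?e = "\<lambda>k. if ?I k then mass k * d t k else 0"
      have r: "r t = (\<lambda>k. 2 * (?e k * w t (x k)))" by (auto simp: r_def)
      have er: "summable (\<lambda>k. ?e k * w t (x k))"
        using summable_mult[OF r_summable[of t], of "1/2"] t by (simp add: r)
      have "(w t (x j))\<^sup>2 - (w t (x i))\<^sup>2 \<le> 2 * (\<Sum>k. ?e k * w t (x k))"
      proof (rule pure_jump_square_increment_le)
        show "summable (\<lambda>k. \<bar>?e k\<bar>)"
          using summable_restrict(1)[OF dsummable[OF less_imp_le[OF t]], of "\<lambda>k. x k \<in> {x i<..x j}"]
          by (rule back_subst[of summable]) auto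
        show "?e k \<noteq> 0 \<Longrightarrow> ?e l \<noteq> 0 \<Longrightarrow> x k = x l \<Longrightarrow> k = l" for k l
          using inj by (auto simp: inj_on_def split: if_splits)
        show "?e sums (w t (x j) - w t (x i))" using incr[OF t ij(3)] by simp
        show "(\<lambda>l. if x l \<le> x k then ?e l else 0) sums (w t (x k) - w t (x i))" if "?e k \<noteq> 0" for k
        proof -
          have ik: "x i < x k" "x k \<le> x j" using that by (auto split: if_splits)
          show ?thesis
            using incr[OF t less_imp_le[OF ik(1)]]
            by (rule back_subst[of "\<lambda>f. f sums _"]) (use ik in auto)
        qed
      qed (rule er)
      also have "\<dots> = (\<Sum>k. r t k)"
        unfolding r by (rule suminf_mult[symmetric]) (rule er)
      finally show ?thesis .
    qed
    have r_int: "((\<lambda>t. r t k) has_integral (if ?I k then - (mass k * (w T (x k))\<^sup>2) else 0)) {0..T}" for k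
    proof (cases "?I k")
      case True
      then have kK: "k \<in> K" by auto
      have "((\<lambda>t. r t k) has_integral - (mass k * (w T (x k))\<^sup>2) - - (mass k * (w 0 (x k))\<^sup>2)) {0..T}"
      proof (rule fundamental_theorem_of_calculus[OF T])
        fix t assume t: "t \<in> {0..T}"
        have D: "((\<lambda>s. w s (x k)) has_real_derivative - d t k) (at t within {0..T})"
          using der[OF kK, of t] t
          by (auto simp: has_real_derivative_iff_has_vector_derivative intro: has_vector_derivative_within_subset)
        have "((\<lambda>s. - (mass k * (w s (x k))\<^sup>2)) has_real_derivative r t k) (at t within {0..T})"
          by (rule derivative_eq_intros D refl)+ (use True in \<open>simp add: r_def\<close>)
        then show "((\<lambda>s. - (mass k * (w s (x k))\<^sup>2)) has_vector_derivative r t k) (at t within {0..T})"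
          by (simp add: has_real_derivative_iff_has_vector_derivative)
      qed
      then show ?thesis using True by (simp add: w0)
    qed (auto simp: r_def)
    define f where "f n t = (\<Sum>k<n. r t k)" for n t
    have f_int: "(f n has_integral - (\<Sum>k<n. if ?I k then mass k * (w T (x k))\<^sup>2 else 0)) {0..T}" for n
      unfolding f_def sum_negf[symmetric]
      by (rule has_integral_eq_rhs[OF has_integral_sum[OF _ r_int]]) (auto intro!: sum.cong)
    \<comment> \<open>The bound \<open>C\<close> on the absolute sums is uniform in time, so the
      constant \<open>2 * B * C\<close> dominates all partial sums.\<close>
    have f_le: "norm (f n t) \<le> 2 * B * C" if "t \<in> {0..T}" for n t
    proof -
      have "\<bar>f n t\<bar> \<le> (\<Sum>k<n. \<bar>r t k\<bar>)" unfolding f_def by (rule sum_abs)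
      also have "\<dots> \<le> (\<Sum>k<n. 2 * B * (if k \<in> K then mass k * \<bar>d t k\<bar> else 0))"
      proof (rule sum_mono)
        fix k
        show "\<bar>r t k\<bar> \<le> 2 * B * (if k \<in> K then mass k * \<bar>d t k\<bar> else 0)"
          using r_le[of t k] that mass_pos[of k] by (cases "k \<in> K") (simp_all add: abs_mult)
      qed
      also have "\<dots> \<le> 2 * B * C"
        unfolding sum_distrib_left[symmetric] using dsum[of t n] that B by (intro mult_left_mono) auto
      finally show ?thesis by simp
    qed
    have f_lim: "(\<lambda>n. f n t) \<longlonglongrightarrow> (\<Sum>k. r t k)" if "t \<in> {0..T}" for t
      unfolding f_def using r_summable[of t] that by (intro summable_LIMSEQ) auto
    have fi: "f n integrable_on {0..T}" for n using f_int[of n] by blast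
    have hi: "(\<lambda>t. 2 * B * C) integrable_on {0..T}" by (rule integrable_const_ivl)
    note dc = dominated_convergence[of f "{0..T}" "\<lambda>t. 2 * B * C" "\<lambda>t. \<Sum>k. r t k", OF fi hi f_le f_lim]
    have "H T (x j) - H T (x i) = integral {0..T} (\<lambda>t. (w t (x j))\<^sup>2 - (w t (x i))\<^sup>2)"
      unfolding H_def by (intro integral_diff[symmetric] int2 ij)
    also have "\<dots> \<le> integral {0..T} (\<lambda>t. \<Sum>k. r t k)"
      by (intro integral_le integrable_diff int2 ij dc sq) auto
    \<comment> \<open>The integrals of the partial sums are nonincreasing, so their limit lies below
      each of them.\<close>
    also have "\<dots> \<le> - (\<Sum>k<n. if ?I k then mass k * (w T (x k))\<^sup>2 else 0)"
    proof (rule LIMSEQ_le_const2[OF dc(2)])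
      show "\<exists>N. \<forall>m\<ge>N. integral {0..T} (f m) \<le> - (\<Sum>k<n. if ?I k then mass k * (w T (x k))\<^sup>2 else 0)"
      proof (intro exI[of _ n] allI impI)
        fix m assume "m \<ge> n"
        then have "(\<Sum>k<n. if ?I k then mass k * (w T (x k))\<^sup>2 else 0)
            \<le> (\<Sum>k<m. if ?I k then mass k * (w T (x k))\<^sup>2 else 0)"
          using mass_pos by (intro sum_mono2) (auto simp: less_imp_le)
        then show "integral {0..T} (f m) \<le> - (\<Sum>k<n. if ?I k then mass k * (w T (x k))\<^sup>2 else 0)"
          using integral_unique[OF f_int[of m]] by simp
      qed
    qed
    finally show ?thesis by simp
  qed
  have H_nonneg: "0 \<le> H T (x i)" if "i \<in> K" for T i
    unfolding H_def by (intro integral_nonneg int2 that) auto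
  have H_mono: "H T (x j) \<le> H T (x i)" if "i \<in> K" "j \<in> K" "x i \<le> x j" "T \<ge> 0" for i j T
    using energy[OF that, of 0] by simp
  have H_le: "H T (x i) \<le> T * B\<^sup>2" if "T \<ge> 0" "i \<in> K" for i T
  proof -
    have "H T (x i) \<le> integral {0..T} (\<lambda>_. B\<^sup>2)"
      unfolding H_def using that by (intro integral_le int2 integrable_const_ivl sq_le) auto
    then show ?thesis using that by simp
  qed
  \<comment> \<open>The interval \<open>{0..S}\<close> contains \<open>t\<close> and is
    nondegenerate also when \<open>t = 0\<close>; vanishing of the integral then forces the
    continuous integrand to vanish at \<open>t\<close>.\<close>
  define S where "S = t + 1"
  have S: "S > 0" using t by (simp add: S_def)
  \<comment> \<open>The second time integration. For a trap \<open>j\<close> of \<open>F\<close>,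
    \<open>H S (x j)\<close> is at least \<open>H S (x k)\<close>, while the energy of
    \<open>F\<close> at any time up to \<open>S\<close> is at most \<open>S * B^2\<close>,
    independently of \<open>F\<close>.\<close>
  have finite_bound: "(\<Sum>k\<in>F. mass k) * H S (x k) \<le> S * (S * B\<^sup>2)"
    if F: "finite F" "F \<subseteq> {i\<in>K. x i \<le> x k}" for F
  proof -
    \<comment> \<open>The left end must itself be a trap, because \<open>w\<close> is known to be
      continuous in time only there.\<close>
    obtain i where i: "i \<in> K" "x i < x k" "\<And>j. j \<in> F \<Longrightarrow> x i < x j"
    proof -
      obtain i where "i \<in> K" "Min (insert (x k) (x ` F)) - 1 < x i" "x i < Min (insert (x k) (x ` F))"
        using dense[of "Min (insert (x k) (x ` F)) - 1" "Min (insert (x k) (x ` F))"] by auto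
      then show ?thesis using F(1) by (intro that[of i]) auto
    qed
    have at_T: "(\<Sum>j\<in>F. mass j * (w T (x j))\<^sup>2) \<le> S * B\<^sup>2" if T: "T \<in> {0..S}" for T
    proof -
      obtain n where n: "F \<subseteq> {..<n}" using finite_nat_iff_bounded[of F] F(1) by auto
      have "(\<Sum>j\<in>F. mass j * (w T (x j))\<^sup>2)
          = (\<Sum>j\<in>F. if j \<in> K \<and> x j \<in> {x i<..x k} then mass j * (w T (x j))\<^sup>2 else 0)"
        using F i by (intro sum.cong) auto
      also have "\<dots> \<le> (\<Sum>j<n. if j \<in> K \<and> x j \<in> {x i<..x k} then mass j * (w T (x j))\<^sup>2 else 0)"
        using n mass_pos by (intro sum_mono2) (auto simp: less_imp_le)
      also have "\<dots> \<le> H T (x i) - H T (x k)"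
        using energy[of i k T n] i k T by auto
      also have "\<dots> \<le> T * B\<^sup>2" using H_le[of T i] H_nonneg[OF k, of T] i T by auto
      also have "\<dots> \<le> S * B\<^sup>2" using T by (intro mult_right_mono) auto
      finally show ?thesis .
    qed
    have "(\<Sum>j\<in>F. mass j) * H S (x k) \<le> (\<Sum>j\<in>F. mass j * H S (x j))"
      unfolding sum_distrib_right
      using F k S mass_pos by (intro sum_mono mult_left_mono H_mono) (auto simp: less_imp_le)
    also have "\<dots> = (\<Sum>j\<in>F. integral {0..S} (\<lambda>T. mass j * (w T (x j))\<^sup>2))"
      by (simp add: H_def)
    also have "\<dots> = integral {0..S} (\<lambda>T. \<Sum>j\<in>F. mass j * (w T (x j))\<^sup>2)"
      using F by (intro integral_sum[symmetric] integrable_on_mult_right int2) auto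
    also have "\<dots> \<le> integral {0..S} (\<lambda>_. S * B\<^sup>2)"
      using F by (intro integral_le integrable_sum integrable_on_mult_right int2 integrable_const_ivl at_T) auto
    also have "\<dots> = S * (S * B\<^sup>2)" using S by simp
    finally show ?thesis .
  qed
  have "H S (x k) = 0"
  proof (rule ccontr)
    assume "H S (x k) \<noteq> 0"
    then have pos: "H S (x k) > 0" using H_nonneg[OF k, of S] by simp
    obtain e where e: "e > 0" "infinite {i\<in>K. x i \<le> x k \<and> ennreal e \<le> y i}"
      using left_infinite by blast
    obtain n where n: "S * (S * B\<^sup>2) < of_nat n * (e * H S (x k))"
      using ex_less_of_nat_mult[of "e * H S (x k)" "S * (S * B\<^sup>2)"] pos e by auto
    obtain F where F: "finite F" "card F = n" "F \<subseteq> {i\<in>K. x i \<le> x k \<and> ennreal e \<le> y i}"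
      using infinite_arbitrarily_large[OF e(2), of n] by auto
    have "of_nat n * e \<le> (\<Sum>j\<in>F. mass j)"
    proof -
      have "e \<le> mass j" if "j \<in> F" for j
      proof -
        have j: "j \<in> K" "ennreal e \<le> y j" using F(3) that by auto
        then show ?thesis
          using ennreal_mass[OF j(1)] mass_pos[OF j(1)] by (metis ennreal_le_iff less_imp_le)
      qed
      then have "(\<Sum>j\<in>F. e) \<le> (\<Sum>j\<in>F. mass j)" by (rule sum_mono)
      then show ?thesis using F by simp
    qed
    then have "of_nat n * e * H S (x k) \<le> (\<Sum>j\<in>F. mass j) * H S (x k)"
      using pos by (intro mult_right_mono) auto
    also have "\<dots> \<le> S * (S * B\<^sup>2)" using F by (intro finite_bound) auto
    finally show False using n by (simp add: mult_ac)
  qed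
  then have "\<forall>s\<in>{0..S}. (w s (x k))\<^sup>2 = 0"
    unfolding H_def using S
    by (subst (asm) integral_eq_0_iff) (auto intro!: continuous_on_power cont k)
  then show ?thesis using t by (auto simp: S_def)
qed

text \<open>\<open>f\<close> is arbitrary: cut down to the countable set of traps it is measurable.
  This matters for \<open>time_deriv\<close>, whose values off the traps are meaningless.\<close>

lemma nn_integral_traps:
  "(\<integral>\<^sup>+z\<in>x ` K. f z \<partial>trap_measure K x y) = (\<Sum>k. if k \<in> K then y k * f (x k) else 0)"
proof -
  have [measurable]: "(\<lambda>z. f z * indicator (x ` K) z) \<in> borel_measurable borel"
    by (rule measurable_discrete_difference[of "\<lambda>_. 0" _ _ "x ` K"]) auto
  show ?thesis
    unfolding trap_measure_def
    by (subst nn_integral_atomic_measure) (auto intro!: suminf_cong)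
qed

text \<open>Multiplied by the trap mass, the evolution equation says that
  \<open>- time_deriv\<close> gives the atom of \<open>v(t,dx)\<close> at each trap, and by absolute
  continuity the atoms make up the whole measure.\<close>

lemma trap_evolution_increments:
  assumes v: "trap_evolution (x ` K) (trap_measure K x y) u v" and t: "0 < t" and ab: "a \<le> b"
  shows "(\<lambda>k. if k \<in> K \<and> x k \<in> {a<..b} then mass k * - time_deriv v t (x k) else 0)
    sums (v t b - v t a)"
proof -
  let ?\<mu> = "stieltjes_measure (v t)"
  have bv: "right_cont_left_limits (v t)" "bounded_variation (v t)"
    and ac: "signed_absolutely_continuous (trap_measure K x y) ?\<mu>"
    and D: "\<And>k. k \<in> K \<Longrightarrow> - time_deriv v t (x k) = signed_RN_deriv (trap_measure K x y) ?\<mu> (x k)"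
    using v t unfolding trap_evolution_def by auto
  note \<mu> = stieltjes_measure[OF bv]
  have "mass k * - time_deriv v t (x k) = ?\<mu> {x k}" if "k \<in> K" for k
    using D[OF that] signed_RN_deriv_trap_measure[OF \<mu>(1) ac that] mass_pos[OF that] by simp
  then have "(\<lambda>k. if k \<in> K \<and> x k \<in> {a<..b} then mass k * - time_deriv v t (x k) else 0)
      = (\<lambda>k. if k \<in> K \<and> x k \<in> {a<..b} then ?\<mu> {x k} else 0)"
    by (simp cong: if_cong)
  also have "\<dots> sums ?\<mu> {a<..b}"
    by (rule trap_measure_absolutely_continuous[OF \<mu>(1) ac]) simp
  also have "?\<mu> {a<..b} = v t b - v t a" by (rule \<mu>(2)[OF ab])
  finally show ?thesis .
qed

lemma trap_evolution_derivative:
  assumes v: "trap_evolution (x ` K) (trap_measure K x y) u v" and t: "0 \<le> t" and k: "k \<in> K"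
  shows "((\<lambda>s. v s (x k)) has_vector_derivative time_deriv v t (x k)) (at t within {0..})"
proof -
  have "(\<lambda>s. v s (x k)) differentiable (at t within {0..})"
    using v t k unfolding trap_evolution_def differentiable_on_def by auto
  then show ?thesis
    unfolding time_deriv_def by (simp add: vector_derivative_works)
qed

lemma trap_evolution_derivative_bound:
  assumes v: "trap_evolution (x ` K) (trap_measure K x y) u v"
  shows "\<exists>C. \<forall>t n. 0 \<le> t \<longrightarrow>
    (\<Sum>k<n. if k \<in> K then mass k * \<bar>time_deriv v t (x k)\<bar> else 0) \<le> C"
proof -
  define S where "S = (SUP t\<in>{0..}. \<integral>\<^sup>+z\<in>x ` K. ennreal \<bar>time_deriv v t z\<bar> \<partial>trap_measure K x y)"
  have S: "S < \<infinity>" using v unfolding trap_evolution_def S_def by auto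
  show ?thesis
  proof (intro exI[of _ "enn2real S"] allI impI)
    fix t :: real and n :: nat assume t: "0 \<le> t"
    let ?f = "\<lambda>k. if k \<in> K then mass k * \<bar>time_deriv v t (x k)\<bar> else 0"
    have "ennreal (\<Sum>k<n. ?f k) = (\<Sum>k<n. ennreal (?f k))"
      using mass_pos by (intro sum_ennreal[symmetric]) (auto simp: less_imp_le)
    also have "\<dots> = (\<Sum>k<n. if k \<in> K then y k * ennreal \<bar>time_deriv v t (x k)\<bar> else 0)"
      using mass_pos by (intro sum.cong) (auto simp: ennreal_mult ennreal_mass less_imp_le)
    also have "\<dots> \<le> (\<Sum>k. if k \<in> K then y k * ennreal \<bar>time_deriv v t (x k)\<bar> else 0)"
      by (intro sum_le_suminf) auto
    also have "\<dots> = (\<integral>\<^sup>+z\<in>x ` K. ennreal \<bar>time_deriv v t z\<bar> \<partial>trap_measure K x y)"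
      by (rule nn_integral_traps[symmetric])
    also have "\<dots> \<le> S"
      unfolding S_def using t by (intro SUP_upper) auto
    also have "S = ennreal (enn2real S)" using S by simp
    finally show "(\<Sum>k<n. ?f k) \<le> enn2real S" by (simp add: ennreal_le_iff)
  qed
qed

theorem trap_evolution_unique:
  assumes v: "trap_evolution (x ` K) (trap_measure K x y) u v"
    and v': "trap_evolution (x ` K) (trap_measure K x y) u v'"
    and t: "0 \<le> t"
  shows "v t z = v' t z"
proof (cases "t = 0")
  case True
  then show ?thesis using v v' unfolding trap_evolution_def by simp
next
  case False
  with t have t: "0 < t" by simp
  let ?w = "\<lambda>t z. v t z - v' t z"
  \<comment> \<open>The order is reversed because \<open>d\<close> denotes minus the time derivative
    of the difference.\<close>
  let ?d = "\<lambda>t k. time_deriv v' t (x k) - time_deriv v t (x k)"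
  obtain C where C: "\<And>t n. 0 \<le> t \<Longrightarrow>
      (\<Sum>k<n. if k \<in> K then mass k * \<bar>time_deriv v t (x k)\<bar> else 0) \<le> C"
    using trap_evolution_derivative_bound[OF v] by blast
  obtain C' where C': "\<And>t n. 0 \<le> t \<Longrightarrow>
      (\<Sum>k<n. if k \<in> K then mass k * \<bar>time_deriv v' t (x k)\<bar> else 0) \<le> C'"
    using trap_evolution_derivative_bound[OF v'] by blast
  have "bounded {v t x |t x. 0 \<le> t}" "bounded {v' t x |t x. 0 \<le> t}"
    using v v' unfolding trap_evolution_def by blast+
  then obtain B B' where BB': "\<forall>r\<in>{v t x |t x. 0 \<le> t}. \<bar>r\<bar> \<le> B" "\<forall>r\<in>{v' t x |t x. 0 \<le> t}. \<bar>r\<bar> \<le> B'"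
    unfolding bounded_iff real_norm_def by blast
  have B: "\<bar>v t z\<bar> \<le> B" and B': "\<bar>v' t z\<bar> \<le> B'" if "0 \<le> t" for t z
    using BB' that by blast+
  have on_traps: "?w t (x k) = 0" if k: "k \<in> K" for k
  proof (rule zero_of_zero_initial_value[of ?w "B + B'" ?d "C + C'"])
    show "?w 0 z = 0" for z using v v' unfolding trap_evolution_def by simp
    show "\<bar>?w t z\<bar> \<le> B + B'" if "t \<ge> 0" for t z
      using B[OF that, of z] B'[OF that, of z] by linarith
    show "(\<lambda>k. if k \<in> K \<and> x k \<in> {a<..b} then mass k * ?d t k else 0) sums (?w t b - ?w t a)"
      if "t > 0" "a \<le> b" for t a b
    proof -
      have "v t b - v t a - (v' t b - v' t a) = ?w t b - ?w t a" by simp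
      from sums_diff[OF trap_evolution_increments[OF v that] trap_evolution_increments[OF v' that],
          unfolded this]
      show ?thesis
        by (rule back_subst[of "\<lambda>f. f sums _"]) (auto simp: fun_eq_iff algebra_simps)
    qed
    show "(\<Sum>k<n. if k \<in> K then mass k * \<bar>?d t k\<bar> else 0) \<le> C + C'" if "t \<ge> 0" for t n
    proof -
      have "(\<Sum>k<n. if k \<in> K then mass k * \<bar>?d t k\<bar> else 0)
          \<le> (\<Sum>k<n. (if k \<in> K then mass k * \<bar>time_deriv v t (x k)\<bar> else 0)
            + (if k \<in> K then mass k * \<bar>time_deriv v' t (x k)\<bar> else 0))"
        using mass_pos by (intro sum_mono) (auto simp: distrib_left[symmetric] less_imp_le intro!: mult_left_mono)
      then show ?thesis
        using C[OF that, of n] C'[OF that, of n] by (simp add: sum.distrib)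
    qed
    show "((\<lambda>s. ?w s (x k)) has_vector_derivative - ?d t k) (at t within {0..})"
      if "k \<in> K" "t \<ge> 0" for t k
      using has_vector_derivative_diff[OF trap_evolution_derivative[OF v that(2,1)]
          trap_evolution_derivative[OF v' that(2,1)]] by simp
  qed (use k t in auto)
  \<comment> \<open>The energy argument covers only the traps. A nonzero value elsewhere would
    persist on a small interval to the right, which contains a trap.\<close>
  have rc: "continuous (at_right z) (?w t)"
    using v v' t unfolding trap_evolution_def right_cont_left_limits_def
    by (intro continuous_diff) auto
  have "?w t z = 0"
  proof (rule ccontr)
    assume "?w t z \<noteq> 0"
    then have "\<forall>\<^sub>F s in at_right z. ?w t s \<noteq> 0"
      using rc by (intro tendsto_imp_eventually_ne) (auto simp: continuous_within)
    then obtain b where "b > z" "\<And>s. z < s \<Longrightarrow> s < b \<Longrightarrow> ?w t s \<noteq> 0"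
      unfolding eventually_at_right_field by auto
    then show False using dense[of z b] on_traps by blast
  qed
  then show ?thesis by simp
qed

end

section \<open>Weighted configurations\<close>

context trap_config
begin

text \<open>With \<open>q\<close> the realised clocks, this is \<open>\<tau>(A)\<close>. Keeping it
  a function of the whole configuration makes it possible to change one coordinate, as in
  \<open>q(j := 0)\<close>, and to speak of joint measurability in \<open>q\<close> and further
  parameters.\<close>

definition weight :: "(nat \<Rightarrow> real) \<Rightarrow> real set \<Rightarrow> ennreal" where
  "weight q A = (\<Sum>k. if k \<in> K \<and> x k \<in> A then y k * ennreal (q k) else 0)"

lemma weight_eq_emeasure:
  "A \<in> sets borel \<Longrightarrow> weight q A = emeasure (atomic_measure K x (\<lambda>k. y k * ennreal (q k))) A"
  by (simp add: weight_def emeasure_atomic_measure)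

lemma weight_mono: "A \<subseteq> B \<Longrightarrow> weight q A \<le> weight q B"
  unfolding weight_def by (intro suminf_le) auto

lemma weight_empty [simp]: "weight q {} = 0"
  by (simp add: weight_def)

lemma weight_Un_disjoint: "A \<inter> B = {} \<Longrightarrow> weight q (A \<union> B) = weight q A + weight q B"
  unfolding weight_def by (subst suminf_add) (auto intro!: suminf_cong)

lemma weight_point:
  assumes "k \<in> K"
  shows "weight q {x k} = y k * ennreal (q k)"
proof -
  have "weight q {x k} = (\<Sum>j. if j = k then y k * ennreal (q k) else 0)"
    unfolding weight_def using assms inj_onD[OF inj] by (intro suminf_cong) auto
  then show ?thesis
    using sums_single[of k "\<lambda>_. y k * ennreal (q k)"] by (simp add: sums_iff)
qed

lemma weight_Ioc_Ioo:
  assumes "k \<in> K" "z < x k"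
  shows "weight q {z<..x k} = weight q {z<..<x k} + y k * ennreal (q k)"
proof -
  have "{z<..x k} = {z<..<x k} \<union> {x k}" using assms by auto
  then show ?thesis
    using assms by (simp only:) (subst weight_Un_disjoint, auto simp: weight_point)
qed

lemma weight_split:
  assumes "j \<in> K"
  shows "weight q A = (if x j \<in> A then y j * ennreal (q j) else 0) + weight (q(j := 0)) A"
proof -
  let ?a = "if x j \<in> A then y j * ennreal (q j) else 0"
  have "weight q A = (\<Sum>k. (if k = j then ?a else 0)
      + (if k \<in> K \<and> x k \<in> A then y k * ennreal ((q(j := 0)) k) else 0))"
    unfolding weight_def using assms by (intro suminf_cong) auto
  also have "\<dots> = (\<Sum>k. if k = j then ?a else 0) + weight (q(j := 0)) A"
    unfolding weight_def by (rule suminf_add[symmetric]) auto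
  also have "(\<Sum>k. if k = j then ?a else 0) = ?a"
    using sums_single[of j "\<lambda>_. ?a"] by (rule sums_unique[symmetric])
  finally show ?thesis .
qed

lemma weight_pos:
  assumes "\<And>k. k \<in> K \<Longrightarrow> 0 < q k" "a < b"
  shows "0 < weight q {a<..<b}"
proof -
  obtain k where k: "k \<in> K" "a < x k" "x k < b" using dense[OF assms(2)] by auto
  have "0 < y k * ennreal (q k)" using y_pos[OF k(1)] assms(1)[OF k(1)] by (simp add: ennreal_zero_less_mult_iff)
  also have "\<dots> = weight q {x k}" using k by (simp add: weight_point)
  also have "\<dots> \<le> weight q {a<..<b}" using k by (intro weight_mono) auto
  finally show ?thesis .
qed

section \<open>Regular configurations, the inverse process and the levels crossed by jumps\<close>

definition regular :: "(nat \<Rightarrow> real) \<Rightarrow> bool" where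
  "regular q \<longleftrightarrow> (\<forall>k\<in>K. 0 < q k) \<and> (\<forall>a b. weight q {a..b} < \<infinity>) \<and> (\<forall>b. weight q {..b} = \<infinity>)"

lemma regular_finite:
  assumes "regular q" "A \<subseteq> {a..b}"
  shows "weight q A < \<infinity>"
  using assms weight_mono[OF assms(2), of q] unfolding regular_def by (meson le_less_trans)

text \<open>The set under the infimum is closed upwards, and bounded below because the mass of
  \<open>{..b}\<close> exceeds \<open>t\<close>. It contains its infimum, since
  \<open>{a<..b}\<close> increases to \<open>{z<..b}\<close> as \<open>a\<close> decreases to
  \<open>z\<close> and measures are continuous along increasing sequences. Hence both inequalities
  are strict.\<close>

lemma less_inverse_iff:
  assumes t: "ennreal t < weight q {..b}"
  shows "z < Inf {a. weight q {a<..b} \<le> ennreal t} \<longleftrightarrow> ennreal t < weight q {z<..b}"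
proof -
  let ?S = "{a. weight q {a<..b} \<le> ennreal t}"
  let ?m = "atomic_measure K x (\<lambda>k. y k * ennreal (q k))"
  have ne: "b \<in> ?S" by simp
  have "(SUP n. weight q {- real n<..b}) = (SUP n. emeasure ?m {- real n<..b})"
    by (simp add: weight_eq_emeasure)
  also have "\<dots> = emeasure ?m (\<Union>n. {- real n<..b})"
    by (rule SUP_emeasure_incseq) (auto simp: incseq_def)
  also have "(\<Union>n. {- real n<..b}) = {..b}"
    by auto (metis minus_less_iff reals_Archimedean2)
  also have "emeasure ?m {..b} = weight q {..b}" by (simp add: weight_eq_emeasure)
  finally have "ennreal t < (SUP n. weight q {- real n<..b})" using t by simp
  then obtain n where n: "ennreal t < weight q {- real n<..b}" by (auto simp: less_SUP_iff)
  have bdd: "bdd_below ?S"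
  proof (rule bdd_belowI)
    fix a assume "a \<in> ?S"
    show "- real n \<le> a"
    proof (rule ccontr)
      assume "\<not> - real n \<le> a"
      then have "weight q {- real n<..b} \<le> weight q {a<..b}" by (intro weight_mono) auto
      with n \<open>a \<in> ?S\<close> show False by (auto simp: not_le[symmetric])
    qed
  qed
  have "weight q {z<..b} \<le> ennreal t" if "Inf ?S \<le> z"
  proof -
    have "weight q {z<..b} = emeasure ?m (\<Union>n. {z + 1 / real (Suc n)<..b})"
    proof -
      have "(\<Union>n. {z + 1 / real (Suc n)<..b}) = {z<..b}"
      proof safe
        fix a assume "a \<in> {z<..b}"
        then obtain n where "1 / real (Suc n) < a - z"
          using nat_approx_posE[of "a - z"] by auto
        then show "a \<in> (\<Union>n. {z + 1 / real (Suc n)<..b})" using \<open>a \<in> {z<..b}\<close> by (intro UN_I[of n]) auto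
      qed (auto intro: less_trans[rotated] simp: add_strict_increasing)
      then show ?thesis by (simp add: weight_eq_emeasure)
    qed
    also have "\<dots> = (SUP n. emeasure ?m {z + 1 / real (Suc n)<..b})"
    proof (rule SUP_emeasure_incseq[symmetric])
      have "1 / real (Suc (Suc n)) \<le> 1 / real (Suc n)" for n by (rule frac_le) auto
      then show "incseq (\<lambda>n. {z + 1 / real (Suc n)<..b})"
        by (intro incseq_SucI Ioc_subset_iff[THEN iffD2] disjI2 conjI order_refl add_left_mono)
    qed auto
    also have "\<dots> \<le> ennreal t"
    proof (rule SUP_least)
      fix n
      have "Inf ?S < z + 1 / real (Suc n)" using that by (rule le_less_trans) simp
      then obtain a where a: "a \<in> ?S" "a < z + 1 / real (Suc n)"
        using cInf_lessD[of ?S] ne by blast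
      have "weight q {z + 1 / real (Suc n)<..b} \<le> weight q {a<..b}"
        using a(2) by (intro weight_mono) auto
      also have "\<dots> \<le> ennreal t" using a(1) by simp
      finally show "emeasure ?m {z + 1 / real (Suc n)<..b} \<le> ennreal t"
        by (simp add: weight_eq_emeasure)
    qed
    finally show ?thesis .
  qed
  moreover have "Inf ?S \<le> z" if "weight q {z<..b} \<le> ennreal t"
    using that bdd by (intro cInf_lower) auto
  ultimately show ?thesis by (meson not_le)
qed

text \<open>The path \<open>a \<mapsto> weight q {z<..a}\<close> increases by jumps only, so the levels that none of its
  jumps covers form a null set.\<close>

definition missed_levels :: "(nat \<Rightarrow> real) \<Rightarrow> real \<Rightarrow> real \<Rightarrow> real set" where
  "missed_levels q z b = {s. 0 \<le> s \<and> ennreal s < weight q {z<..b} \<and>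
     (\<forall>k\<in>K. x k \<in> {z<..b} \<longrightarrow>
        \<not> (weight q {z<..<x k} \<le> ennreal s \<and> ennreal s < weight q {z<..x k}))}"

text \<open>The levels crossed at trap \<open>k\<close> form the interval from
  \<open>l (x k)\<close> to \<open>r (x k)\<close>. These intervals are disjoint, lie in
  \<open>{0..<T}\<close>, and their lengths are the single atoms, which add up to \<open>T\<close>;
  what remains has measure \<open>T - T = 0\<close>.\<close>

lemma missed_levels_null:
  assumes fin: "weight q {z<..b} < \<infinity>"
  shows "missed_levels q z b \<in> null_sets lborel"
proof -
  define T where "T = enn2real (weight q {z<..b})"
  have T: "weight q {z<..b} = ennreal T" "0 \<le> T" using fin by (auto simp: T_def)
  define l where "l a = enn2real (weight q {z<..<a})" for a
  define r where "r a = enn2real (weight q {z<..a})" for a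
  have wl: "weight q {z<..<a} = ennreal (l a)" and wr: "weight q {z<..a} = ennreal (r a)" if "a \<le> b" for a
  proof -
    have "weight q {z<..<a} \<le> weight q {z<..b}" "weight q {z<..a} \<le> weight q {z<..b}"
      using that by (auto intro!: weight_mono)
    then show "weight q {z<..<a} = ennreal (l a)" "weight q {z<..a} = ennreal (r a)"
      using fin by (auto simp: l_def r_def intro!: ennreal_enn2real[symmetric] intro: le_less_trans)
  qed
  have nonneg: "0 \<le> l a" "0 \<le> r a" for a by (auto simp: l_def r_def)
  let ?P = "\<lambda>k. k \<in> K \<and> x k \<in> {z<..b}"
  let ?I = "\<lambda>k. if ?P k then {l (x k)..<r (x k)} else {}"
  have jump: "ennreal (r (x k)) = ennreal (l (x k)) + y k * ennreal (q k)" if "?P k" for k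
    using that weight_Ioc_Ioo[of k z q] by (simp add: wl wr)
  have r_le_l: "r a \<le> l c" if "a < c" "c \<le> b" for a c
  proof -
    have "weight q {z<..a} \<le> weight q {z<..<c}" using that by (intro weight_mono) auto
    then show ?thesis using that wl[of c] wr[of a] nonneg by (simp add: ennreal_le_iff)
  qed
  have r_le: "r a \<le> T" if "a \<le> b" for a
  proof -
    have "weight q {z<..a} \<le> weight q {z<..b}" using that by (intro weight_mono) auto
    then show ?thesis using T wr[OF that] nonneg by (simp add: ennreal_le_iff)
  qed
  have disj: "disjoint_family ?I"
    unfolding disjoint_family_on_def
  proof (intro ballI impI)
    fix i j :: nat assume "i \<noteq> j"
    show "?I i \<inter> ?I j = {}"
    proof (cases "?P i \<and> ?P j")
      case True
      then have "x i \<noteq> x j" using \<open>i \<noteq> j\<close> inj_onD[OF inj] by auto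
      then show ?thesis
        using True r_le_l[of "x i" "x j"] r_le_l[of "x j" "x i"] by (auto simp: neq_iff)
    qed auto
  qed
  have len: "emeasure lborel (?I k) = (if ?P k then y k * ennreal (q k) else 0)" for k
  proof (cases "?P k")
    case True
    have le: "l (x k) \<le> r (x k)"
    proof -
      have "ennreal (l (x k)) \<le> ennreal (r (x k))" unfolding jump[OF True] by simp
      then show ?thesis using nonneg by (simp add: ennreal_le_iff)
    qed
    have "emeasure lborel (?I k) = ennreal (r (x k) - l (x k))" using True le by simp
    also have "\<dots> = ennreal (r (x k)) - ennreal (l (x k))" using nonneg by (simp add: ennreal_minus)
    also have "\<dots> = y k * ennreal (q k)" unfolding jump[OF True] by simp
    finally show ?thesis using True by simp
  next
    case False
    then show ?thesis by (simp only: if_False emeasure_empty)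
  qed
  have UN: "emeasure lborel (\<Union>k. ?I k) = ennreal T"
  proof -
    have "emeasure lborel (\<Union>k. ?I k) = (\<Sum>k. emeasure lborel (?I k))"
      by (rule suminf_emeasure[symmetric, OF _ disj]) auto
    also have "\<dots> = weight q {z<..b}" unfolding len weight_def by simp
    finally show ?thesis using T by simp
  qed
  have sub: "(\<Union>k. ?I k) \<subseteq> {0..<T}"
    using nonneg r_le by (auto split: if_splits) (meson order_trans less_le_trans)+
  have "missed_levels q z b = {0..<T} - (\<Union>k. ?I k)"
  proof -
    have "s \<in> missed_levels q z b \<longleftrightarrow> s \<in> {0..<T} - (\<Union>k. ?I k)" for s
    proof (cases "0 \<le> s")
      case True
      have "(weight q {z<..<x k} \<le> ennreal s \<and> ennreal s < weight q {z<..x k}) \<longleftrightarrow> s \<in> ?I k" if "?P k" for k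
        using that True nonneg by (simp add: wl wr ennreal_le_iff ennreal_less_iff)
      then show ?thesis
        using True T by (auto simp: missed_levels_def ennreal_less_iff)
    qed (auto simp: missed_levels_def)
    then show ?thesis by blast
  qed
  moreover have "emeasure lborel ({0..<T} - (\<Union>k. ?I k)) = emeasure lborel {0..<T} - emeasure lborel (\<Union>k. ?I k)"
    using sub UN by (intro emeasure_Diff) auto
  ultimately show ?thesis
    using T(2) UN by (auto simp: null_sets_def)
qed

text \<open>From \<open>x j\<close> onwards, deleting atom \<open>j\<close> lowers the path by
  exactly \<open>mass j * q j\<close>, so comparisons with \<open>t\<close> become comparisons with
  the shifted level. The shifted level involves \<open>q j\<close>, the reduced path does not; this
  is what makes the resampling possible.\<close>

lemma missed_levels_shift:
  assumes j: "j \<in> K" "x j \<in> {z<..b}" and tj: "weight q {z<..x j} \<le> ennreal t"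
    and t: "t \<in> missed_levels q z b" and q: "0 \<le> q j"
  shows "t - mass j * q j \<in> missed_levels (q(j := 0)) z b"
proof -
  let ?c = "mass j * q j" and ?q = "q(j := 0)"
  have t0: "0 \<le> t" using t by (simp add: missed_levels_def)
  have c0: "0 \<le> ?c" using mass_pos[OF j(1)] q by (simp add: less_imp_le)
  have c: "y j * ennreal (q j) = ennreal ?c"
    using mass_pos[OF j(1)] q by (simp add: ennreal_mass[OF j(1), symmetric] ennreal_mult less_imp_le)
  have w: "weight q A = ennreal ?c + weight ?q A" if "x j \<in> A" for A
    using weight_split[OF j(1), of q A] that by (simp add: c)
  have "ennreal ?c \<le> ennreal t"
    using tj unfolding w[of "{z<..x j}", simplified, OF j(2)[THEN greaterThanAtMost_iff[THEN iffD1], THEN conjunct1]]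
    by (rule order_trans[rotated]) simp
  then have ct: "?c \<le> t" using t0 by (simp add: ennreal_le_iff)
  have add: "ennreal ?c + ennreal (t - ?c) = ennreal t"
    using ct c0 by (simp flip: ennreal_plus)
  have le_iff: "weight ?q A \<le> ennreal (t - ?c) \<longleftrightarrow> weight q A \<le> ennreal t" if "x j \<in> A" for A
    unfolding w[OF that] add[symmetric] by (simp add: ennreal_add_left_cancel_le)
  have less_iff: "ennreal (t - ?c) < weight ?q A \<longleftrightarrow> ennreal t < weight q A" if "x j \<in> A" for A
    using le_iff[OF that] by (simp add: not_le[symmetric])
  show ?thesis
    unfolding missed_levels_def mem_Collect_eq
  proof (intro conjI ballI impI notI)
    show "0 \<le> t - ?c" using ct by simp
    show "ennreal (t - ?c) < weight ?q {z<..b}"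
      using t j(2) by (simp add: less_iff missed_levels_def)
    fix k assume k: "k \<in> K" "x k \<in> {z<..b}"
      and *: "weight ?q {z<..<x k} \<le> ennreal (t - ?c) \<and> ennreal (t - ?c) < weight ?q {z<..x k}"
    \<comment> \<open>A trap covering the shifted level would be \<open>j\<close>, whose jump is
      gone; or lie to the right of \<open>x j\<close>, where it covers \<open>t\<close> in the full
      path; or lie to the left, where the reduced path has not passed the shifted level yet.\<close>
    consider "k = j" | "x j < x k" | "x k < x j"
      using inj_onD[OF inj _ k(1) j(1)] by fastforce
    then show False
    proof cases
      case 1
      then show ?thesis using * weight_Ioc_Ioo[OF k(1), of z ?q] k(2) by auto
    next
      case 2
      then have "weight q {z<..<x k} \<le> ennreal t \<and> ennreal t < weight q {z<..x k}"
        using * j(2) by (simp add: le_iff less_iff)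
      then show ?thesis using t k by (auto simp: missed_levels_def)
    next
      case 3
      have "weight ?q {z<..x k} \<le> weight ?q {z<..x j}" using 3 by (intro weight_mono) auto
      moreover have "weight ?q {z<..x j} \<le> ennreal (t - ?c)" using tj j(2) by (simp add: le_iff)
      ultimately show ?thesis using * by (meson leD order_trans)
    qed
  qed
qed

text \<open>The intervals \<open>{z<..z + 1/(n+1)}\<close> decrease to the empty set and have finite
  mass, so their masses tend to 0 and fall below the positive level \<open>t\<close>; density puts a
  trap inside.\<close>

lemma ex_small_weight:
  assumes q: "regular q" and zb: "z < b" and t: "0 < t"
  shows "\<exists>j\<in>K. x j \<in> {z<..b} \<and> weight q {z<..x j} \<le> ennreal t"
proof -
  let ?m = "atomic_measure K x (\<lambda>k. y k * ennreal (q k))"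
  let ?A = "\<lambda>n. {z<..z + 1 / real (Suc n)}"
  have "(\<lambda>n. emeasure ?m (?A n)) \<longlonglongrightarrow> emeasure ?m (\<Inter>n. ?A n)"
  proof (rule Lim_emeasure_decseq)
    have "1 / real (Suc (Suc n)) \<le> 1 / real (Suc n)" for n by (rule frac_le) auto
    then have "?A (Suc n) \<subseteq> ?A n" for n
      by (intro Ioc_subset_iff[THEN iffD2] disjI2 conjI order_refl add_left_mono)
    then show "decseq ?A" by (rule decseq_SucI)
    show "emeasure ?m (?A n) \<noteq> \<infinity>" for n
    proof -
      have "?A n \<subseteq> {z..z + 1 / real (Suc n)}" by auto
      from regular_finite[OF q this] show ?thesis by (simp add: weight_eq_emeasure)
    qed
  qed auto
  moreover have "(\<Inter>n. ?A n) = {}"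
  proof -
    have "a \<notin> (\<Inter>n. ?A n)" for a
    proof (cases "z < a")
      case True
      then obtain n where "1 / real (Suc n) < a - z" using nat_approx_posE[of "a - z"] by auto
      then have "a \<notin> ?A n" by auto
      then show ?thesis by blast
    qed auto
    then show ?thesis by blast
  qed
  ultimately have "(\<lambda>n. weight q (?A n)) \<longlonglongrightarrow> 0" by (simp add: weight_eq_emeasure)
  then have "\<forall>\<^sub>F n in sequentially. weight q (?A n) < ennreal t"
    using t by (intro order_tendstoD(2)[of _ 0]) auto
  then obtain n where n: "weight q (?A n) < ennreal t" by (auto simp: eventually_sequentially)
  obtain j where j: "j \<in> K" "z < x j" "x j < min b (z + 1 / real (Suc n))"
    using dense[of z "min b (z + 1 / real (Suc n))"] zb by auto
  have "weight q {z<..x j} \<le> weight q (?A n)" using j by (intro weight_mono) auto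
  then show ?thesis using j n by (intro bexI[of _ j]) auto
qed

end

section \<open>The random trap configuration\<close>

lemma AE_lborel_affine_not_in_null_set:
  assumes N: "N \<in> null_sets lborel" and c: "c \<noteq> (0::real)"
  shows "AE s in lborel. t + c * s \<notin> N"
proof -
  have [measurable]: "N \<in> sets borel" using N by auto
  have "0 = (\<integral>\<^sup>+s. indicator N s \<partial>lborel)" using N by auto
  also have "\<dots> = ennreal \<bar>c\<bar> * (\<integral>\<^sup>+s. indicator N (t + c * s) \<partial>lborel)"
    by (rule nn_integral_real_affine[OF _ c]) simp
  finally have "(\<integral>\<^sup>+s. indicator N (t + c * s) \<partial>lborel) = 0" using c by simp
  then show ?thesis
    by (subst (asm) nn_integral_0_iff_AE) (auto simp: indicator_def split: if_splits)
qed

context trap_config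
begin

text \<open>Configuration and set may both depend on the parameter. This serves the product spaces
  on which the base point \<open>z\<close> or a single clock is a variable of its own.\<close>

lemma borel_measurable_weight:
  assumes "\<And>k. k \<in> K \<Longrightarrow> (\<lambda>w. q w k) \<in> borel_measurable N"
    and "\<And>k. k \<in> K \<Longrightarrow> Measurable.pred N (\<lambda>w. x k \<in> A w)"
  shows "(\<lambda>w. weight (q w) (A w)) \<in> borel_measurable N"
proof -
  have "(\<lambda>w. if k \<in> K \<and> x k \<in> A w then y k * ennreal (q w k) else 0) \<in> borel_measurable N" for k
  proof (cases "k \<in> K")
    case True
    note [measurable] = assms[OF True]
    show ?thesis by measurable
  qed simp
  then show ?thesis
    unfolding weight_def by (rule borel_measurable_suminf_order)
qed

lemma weight_cong:
  "(\<And>k. k \<in> K \<Longrightarrow> q k = q' k) \<Longrightarrow> weight q A = weight q' A"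
  unfolding weight_def by (intro suminf_cong) auto

lemma weight_remove: "x j \<notin> A \<Longrightarrow> j \<in> K \<Longrightarrow> weight (q(j := 0)) A = weight q A"
  using weight_split[of j q A] by simp

end

locale random_traps = trap_config K x y + prob_space M
  for K x y and M :: "'w measure" +
  fixes \<zeta> :: "nat \<Rightarrow> 'w \<Rightarrow> real"
  assumes indep: "indep_vars (\<lambda>_. borel) \<zeta> K"
    and exponential: "\<And>k. k \<in> K \<Longrightarrow> distributed M lborel (\<zeta> k) (exponential_density 1)"
begin

section \<open>Resampling a single clock\<close>

definition config :: "'w \<Rightarrow> nat \<Rightarrow> real" where "config \<omega> k = \<zeta> k \<omega>"

lemma config_measurable: "k \<in> K \<Longrightarrow> (\<lambda>\<omega>. config \<omega> k) \<in> borel_measurable M"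
  using exponential[of k] unfolding config_def by (auto dest!: distributed_measurable)

abbreviation rest :: "nat \<Rightarrow> 'w \<Rightarrow> nat \<Rightarrow> real" where
  "rest j \<omega> \<equiv> restrict (config \<omega>) (K - {j})"

lemma rest_measurable: "rest j \<in> measurable M (PiM (K - {j}) (\<lambda>_. borel))"
  using config_measurable by (intro measurable_restrict) auto

text \<open>Independence of blocks gives a product law on the function spaces over
  \<open>{j}\<close> and \<open>K - {j}\<close>; evaluation at \<open>j\<close> then turns the first
  factor into the exponential law on the reals.\<close>

lemma distr_pair_rest:
  assumes j: "j \<in> K"
  shows "distr M (borel \<Otimes>\<^sub>M PiM (K - {j}) (\<lambda>_. borel)) (\<lambda>\<omega>. (\<zeta> j \<omega>, rest j \<omega>))
    = density lborel (exponential_density 1) \<Otimes>\<^sub>M distr M (PiM (K - {j}) (\<lambda>_. borel)) (rest j)"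
proof -
  let ?A = "\<lambda>\<omega>. restrict (\<lambda>i. \<zeta> i \<omega>) {j}"
  let ?P1 = "PiM {j} (\<lambda>_. borel) :: (nat \<Rightarrow> real) measure"
  let ?P2 = "PiM (K - {j}) (\<lambda>_. borel) :: (nat \<Rightarrow> real) measure"
  have "indep_var ?P1 ?A ?P2 (\<lambda>\<omega>. restrict (\<lambda>i. \<zeta> i \<omega>) (K - {j}))"
    by (rule indep_var_restrict[OF indep]) (use j in auto)
  then have eq: "distr M ?P1 ?A \<Otimes>\<^sub>M distr M ?P2 (rest j) = distr M (?P1 \<Otimes>\<^sub>M ?P2) (\<lambda>\<omega>. (?A \<omega>, rest j \<omega>))"
    by (simp add: indep_var_distribution_eq config_def[abs_def])
  have zeta: "\<zeta> j \<in> borel_measurable M"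
    using config_measurable[OF j] by (simp add: config_def)
  then have A: "?A \<in> measurable M ?P1"
    by (intro measurable_restrict) auto
  have at_j: "(\<lambda>q. q j) \<in> borel_measurable ?P1"
    by (rule measurable_component_singleton) simp
  interpret D: prob_space "distr M ?P2 (rest j)"
    by (rule prob_space_distr[OF rest_measurable])
  have "distr M borel (\<zeta> j) = distr (distr M ?P1 ?A) borel (\<lambda>q. q j)"
    by (subst distr_distr[OF at_j A]) (simp add: comp_def)
  then have "distr M borel (\<zeta> j) \<Otimes>\<^sub>M distr M ?P2 (rest j)
      = distr (distr M ?P1 ?A) borel (\<lambda>q. q j) \<Otimes>\<^sub>M distr (distr M ?P2 (rest j)) ?P2 (\<lambda>q. q)"
    by (simp add: distr_id2)
  also have "\<dots> = distr (distr M ?P1 ?A \<Otimes>\<^sub>M distr M ?P2 (rest j)) (borel \<Otimes>\<^sub>M ?P2) (\<lambda>(a, q). (a j, q))"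
    using at_j D.sigma_finite_measure_axioms by (intro pair_measure_distr) (auto simp: distr_id2)
  also have "\<dots> = distr M (borel \<Otimes>\<^sub>M ?P2) ((\<lambda>(a, q). (a j, q)) \<circ> (\<lambda>\<omega>. (?A \<omega>, rest j \<omega>)))"
    unfolding eq
  proof (rule distr_distr)
    note [measurable] = at_j
    show "(\<lambda>(a, q). (a j, q)) \<in> measurable (?P1 \<Otimes>\<^sub>M ?P2) (borel \<Otimes>\<^sub>M ?P2)" by measurable
    show "(\<lambda>\<omega>. (?A \<omega>, rest j \<omega>)) \<in> measurable M (?P1 \<Otimes>\<^sub>M ?P2)"
      by (intro measurable_Pair A rest_measurable)
  qed
  also have "(\<lambda>(a, q). (a j, q)) \<circ> (\<lambda>\<omega>. (?A \<omega>, rest j \<omega>)) = (\<lambda>\<omega>. (\<zeta> j \<omega>, rest j \<omega>))"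
    by (simp add: comp_def)
  also have "distr M borel (\<zeta> j) = density lborel (exponential_density 1)"
    using distributed_distr_eq_density[OF exponential[OF j]]
    by (simp cong: distr_cong)
  finally show ?thesis by (rule sym)
qed

text \<open>Tonelli in both orders. Averaging over the other clocks inside yields the exponential
  average of the left limits; freezing the other clocks outside serves almost sure
  statements.\<close>

lemma nn_integral_resample:
  assumes j: "j \<in> K" and f: "f \<in> borel_measurable (borel \<Otimes>\<^sub>M PiM (K - {j}) (\<lambda>_. borel))"
  shows "(\<integral>\<^sup>+\<omega>. f (\<zeta> j \<omega>, rest j \<omega>) \<partial>M) =
      (\<integral>\<^sup>+s. ennreal (exponential_density 1 s) * (\<integral>\<^sup>+\<omega>. f (s, rest j \<omega>) \<partial>M) \<partial>lborel)" (is "?L = ?R1")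
    and "(\<integral>\<^sup>+\<omega>. f (\<zeta> j \<omega>, rest j \<omega>) \<partial>M) =
      (\<integral>\<^sup>+\<omega>. (\<integral>\<^sup>+s. ennreal (exponential_density 1 s) * f (s, rest j \<omega>) \<partial>lborel) \<partial>M)" (is "_ = ?R2")
proof -
  let ?P = "PiM (K - {j}) (\<lambda>_. borel) :: (nat \<Rightarrow> real) measure"
  let ?E = "density lborel (exponential_density 1)"
  let ?D = "distr M ?P (rest j)"
  note [measurable] = rest_measurable[of j] f
  have [measurable]: "\<zeta> j \<in> borel_measurable M"
    using config_measurable[OF j] by (simp add: config_def)
  interpret E: prob_space ?E by (rule prob_space_exponential_density) simp
  interpret D: prob_space ?D by (rule prob_space_distr) simp
  interpret ED: pair_prob_space ?E ?D ..
  have [measurable_cong]: "sets ?E = sets borel" "sets ?D = sets ?P" by auto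
  have L: "?L = (\<integral>\<^sup>+p. f p \<partial>(?E \<Otimes>\<^sub>M ?D))"
    unfolding distr_pair_rest[OF j, symmetric] by (subst nn_integral_distr) auto
  have "(\<integral>\<^sup>+p. f p \<partial>(?E \<Otimes>\<^sub>M ?D)) = (\<integral>\<^sup>+s. (\<integral>\<^sup>+q. f (s, q) \<partial>?D) \<partial>?E)"
    by (rule D.nn_integral_fst[symmetric]) measurable
  also have "\<dots> = (\<integral>\<^sup>+s. (\<integral>\<^sup>+\<omega>. f (s, rest j \<omega>) \<partial>M) \<partial>?E)"
    by (intro nn_integral_cong nn_integral_distr) auto
  also have "\<dots> = ?R1"
    by (subst nn_integral_density) auto
  finally show "?L = ?R1" using L by simp
  have "(\<integral>\<^sup>+p. f p \<partial>(?E \<Otimes>\<^sub>M ?D)) = (\<integral>\<^sup>+q. (\<integral>\<^sup>+s. f (s, q) \<partial>?E) \<partial>?D)"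
    by (rule ED.nn_integral_snd[symmetric]) measurable
  also have "\<dots> = (\<integral>\<^sup>+\<omega>. (\<integral>\<^sup>+s. f (s, rest j \<omega>) \<partial>?E) \<partial>M)"
    by (subst nn_integral_distr) auto
  also have "\<dots> = ?R2"
    by (intro nn_integral_cong) (subst nn_integral_density, auto)
  finally show "?L = ?R2" using L by simp
qed

text \<open>The exponential law has a density that vanishes on the negative half-line, so a property
  that holds for Lebesgue almost every \<open>s \<ge> 0\<close>, given the other clocks, holds
  almost surely.\<close>

lemma AE_resample:
  assumes j: "j \<in> K" and P: "Measurable.pred (borel \<Otimes>\<^sub>M PiM (K - {j}) (\<lambda>_. borel)) P"
    and ae: "AE \<omega> in M. AE s in lborel. 0 \<le> s \<longrightarrow> P (s, rest j \<omega>)"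
  shows "AE \<omega> in M. P (\<zeta> j \<omega>, rest j \<omega>)"
proof -
  let ?f = "\<lambda>p. if P p then 0 else 1 :: ennreal"
  note [measurable] = P rest_measurable[of j]
  have [measurable]: "\<zeta> j \<in> borel_measurable M"
    using config_measurable[OF j] by (simp add: config_def)
  have "(\<integral>\<^sup>+\<omega>. ?f (\<zeta> j \<omega>, rest j \<omega>) \<partial>M)
      = (\<integral>\<^sup>+\<omega>. (\<integral>\<^sup>+s. ennreal (exponential_density 1 s) * ?f (s, rest j \<omega>) \<partial>lborel) \<partial>M)"
    by (rule nn_integral_resample(2)[OF j]) measurable
  also have "\<dots> = (\<integral>\<^sup>+\<omega>. 0 \<partial>M)"
  proof (rule nn_integral_cong_AE)
    show "AE \<omega> in M. (\<integral>\<^sup>+s. ennreal (exponential_density 1 s) * ?f (s, rest j \<omega>) \<partial>lborel) = 0"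
      using ae AE_space
    proof eventually_elim
      case (elim \<omega>)
      have "(\<integral>\<^sup>+s. ennreal (exponential_density 1 s) * ?f (s, rest j \<omega>) \<partial>lborel) = (\<integral>\<^sup>+s. 0 \<partial>(lborel :: real measure))"
        by (rule nn_integral_cong_AE, use elim(1) in eventually_elim) (auto simp: exponential_density_def)
      then show ?case by simp
    qed
  qed
  finally have "(\<integral>\<^sup>+\<omega>. ?f (\<zeta> j \<omega>, rest j \<omega>) \<partial>M) = 0" by simp
  then show ?thesis
    by (subst (asm) nn_integral_0_iff_AE) (auto split: if_splits)
qed

lemma weight_rest: "weight ((rest j \<omega>)(j := 0)) A = weight ((config \<omega>)(j := 0)) A"
  by (rule weight_cong) auto

lemma weight_config_split:
  assumes "j \<in> K" "x j \<in> A"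
  shows "weight (config \<omega>) A = y j * ennreal (\<zeta> j \<omega>) + weight ((rest j \<omega>)(j := 0)) A"
  using weight_split[OF assms(1), of "config \<omega>" A] assms(2) unfolding weight_rest config_def by simp

lemma borel_measurable_weight_rest:
  assumes "\<And>k. k \<in> K \<Longrightarrow> Measurable.pred (N \<Otimes>\<^sub>M PiM (K - {j}) (\<lambda>_. borel)) (\<lambda>p. x k \<in> A p)"
  shows "(\<lambda>p. weight ((snd p)(j := 0)) (A p)) \<in> borel_measurable (N \<Otimes>\<^sub>M PiM (K - {j}) (\<lambda>_. borel))"
proof (rule borel_measurable_weight[OF _ assms])
  fix k assume k: "k \<in> K"
  show "(\<lambda>p. ((snd p)(j := 0)) k) \<in> borel_measurable (N \<Otimes>\<^sub>M PiM (K - {j}) (\<lambda>_. borel))"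
  proof (cases "k = j")
    case False
    then have "k \<in> K - {j}" using k by simp
    then have [measurable]: "(\<lambda>q. q k) \<in> borel_measurable (PiM (K - {j}) (\<lambda>_. borel))"
      by (rule measurable_component_singleton)
    show ?thesis using False by simp
  qed simp
qed

lemma borel_measurable_weight_config:
  assumes "\<And>k. k \<in> K \<Longrightarrow> Measurable.pred (N \<Otimes>\<^sub>M M) (\<lambda>p. x k \<in> A p)"
  shows "(\<lambda>p. weight (config (snd p)) (A p)) \<in> borel_measurable (N \<Otimes>\<^sub>M M)"
  using config_measurable
  by (intro borel_measurable_weight[OF _ assms] measurable_compose[OF measurable_snd]) auto

lemma weight_config_measurable [measurable]:
  "(\<lambda>\<omega>. weight (config \<omega>) A) \<in> borel_measurable M"
  using config_measurable by (intro borel_measurable_weight) auto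

text \<open>A single trap inside the interval suffices: given the other clocks, at most one
  nonnegative value of its clock produces the total mass \<open>r\<close>.\<close>

lemma AE_weight_neq:
  assumes "z < b"
  shows "AE \<omega> in M. weight (config \<omega>) {z<..<b} \<noteq> ennreal r"
proof -
  obtain j where j: "j \<in> K" "z < x j" "x j < b" using dense[OF assms] by auto
  define P where "P p = (y j * ennreal (fst p) + weight ((snd p)(j := 0)) {z<..<b} \<noteq> ennreal r)" for p
  have "AE \<omega> in M. P (\<zeta> j \<omega>, rest j \<omega>)"
  proof (rule AE_resample[OF j(1)])
    have [measurable]: "(\<lambda>p. weight ((snd p)(j := 0)) {z<..<b})
        \<in> borel_measurable (borel \<Otimes>\<^sub>M PiM (K - {j}) (\<lambda>_. borel))"
      by (rule borel_measurable_weight_rest) auto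
    show "Measurable.pred (borel \<Otimes>\<^sub>M PiM (K - {j}) (\<lambda>_. borel)) P"
      unfolding P_def by measurable
    show "AE \<omega> in M. AE s in lborel. 0 \<le> s \<longrightarrow> P (s, rest j \<omega>)"
    proof (rule AE_I2)
      fix \<omega>
      define w where "w = weight ((rest j \<omega>)(j := 0)) {z<..<b}"
      show "AE s in lborel. 0 \<le> s \<longrightarrow> P (s, rest j \<omega>)"
      proof (cases "w = \<infinity>")
        case True
        then show ?thesis by (simp add: P_def w_def)
      next
        case False
        have w: "w = ennreal (enn2real w)" using False by (simp add: less_top)
        show ?thesis
          \<comment> \<open>The excluded point solves \<open>mass j * s + w = r\<close>; the maximum
            with 0 is taken because \<open>ennreal\<close> sends a negative \<open>r\<close> to
            0.\<close>
          using AE_lborel_singleton[of "(max 0 r - enn2real w) / mass j"]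
        proof eventually_elim
          case (elim s)
          have "mass j * s + enn2real w \<noteq> max 0 r"
            using elim mass_pos[OF j(1)] by (auto simp: field_simps)
          moreover have "y j * ennreal s + w = ennreal (mass j * s + enn2real w)" if "0 \<le> s"
            using that mass_pos[OF j(1)] w
            by (metis ennreal_mass[OF j(1)] ennreal_mult ennreal_plus enn2real_nonneg less_imp_le mult_nonneg_nonneg)
          moreover have "ennreal r = ennreal (max 0 r)" by (simp add: ennreal_neg max_def)
          ultimately show ?case
            using mass_pos[OF j(1)] unfolding P_def fst_conv snd_conv w_def[symmetric]
            by (metis enn2real_nonneg ennreal_inj add_nonneg_nonneg less_imp_le max.cobounded1 mult_nonneg_nonneg)
        qed
      qed
    qed
  qed
  then show ?thesis
    using j by (simp add: P_def weight_config_split)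
qed

section \<open>Almost sure regularity of the random configuration\<close>

lemma AE_zeta_pos: "k \<in> K \<Longrightarrow> AE \<omega> in M. 0 < \<zeta> k \<omega>"
proof -
  assume k: "k \<in> K"
  have [measurable]: "\<zeta> k \<in> borel_measurable M"
    using config_measurable[OF k] by (simp add: config_def)
  have "prob {\<omega>\<in>space M. \<zeta> k \<omega> \<le> 0} = 0"
    using exponential_distributedD_le[OF exponential[OF k], of 0] by simp
  then show ?thesis by (subst (asm) prob_Collect_eq_0) (auto simp: not_le)
qed

lemma nn_integral_zeta: "k \<in> K \<Longrightarrow> (\<integral>\<^sup>+\<omega>. ennreal (\<zeta> k \<omega>) \<partial>M) = 1"
proof -
  assume k: "k \<in> K"
  have "(\<integral>\<^sup>+\<omega>. ennreal (\<zeta> k \<omega>) \<partial>M) = (\<integral>\<^sup>+s. ennreal (exponential_density 1 s) * ennreal s \<partial>lborel)"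
    by (rule distributed_nn_integral[OF exponential[OF k], symmetric]) simp
  also have "\<dots> = (\<integral>\<^sup>+s. ennreal (exponential_density 1 s * s ^ 1) \<partial>lborel)"
    by (intro nn_integral_cong) (auto simp: exponential_density_def ennreal_mult'')
  also have "\<dots> = 1" by (subst nn_integral_erlang_ith_moment) auto
  finally show ?thesis .
qed

text \<open>\<open>exp (- s)\<close> times the density of rate 1 is half the density of rate
  2.\<close>

lemma nn_integral_exp_zeta: "k \<in> K \<Longrightarrow> (\<integral>\<^sup>+\<omega>. ennreal (exp (- \<zeta> k \<omega>)) \<partial>M) = ennreal (1/2)"
proof -
  assume k: "k \<in> K"
  interpret E: prob_space "density lborel (exponential_density 2)"
    by (rule prob_space_exponential_density) simp
  have "(\<integral>\<^sup>+\<omega>. ennreal (exp (- \<zeta> k \<omega>)) \<partial>M)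
      = (\<integral>\<^sup>+s. ennreal (exponential_density 1 s) * ennreal (exp (- s)) \<partial>lborel)"
    by (rule distributed_nn_integral[OF exponential[OF k], symmetric]) simp
  also have "\<dots> = (\<integral>\<^sup>+s. ennreal (1/2) * ennreal (exponential_density 2 s) \<partial>lborel)"
  proof (intro nn_integral_cong)
    fix s :: real
    have "ennreal (exponential_density 1 s) * ennreal (exp (- s)) = ennreal (exponential_density 1 s * exp (- s))"
      by (rule ennreal_mult''[symmetric]) simp
    also have "exponential_density 1 s * exp (- s) = 1/2 * exponential_density 2 s"
      by (auto simp: exponential_density_def exp_add[symmetric])
    also have "ennreal \<dots> = ennreal (1/2) * ennreal (exponential_density 2 s)"
      by (rule ennreal_mult') simp
    finally show "ennreal (exponential_density 1 s) * ennreal (exp (- s))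
        = ennreal (1/2) * ennreal (exponential_density 2 s)" .
  qed
  also have "\<dots> = ennreal (1/2) * (\<integral>\<^sup>+s. ennreal (exponential_density 2 s) \<partial>lborel)"
    by (rule nn_integral_cmult) simp
  also have "(\<integral>\<^sup>+s. ennreal (exponential_density 2 s) \<partial>lborel) = 1"
    using E.emeasure_space_1 by (simp add: emeasure_density)
  finally show ?thesis by simp
qed

text \<open>The clocks have mean 1, so the expected random mass of \<open>{a..b}\<close> is its trap
  mass, which is finite.\<close>

lemma AE_weight_finite: "AE \<omega> in M. weight (config \<omega>) {a..b} \<noteq> \<infinity>"
proof (rule nn_integral_PInf_AE)
  have "(\<integral>\<^sup>+\<omega>. weight (config \<omega>) {a..b} \<partial>M)
      = (\<Sum>k. \<integral>\<^sup>+\<omega>. (if k \<in> K \<and> x k \<in> {a..b} then y k * ennreal (config \<omega> k) else 0) \<partial>M)"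
    unfolding weight_def
  proof (rule nn_integral_suminf)
    show "(\<lambda>\<omega>. if k \<in> K \<and> x k \<in> {a..b} then y k * ennreal (config \<omega> k) else 0) \<in> borel_measurable M" for k
      using config_measurable[of k] by (cases "k \<in> K") auto
  qed
  also have "\<dots> = (\<Sum>k. if k \<in> K \<and> x k \<in> {a..b} then y k else 0)"
  proof (intro suminf_cong)
    fix k
    show "(\<integral>\<^sup>+\<omega>. (if k \<in> K \<and> x k \<in> {a..b} then y k * ennreal (config \<omega> k) else 0) \<partial>M)
        = (if k \<in> K \<and> x k \<in> {a..b} then y k else 0)"
      using config_measurable[of k] nn_integral_zeta[of k]
      by (cases "k \<in> K \<and> x k \<in> {a..b}") (auto simp: config_def nn_integral_cmult)
  qed
  also have "\<dots> = emeasure (trap_measure K x y) {a..b}"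
    by (simp add: trap_measure_def emeasure_atomic_measure)
  finally show "(\<integral>\<^sup>+\<omega>. weight (config \<omega>) {a..b} \<partial>M) \<noteq> \<infinity>"
    using locally_finite[of a b] by simp
qed simp

text \<open>\<open>E[exp (- \<zeta>\<^sub>k)] = 1/2\<close> turns independence into geometric decay of
  \<open>P(\<Sum>\<^bsub>k\<in>F\<^esub> \<zeta>\<^sub>k \<le> c)\<close> in the size of \<open>F\<close>.\<close>

lemma AE_weight_left_infinite: "AE \<omega> in M. weight (config \<omega>) {..b} = \<infinity>"
proof -
  obtain e where e: "e > 0" "\<And>L. infinite {k\<in>K. x k \<le> L \<and> ennreal e \<le> y k}"
    using left_infinite by auto
  have small: "prob {\<omega>\<in>space M. weight (config \<omega>) {..b} \<le> ennreal c} = 0" if c: "0 \<le> c" for c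
  proof -
    let ?B = "{\<omega>\<in>space M. weight (config \<omega>) {..b} \<le> ennreal c}"
    have B: "?B \<in> sets M" by measurable
    \<comment> \<open>Each trap of \<open>F\<close> has mass at least \<open>e\<close>, so on
      \<open>?B\<close> the sum of its clocks is at most \<open>c / e\<close>. Markov's inequality
      for \<open>exp (- \<Sum>k\<in>F. \<zeta> k)\<close> and independence give one factor 1/2 per
      trap.\<close>
    have bound: "prob ?B * exp (- (c / e)) \<le> (1/2) ^ n" for n
    proof -
      obtain F where F: "finite F" "card F = n" "F \<subseteq> {k\<in>K. x k \<le> b \<and> ennreal e \<le> y k}"
        using infinite_arbitrarily_large[OF e(2), of n b] by auto
      have [measurable]: "k \<in> F \<Longrightarrow> \<zeta> k \<in> borel_measurable M" for k
        using F(3) config_measurable[of k] by (auto simp: config_def)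
      have le: "ennreal (exp (- (c / e))) * indicator ?B \<omega> \<le> (\<Prod>k\<in>F. ennreal (exp (- \<zeta> k \<omega>)))"
        if pos: "\<forall>k\<in>K. 0 < \<zeta> k \<omega>" for \<omega>
      proof (cases "\<omega> \<in> ?B")
        case True
        have pos: "0 \<le> \<zeta> k \<omega>" if "k \<in> F" for k using F(3) that pos by (auto intro: less_imp_le)
        have "ennreal (e * (\<Sum>k\<in>F. \<zeta> k \<omega>)) = (\<Sum>k\<in>F. ennreal e * ennreal (\<zeta> k \<omega>))"
          using e(1) pos by (simp add: sum_distrib_left ennreal_mult' flip: sum_ennreal)
        also have "\<dots> \<le> (\<Sum>k\<in>F. if k \<in> K \<and> x k \<in> {..b} then y k * ennreal (config \<omega> k) else 0)"
          using F(3) by (intro sum_mono) (auto simp: config_def intro!: mult_right_mono)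
        also have "\<dots> \<le> weight (config \<omega>) {..b}"
          unfolding weight_def by (rule sum_le_suminf[OF _ F(1)]) auto
        also have "\<dots> \<le> ennreal c" using True by simp
        finally have "(\<Sum>k\<in>F. \<zeta> k \<omega>) \<le> c / e"
          using c e(1) by (simp add: ennreal_le_iff field_simps)
        then have "exp (- (c / e)) \<le> exp (- (\<Sum>k\<in>F. \<zeta> k \<omega>))" by simp
        also have "\<dots> = (\<Prod>k\<in>F. exp (- \<zeta> k \<omega>))"
          using F(1) by (simp add: exp_sum flip: sum_negf)
        finally show ?thesis using True by (simp add: prod_ennreal ennreal_leI)
      qed simp
      have "ennreal (prob ?B * exp (- (c / e))) = (\<integral>\<^sup>+\<omega>. ennreal (exp (- (c / e))) * indicator ?B \<omega> \<partial>M)"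
        using B by (simp add: nn_integral_cmult_indicator emeasure_eq_measure ennreal_mult'' mult.commute)
      also have "\<dots> \<le> (\<integral>\<^sup>+\<omega>. (\<Prod>k\<in>F. ennreal (exp (- \<zeta> k \<omega>))) \<partial>M)"
      proof (rule nn_integral_mono_AE)
        have "AE \<omega> in M. \<forall>k\<in>K. 0 < \<zeta> k \<omega>"
          using AE_zeta_pos by (intro AE_ball_countable[THEN iffD2]) auto
        then show "AE \<omega> in M. ennreal (exp (- (c / e))) * indicator ?B \<omega> \<le> (\<Prod>k\<in>F. ennreal (exp (- \<zeta> k \<omega>)))"
          by (rule eventually_mono) (rule le)
      qed
      also have "\<dots> = (\<Prod>k\<in>F. \<integral>\<^sup>+\<omega>. ennreal (exp (- \<zeta> k \<omega>)) \<partial>M)"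
      proof (rule indep_vars_nn_integral[OF F(1)])
        have "indep_vars (\<lambda>_. borel) \<zeta> F" using F(3) by (intro indep_vars_subset[OF indep]) auto
        then show "indep_vars (\<lambda>_. borel) (\<lambda>k \<omega>. ennreal (exp (- \<zeta> k \<omega>))) F"
          by (rule indep_vars_compose2[where Y = "\<lambda>_ s. ennreal (exp (- s))"]) auto
      qed simp
      also have "\<dots> = (\<Prod>k\<in>F. ennreal (1/2))"
        using F(3) by (intro prod.cong refl nn_integral_exp_zeta) auto
      also have "\<dots> = ennreal ((1/2) ^ n)" using F(2) ennreal_power[of "1/2" n] by (simp only: prod_constant)
      finally show ?thesis by (simp add: ennreal_le_iff)
    qed
    have "prob ?B * exp (- (c / e)) \<le> 0"
      by (rule LIMSEQ_le_const[OF LIMSEQ_realpow_zero[of "1/2"]]) (use bound in auto)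
    then show ?thesis
      using measure_nonneg[of M ?B] by (simp add: mult_le_0_iff)
  qed
  have "AE \<omega> in M. \<not> weight (config \<omega>) {..b} \<le> ennreal (real n)" for n
    using small[OF of_nat_0_le_iff, of n] by (subst (asm) prob_Collect_eq_0) auto
  then have "AE \<omega> in M. \<forall>n. \<not> weight (config \<omega>) {..b} \<le> ennreal (real n)"
    by (simp add: AE_all_countable)
  then show ?thesis
  proof (rule eventually_mono)
    fix \<omega> assume *: "\<forall>n. \<not> weight (config \<omega>) {..b} \<le> ennreal (real n)"
    show "weight (config \<omega>) {..b} = \<infinity>"
    proof (rule ccontr)
      assume "weight (config \<omega>) {..b} \<noteq> \<infinity>"
      then obtain r where r: "weight (config \<omega>) {..b} = ennreal r"
        by (cases "weight (config \<omega>) {..b}") auto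
      obtain n where "r \<le> real n" using real_arch_simple by auto
      then show False using * r by (auto intro: ennreal_leI)
    qed
  qed
qed

lemma AE_regular: "AE \<omega> in M. regular (config \<omega>)"
proof -
  have "AE \<omega> in M. \<forall>k\<in>K. 0 < \<zeta> k \<omega>"
    using AE_zeta_pos by (intro AE_ball_countable[THEN iffD2]) auto
  \<comment> \<open>Integer end points leave only countably many exceptional sets; monotonicity
    recovers all intervals and half-lines.\<close>
  moreover have "AE \<omega> in M. \<forall>n. weight (config \<omega>) {- real n..real n} \<noteq> \<infinity>"
    using AE_weight_finite by (simp add: AE_all_countable)
  moreover have "AE \<omega> in M. \<forall>n. weight (config \<omega>) {..- real n} = \<infinity>"
    using AE_weight_left_infinite by (simp add: AE_all_countable)
  ultimately show ?thesis
  proof eventually_elim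
    case (elim \<omega>)
    have "weight (config \<omega>) {a..b} < \<infinity>" for a b
    proof -
      obtain n where "max \<bar>a\<bar> \<bar>b\<bar> \<le> real n"
        using real_arch_simple[of "max \<bar>a\<bar> \<bar>b\<bar>"] by blast
      then have "weight (config \<omega>) {a..b} \<le> weight (config \<omega>) {- real n..real n}"
        by (intro weight_mono) auto
      also have "\<dots> < \<infinity>" using elim(2) by (simp add: less_top)
      finally show ?thesis .
    qed
    moreover have "weight (config \<omega>) {..b} = \<infinity>" for b
    proof -
      obtain n where "- b \<le> real n" using real_arch_simple by auto
      then have "weight (config \<omega>) {..- real n} \<le> weight (config \<omega>) {..b}"
        by (intro weight_mono) auto
      then show ?thesis using elim(3) by (simp add: top_unique)
    qed
    ultimately show ?case using elim(1) by (auto simp: regular_def config_def)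
  qed
qed

text \<open>The trap to be resampled depends on \<open>\<omega>\<close>. The shifted statement is
  therefore proved for every fixed \<open>j\<close>, where the clock is independent of the null set
  of reduced levels, and then for all \<open>j\<close> at once by countability of \<open>K\<close>.
  Only afterwards is \<open>j\<close> chosen for the given \<open>\<omega>\<close>, close enough to
  \<open>z\<close> for \<open>missed_levels_shift\<close>.\<close>

lemma AE_not_missed:
  assumes zb: "z < b" and t: "0 < t"
  shows "AE \<omega> in M. t \<notin> missed_levels (config \<omega>) z b"
proof -
  have *: "AE \<omega> in M. t - mass j * \<zeta> j \<omega> \<notin> missed_levels ((rest j \<omega>)(j := 0)) z b"
    if j: "j \<in> K" for j
  proof -
    define P where "P p = (t - mass j * fst p \<notin> missed_levels ((snd p)(j := 0)) z b)" for p
    let ?N = "borel \<Otimes>\<^sub>M PiM (K - {j}) (\<lambda>_. borel) :: (real \<times> (nat \<Rightarrow> real)) measure"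
    have [measurable]: "(\<lambda>p. weight ((snd p)(j := 0)) A) \<in> borel_measurable ?N" for A
      by (rule borel_measurable_weight_rest) auto
    have "AE \<omega> in M. P (\<zeta> j \<omega>, rest j \<omega>)"
    proof (rule AE_resample[OF j])
      show "Measurable.pred ?N P"
        unfolding P_def missed_levels_def mem_Collect_eq by measurable
      show "AE \<omega> in M. AE s in lborel. 0 \<le> s \<longrightarrow> P (s, rest j \<omega>)"
        using AE_regular
      proof eventually_elim
        case (elim \<omega>)
        have "weight ((rest j \<omega>)(j := 0)) {z<..b} \<le> weight (config \<omega>) {z<..b}"
          unfolding weight_rest weight_split[OF j, of "config \<omega>"] by simp
        also have "\<dots> < \<infinity>"
          by (rule regular_finite[OF elim, of _ z b]) auto
        finally have "missed_levels ((rest j \<omega>)(j := 0)) z b \<in> null_sets lborel"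
          by (rule missed_levels_null)
        then have "AE s in lborel. t + - mass j * s \<notin> missed_levels ((rest j \<omega>)(j := 0)) z b"
          using mass_pos[OF j] by (intro AE_lborel_affine_not_in_null_set) auto
        then show ?case
          by (rule eventually_mono) (simp add: P_def)
      qed
    qed
    then show ?thesis by (simp add: P_def)
  qed
  have "AE \<omega> in M. \<forall>j\<in>K. t - mass j * \<zeta> j \<omega> \<notin> missed_levels ((rest j \<omega>)(j := 0)) z b"
    using * by (intro AE_ball_countable[THEN iffD2]) auto
  with AE_regular show ?thesis
  proof eventually_elim
    case (elim \<omega>)
    show ?case
    proof
      assume miss: "t \<in> missed_levels (config \<omega>) z b"
      obtain j where j: "j \<in> K" "x j \<in> {z<..b}" "weight (config \<omega>) {z<..x j} \<le> ennreal t"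
        using ex_small_weight[OF elim(1) zb t] by auto
      have "0 \<le> config \<omega> j" using elim(1) j(1) by (auto simp: regular_def less_imp_le)
      from missed_levels_shift[OF j miss this] have "t - mass j * \<zeta> j \<omega> \<in> missed_levels ((config \<omega>)(j := 0)) z b"
        unfolding config_def[of \<omega> j] .
      moreover have "missed_levels ((config \<omega>)(j := 0)) z b = missed_levels ((rest j \<omega>)(j := 0)) z b"
        by (simp only: missed_levels_def weight_rest)
      ultimately show False using elim(2) j(1) by auto
    qed
  qed
qed

end

section \<open>The solution\<close>

text \<open>\<open>\<Phi>\<close> is the exponential average of \<open>\<psi>\<close> with mean
  delay \<open>c\<close>, that is, the resolvent of the shift. In the form
  \<open>exp (- t / c) / c\<close> times the integral of \<open>exp (r / c) * \<psi> r\<close> over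
  \<open>r \<le> t\<close> it can be differentiated although \<open>\<psi>\<close> is merely
  continuous.\<close>

lemma resolvent_has_vector_derivative:
  fixes \<psi> :: "real \<Rightarrow> real"
  assumes cont: "continuous_on UNIV \<psi>" and bdd: "\<And>r. \<bar>\<psi> r\<bar> \<le> B" and c: "0 < c"
  defines "\<Phi> \<equiv> (\<lambda>t. \<integral>s. exponential_density 1 s * \<psi> (t - c * s) \<partial>lborel)"
  shows "(\<Phi> has_vector_derivative (\<psi> t - \<Phi> t) / c) (at t)"
proof -
  have [measurable]: "\<psi> \<in> borel_measurable borel"
    by (rule borel_measurable_continuous_onI[OF cont])
  define e where "e r = exp (r / c) * \<psi> r" for r
  define G where "G t = (LBINT r:{..t}. e r)" for t
  interpret E: prob_space "density lborel (exponential_density 1)"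
    by (rule prob_space_exponential_density) simp
  have dens: "integrable lborel (exponential_density 1)"
  proof (rule integrableI_bounded)
    show "(\<integral>\<^sup>+s. ennreal (norm (exponential_density 1 s)) \<partial>lborel) < \<infinity>"
      using E.emeasure_space_1 by (simp add: emeasure_density exponential_density_nonneg)
  qed simp
  have int: "integrable lborel (\<lambda>s. exponential_density 1 s * \<psi> (t - c * s))" for t
  proof (rule Bochner_Integration.integrable_bound)
    show "integrable lborel (\<lambda>s. B * exponential_density 1 s)" using dens by simp
    show "AE s in lborel. norm (exponential_density 1 s * \<psi> (t - c * s)) \<le> norm (B * exponential_density 1 s)"
    proof (rule AE_I2)
      fix s
      have *: "\<bar>\<psi> (t - c * s)\<bar> \<le> \<bar>B\<bar>" using bdd[of "t - c * s"] by linarith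
      show "norm (exponential_density 1 s * \<psi> (t - c * s)) \<le> norm (B * exponential_density 1 s)"
        using mult_left_mono[OF * exponential_density_nonneg[of 1 s]] by (simp add: abs_mult mult.commute)
    qed
  qed measurable
  \<comment> \<open>The substitution \<open>r = t - c * s\<close>, which turns the support
    \<open>s \<ge> 0\<close> of the density into \<open>r \<le> t\<close>.\<close>
  have subst: "exponential_density 1 (t / c + (- 1 / c) * r) * \<psi> (t - c * (t / c + (- 1 / c) * r))
      = exp (- t / c) * (indicator {..t} r * e r)" for t r
  proof -
    have "t - c * (t / c + (- 1 / c) * r) = r" using c by (simp add: field_simps)
    moreover have "exponential_density 1 (t / c + (- 1 / c) * r) = exp (- t / c) * (indicator {..t} r * exp (r / c))"
      using c by (auto simp: exponential_density_def indicator_def field_simps exp_add[symmetric])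
    ultimately show ?thesis by (simp add: e_def)
  qed
  have e_int: "set_integrable lborel {..t} e" for t
  proof -
    have "integrable lborel (\<lambda>r. exp (- t / c) * (indicator {..t} r * e r))"
      using lborel_integrable_real_affine[OF int[of t], of "- 1 / c" "t / c"] c
      by (simp only: subst) simp
    then show ?thesis by (simp add: set_integrable_def)
  qed
  have \<Phi>_G: "\<Phi> t = exp (- t / c) * G t / c" for t
  proof -
    have "\<Phi> t = \<bar>- 1 / c\<bar> *\<^sub>R (\<integral>r. exp (- t / c) * (indicator {..t} r * e r) \<partial>lborel)"
      unfolding \<Phi>_def using c
      by (subst lborel_integral_real_affine[of "- 1 / c" _ "t / c"]) (simp_all only: subst, simp)
    then show ?thesis using c by (simp add: G_def set_lebesgue_integral_def)
  qed
  have G: "(G has_vector_derivative e t) (at t)" for t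
  proof -
    \<comment> \<open>The lower limit of \<open>G\<close> is minus infinity. Splitting off the part
      below \<open>t - 1\<close> leaves an integral over a compact interval around \<open>t\<close>,
      to which the fundamental theorem applies.\<close>
    let ?a = "t - 1" and ?b = "t + 1"
    have "((\<lambda>u. LBINT r=ereal ?a..ereal u. e r) has_vector_derivative e t) (at t within {?a..?b})"
    proof (rule interval_integral_FTC2)
      show "continuous_on {?a..?b} e"
        unfolding e_def using c by (intro continuous_intros continuous_on_subset[OF cont]) auto
    qed auto
    from has_vector_derivative_add[OF has_vector_derivative_const this, of "G ?a"]
    have D: "((\<lambda>u. G ?a + (LBINT r=ereal ?a..ereal u. e r)) has_vector_derivative e t) (at t within {?a..?b})"
      by simp
    have "G u = G ?a + (LBINT r=ereal ?a..ereal u. e r)" if "u \<in> {?a..?b}" for u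
    proof -
      have "{..u} = {..?a} \<union> {?a<..u}" using that by auto
      then have "G u = G ?a + (LBINT r:{?a<..u}. e r)"
        unfolding G_def by (simp only:) (rule set_integral_Un,
            auto intro: set_integrable_subset[OF e_int])
      then show ?thesis using that by (simp add: interval_integral_Ioc)
    qed
    then have "(G has_vector_derivative e t) (at t within {?a..?b})"
      by (rule has_vector_derivative_transform[rotated, OF _ D]) auto
    then show ?thesis by (simp add: at_within_Icc_at)
  qed
  have "(\<Phi> has_real_derivative (\<psi> t - \<Phi> t) / c) (at t)"
  proof -
    have GD: "(G has_real_derivative e t) (at t)"
      using G by (simp add: has_real_derivative_iff_has_vector_derivative)
    have "((\<lambda>t. exp (- t / c) * G t / c) has_real_derivative (\<psi> t - exp (- t / c) * G t / c) / c) (at t)"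
    proof -
      have ED: "((\<lambda>t. exp (- t / c)) has_real_derivative exp (- t / c) * (- 1 / c)) (at t)"
        using c by (auto intro!: derivative_eq_intros)
      have "e t * exp (- t / c) = \<psi> t"
        unfolding e_def by (simp add: exp_minus)
      then have eq: "(exp (- t / c) * (- 1 / c) * G t + e t * exp (- t / c)) / c
          = (\<psi> t - exp (- t / c) * G t / c) / c" by simp
      show ?thesis using DERIV_cdivide[OF DERIV_mult[OF ED GD], of c] unfolding eq .
    qed
    then show ?thesis by (simp add: \<Phi>_G[abs_def])
  qed
  then show ?thesis by (simp add: has_real_derivative_iff_has_vector_derivative)
qed

lemma (in finite_measure) integrable_unit_interval:
  fixes f :: "'a \<Rightarrow> real"
  assumes "f \<in> borel_measurable M" "\<And>z. 0 \<le> f z" "\<And>z. f z \<le> 1"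
  shows "integrable M f" "(\<integral>\<^sup>+z. ennreal (f z) \<partial>M) = ennreal (\<integral>z. f z \<partial>M)"
    "0 \<le> (\<integral>z. f z \<partial>M)" "(\<integral>z. f z \<partial>M) \<le> measure M (space M)"
proof -
  show int: "integrable M f"
    using assms by (intro integrable_const_bound[where B = 1]) auto
  show "(\<integral>\<^sup>+z. ennreal (f z) \<partial>M) = ennreal (\<integral>z. f z \<partial>M)"
    using assms by (intro nn_integral_eq_integral[OF int]) auto
  show "0 \<le> (\<integral>z. f z \<partial>M)" using assms by (intro integral_nonneg_AE) auto
  have "(\<integral>z. f z \<partial>M) \<le> (\<integral>z. 1 \<partial>M)" using assms int by (intro integral_mono) auto
  then show "(\<integral>z. f z \<partial>M) \<le> measure M (space M)" by simp
qed

context random_traps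
begin

section \<open>Probabilities of passing a point, and their jumps at the traps\<close>

lemma weight_Ioo_le_Ioc: "weight q {z<..<b} \<le> weight q {z<..b}"
  by (intro weight_mono) auto

definition exceed :: "real \<Rightarrow> real \<Rightarrow> real \<Rightarrow> real" where
  "exceed t b z = prob {\<omega>\<in>space M. ennreal t < weight (config \<omega>) {z<..b}}"

definition exceed_left :: "real \<Rightarrow> real \<Rightarrow> real \<Rightarrow> real" where
  "exceed_left t b z = prob {\<omega>\<in>space M. ennreal t < weight (config \<omega>) {z<..<b}}"

lemma prob_eq_integral:
  assumes "Measurable.pred M P"
  shows "prob {\<omega>\<in>space M. P \<omega>} = (\<integral>\<omega>. (if P \<omega> then 1 else 0) \<partial>M)"
proof -
  have "(\<integral>\<omega>. (if P \<omega> then 1 else 0) \<partial>M) = (\<integral>\<omega>. indicator {\<omega>\<in>space M. P \<omega>} \<omega> \<partial>M :: real)"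
    by (intro Bochner_Integration.integral_cong) auto
  also have "\<dots> = prob {\<omega>\<in>space M. P \<omega>}"
    using assms by simp
  finally show ?thesis by simp
qed

lemma exceed_measurable2:
  "(\<lambda>p. exceed (fst p) b (snd p)) \<in> borel_measurable (borel \<Otimes>\<^sub>M borel)"
  "(\<lambda>p. exceed_left (fst p) b (snd p)) \<in> borel_measurable (borel \<Otimes>\<^sub>M borel)"
proof -
  let ?N = "borel \<Otimes>\<^sub>M borel :: (real \<times> real) measure"
  have [measurable]: "(\<lambda>p. weight (config (snd p)) {snd (fst p)<..b}) \<in> borel_measurable (?N \<Otimes>\<^sub>M M)"
      "(\<lambda>p. weight (config (snd p)) {snd (fst p)<..<b}) \<in> borel_measurable (?N \<Otimes>\<^sub>M M)"
    by (intro borel_measurable_weight_config; simp; measurable)+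
  have "(\<lambda>p. \<integral>\<omega>. (if ennreal (fst p) < weight (config \<omega>) {snd p<..b} then 1 else 0 :: real) \<partial>M) \<in> borel_measurable ?N"
    by measurable
  then show "(\<lambda>p. exceed (fst p) b (snd p)) \<in> borel_measurable ?N"
    unfolding exceed_def by (subst prob_eq_integral) auto
  have "(\<lambda>p. \<integral>\<omega>. (if ennreal (fst p) < weight (config \<omega>) {snd p<..<b} then 1 else 0 :: real) \<partial>M) \<in> borel_measurable ?N"
    by measurable
  then show "(\<lambda>p. exceed_left (fst p) b (snd p)) \<in> borel_measurable ?N"
    unfolding exceed_left_def by (subst prob_eq_integral) auto
qed

lemma exceed_measurable [measurable]:
  "exceed t b \<in> borel_measurable borel" "exceed_left t b \<in> borel_measurable borel"
  using measurable_compose[OF measurable_Pair1' exceed_measurable2(1), of t]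
    measurable_compose[OF measurable_Pair1' exceed_measurable2(2), of t] by simp_all

lemma exceed_bounds: "0 \<le> exceed t b z" "exceed t b z \<le> 1" "0 \<le> exceed_left t b z" "exceed_left t b z \<le> 1"
  by (simp_all add: exceed_def exceed_left_def)

lemma exceed_eq_0:
  assumes "b \<le> z"
  shows "exceed t b z = 0" "exceed_left t b z = 0"
  using assms by (simp_all add: exceed_def exceed_left_def)

text \<open>By density every interval \<open>{z<..<b}\<close> contains a trap, and its clock is
  almost surely positive. This settles the negative levels in the exponential average as well as the
  derivative at time 0.\<close>

lemma exceed_left_nonpos:
  assumes "z < b" "t \<le> 0"
  shows "exceed_left t b z = 1"
proof -
  have "AE \<omega> in M. ennreal t < weight (config \<omega>) {z<..<b}"
    using AE_regular
  proof (rule eventually_mono)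
    fix \<omega> assume "regular (config \<omega>)"
    then have "0 < weight (config \<omega>) {z<..<b}"
      using assms by (intro weight_pos) (auto simp: regular_def)
    then show "ennreal t < weight (config \<omega>) {z<..<b}" using assms by (simp add: ennreal_neg)
  qed
  then show ?thesis unfolding exceed_left_def by (subst prob_Collect_eq_1) auto
qed

lemma exceed_left_le: "exceed_left t b z \<le> exceed t b z"
  unfolding exceed_def exceed_left_def
  by (intro finite_measure_mono) (auto intro: less_le_trans[OF _ weight_Ioo_le_Ioc])

lemma exceed_0: "exceed 0 b z = (if z < b then 1 else 0)"
  using exceed_left_nonpos[of z b 0] exceed_left_le[of 0 b z] exceed_bounds(2)[of 0 b z] exceed_eq_0(1)[of b z 0]
  by auto

text \<open>The probability that \<open>Z\<^sup>*(t;\<cdot>)\<close> passes the point \<open>z\<close> at the trap \<open>x k\<close>.\<close>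

definition jump :: "real \<Rightarrow> nat \<Rightarrow> real \<Rightarrow> real" where
  "jump t k z = exceed t (x k) z - exceed_left t (x k) z"

lemma jump_measurable [measurable]: "jump t k \<in> borel_measurable borel"
  unfolding jump_def[abs_def] by measurable

lemma jump_bounds: "0 \<le> jump t k z" "jump t k z \<le> 1"
  using exceed_left_le[of t "x k" z] exceed_bounds[of t "x k" z] by (auto simp: jump_def)

lemma jump_eq_prob:
  "jump t k z = prob {\<omega>\<in>space M. weight (config \<omega>) {z<..<x k} \<le> ennreal t \<and> ennreal t < weight (config \<omega>) {z<..x k}}"
proof -
  have "{\<omega>\<in>space M. weight (config \<omega>) {z<..<x k} \<le> ennreal t \<and> ennreal t < weight (config \<omega>) {z<..x k}}
      = {\<omega>\<in>space M. ennreal t < weight (config \<omega>) {z<..x k}} - {\<omega>\<in>space M. ennreal t < weight (config \<omega>) {z<..<x k}}"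
    by auto
  then show ?thesis
    unfolding jump_def exceed_def exceed_left_def
    by (simp only:) (subst finite_measure_Diff, auto intro: less_le_trans[OF _ weight_Ioo_le_Ioc])
qed

text \<open>A nondecreasing path crosses a level at most once, so the crossing events at different
  traps are disjoint.\<close>

lemma jump_sums:
  assumes "P \<subseteq> K"
  shows "(\<lambda>k. if k \<in> P then jump t k z else 0) sums
    prob {\<omega>\<in>space M. \<exists>k\<in>P. weight (config \<omega>) {z<..<x k} \<le> ennreal t \<and> ennreal t < weight (config \<omega>) {z<..x k}}"
proof -
  let ?F = "\<lambda>k. {\<omega>\<in>space M. weight (config \<omega>) {z<..<x k} \<le> ennreal t \<and> ennreal t < weight (config \<omega>) {z<..x k}}"
  let ?E = "\<lambda>k. if k \<in> P then ?F k else {}"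
  have "disjoint_family ?E"
    unfolding disjoint_family_on_def
  proof (intro ballI impI)
    fix i j :: nat assume "i \<noteq> j"
    have disj: "?F i \<inter> ?F j = {}" if "x i < x j" for i j
    proof -
      have "weight (config \<omega>) {z<..x i} \<le> weight (config \<omega>) {z<..<x j}" for \<omega>
        using that by (intro weight_mono) auto
      then show ?thesis by (auto simp: not_less[symmetric]) (meson less_le_trans not_less)
    qed
    show "?E i \<inter> ?E j = {}"
    proof (cases "i \<in> P \<and> j \<in> P")
      case True
      then have "x i \<noteq> x j" using \<open>i \<noteq> j\<close> assms inj_onD[OF inj] by blast
      then show ?thesis using True disj[of i j] disj[of j i] by (auto simp: neq_iff)
    qed auto
  qed
  then have "(\<lambda>k. prob (?E k)) sums prob (\<Union>k. ?E k)"
    by (intro finite_measure_UNION) auto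
  moreover have "(\<lambda>k. prob (?E k)) = (\<lambda>k. if k \<in> P then jump t k z else 0)"
    by (auto simp: jump_eq_prob)
  moreover have "(\<Union>k. ?E k) = {\<omega>\<in>space M. \<exists>k\<in>P. weight (config \<omega>) {z<..<x k} \<le> ennreal t \<and> ennreal t < weight (config \<omega>) {z<..x k}}"
    by auto
  ultimately show ?thesis by simp
qed

text \<open>By \<open>AE_not_missed\<close>, a path that exceeds \<open>t\<close> at
  \<open>b\<close> has almost surely crossed \<open>t\<close> at a trap. At \<open>t = 0\<close> the
  identity fails: every jump vanishes, while \<open>exceed 0 b z = 1\<close> for
  \<open>z < b\<close>.\<close>

lemma exceed_sums_jump:
  assumes t: "0 < t"
  shows "(\<lambda>k. if k \<in> K \<and> x k \<le> b then jump t k z else 0) sums exceed t b z"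
proof -
  let ?P = "{k\<in>K. x k \<le> b}"
  have "prob {\<omega>\<in>space M. \<exists>k\<in>?P. weight (config \<omega>) {z<..<x k} \<le> ennreal t \<and> ennreal t < weight (config \<omega>) {z<..x k}}
      = exceed t b z"
    unfolding exceed_def
  proof (rule finite_measure_eq_AE)
    have "AE \<omega> in M. z < b \<longrightarrow> t \<notin> missed_levels (config \<omega>) z b"
      using AE_not_missed[OF _ t] by (cases "z < b") auto
    then show "AE \<omega> in M. (\<omega> \<in> {\<omega>\<in>space M. \<exists>k\<in>?P. weight (config \<omega>) {z<..<x k} \<le> ennreal t \<and> ennreal t < weight (config \<omega>) {z<..x k}})
        = (\<omega> \<in> {\<omega>\<in>space M. ennreal t < weight (config \<omega>) {z<..b}})"
    proof (rule eventually_mono)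
      fix \<omega> assume miss: "z < b \<longrightarrow> t \<notin> missed_levels (config \<omega>) z b"
      have "ennreal t < weight (config \<omega>) {z<..b}" if "k \<in> ?P" "ennreal t < weight (config \<omega>) {z<..x k}" for k
        using that by (elim less_le_trans) (auto intro!: weight_mono)
      moreover have "\<exists>k\<in>?P. weight (config \<omega>) {z<..<x k} \<le> ennreal t \<and> ennreal t < weight (config \<omega>) {z<..x k}"
        if *: "ennreal t < weight (config \<omega>) {z<..b}"
      proof -
        have "z < b" using * by (cases "z < b") auto
        then show ?thesis using miss * t unfolding missed_levels_def by auto
      qed
      ultimately show "(\<omega> \<in> {\<omega>\<in>space M. \<exists>k\<in>?P. weight (config \<omega>) {z<..<x k} \<le> ennreal t \<and> ennreal t < weight (config \<omega>) {z<..x k}})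
        = (\<omega> \<in> {\<omega>\<in>space M. ennreal t < weight (config \<omega>) {z<..b}})" by auto
    qed
  qed (auto intro!: sets.sets_Collect_countable_Ex' sets.sets_Collect)
  then show ?thesis using jump_sums[of ?P t z] by simp
qed

text \<open>The mass of the open interval almost surely differs from any given level, so the
  indicators converge almost surely and dominated convergence applies.\<close>

lemma continuous_on_exceed_left: "continuous_on UNIV (\<lambda>r. exceed_left r b z)"
proof (cases "z < b")
  case False
  then show ?thesis by (simp add: exceed_eq_0)
next
  case True
  show ?thesis
  proof (rule continuous_at_imp_continuous_on, intro ballI, unfold continuous_at_sequentially comp_def, intro allI impI)
    fix r :: real and R :: "nat \<Rightarrow> real" assume R: "R \<longlonglongrightarrow> r"
    have eq: "exceed_left r b z = (\<integral>\<omega>. (if ennreal r < weight (config \<omega>) {z<..<b} then 1 else 0) \<partial>M)" for r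
      unfolding exceed_left_def by (rule prob_eq_integral) measurable
    show "(\<lambda>n. exceed_left (R n) b z) \<longlonglongrightarrow> exceed_left r b z"
      unfolding eq
    proof (rule integral_dominated_convergence[where w = "\<lambda>_. 1"])
      show "AE \<omega> in M. (\<lambda>n. if ennreal (R n) < weight (config \<omega>) {z<..<b} then 1 else 0 :: real)
          \<longlonglongrightarrow> (if ennreal r < weight (config \<omega>) {z<..<b} then 1 else 0)"
        using AE_weight_neq[OF True, of r]
      proof (rule eventually_mono)
        fix \<omega> assume "weight (config \<omega>) {z<..<b} \<noteq> ennreal r"
        then consider "ennreal r < weight (config \<omega>) {z<..<b}" | "weight (config \<omega>) {z<..<b} < ennreal r"
          by (meson neq_iff)
        then have "\<forall>\<^sub>F n in sequentially. (if ennreal (R n) < weight (config \<omega>) {z<..<b} then 1 else 0 :: real)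
            = (if ennreal r < weight (config \<omega>) {z<..<b} then 1 else 0)"
        proof cases
          case 1
          show ?thesis
            using order_tendstoD(2)[OF tendsto_ennrealI[OF R] 1] by eventually_elim (use 1 in auto)
        next
          case 2
          show ?thesis
            using order_tendstoD(1)[OF tendsto_ennrealI[OF R] 2] by eventually_elim (use 2 in auto)
        qed
        then show "(\<lambda>n. if ennreal (R n) < weight (config \<omega>) {z<..<b} then 1 else 0 :: real)
          \<longlonglongrightarrow> (if ennreal r < weight (config \<omega>) {z<..<b} then 1 else 0)"
          by (rule tendsto_eventually)
      qed
    qed auto
  qed
qed

text \<open>Condition on the clock of trap \<open>k\<close>: the mass of \<open>{z<..x k}\<close> is
  \<open>mass k * s\<close> plus the mass of \<open>{z<..<x k}\<close>, which does not depend on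
  that clock, so the level for the latter drops to \<open>t - mass k * s\<close>.\<close>

lemma exceed_eq_nn_integral:
  assumes k: "k \<in> K" and t: "0 \<le> t"
  shows "ennreal (exceed t (x k) z) =
    (\<integral>\<^sup>+s. ennreal (exponential_density 1 s) * ennreal (exceed_left (t - mass k * s) (x k) z) \<partial>lborel)"
proof (cases "z < x k")
  case False
  then show ?thesis by (simp add: exceed_eq_0)
next
  case True
  let ?N = "borel \<Otimes>\<^sub>M PiM (K - {k}) (\<lambda>_. borel) :: (real \<times> (nat \<Rightarrow> real)) measure"
  define f where "f p = (if ennreal t < y k * ennreal (fst p) + weight ((snd p)(k := 0)) {z<..x k} then 1 else 0 :: ennreal)" for p
  have [measurable]: "(\<lambda>p. weight ((snd p)(k := 0)) {z<..x k}) \<in> borel_measurable ?N"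
    by (rule borel_measurable_weight_rest) auto
  have f: "f \<in> borel_measurable ?N" unfolding f_def by measurable
  have rest: "weight ((rest k \<omega>)(k := 0)) {z<..x k} = weight (config \<omega>) {z<..<x k}" for \<omega>
  proof -
    have "weight ((rest k \<omega>)(k := 0)) {z<..x k} = weight ((config \<omega>)(k := 0)) {z<..<x k}"
      unfolding weight_rest weight_Ioc_Ioo[OF k True] by simp
    also have "\<dots> = weight (config \<omega>) {z<..<x k}" by (rule weight_remove[OF _ k]) simp
    finally show ?thesis .
  qed
  have nn: "(\<integral>\<^sup>+\<omega>. (if P \<omega> then 1 else 0) \<partial>M) = ennreal (prob {\<omega>\<in>space M. P \<omega>})"
    if [measurable]: "Measurable.pred M P" for P
  proof -
    have "(\<integral>\<^sup>+\<omega>. (if P \<omega> then 1 else 0) \<partial>M) = (\<integral>\<^sup>+\<omega>. indicator {\<omega>\<in>space M. P \<omega>} \<omega> \<partial>M)"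
      by (intro nn_integral_cong) auto
    then show ?thesis by (simp add: emeasure_eq_measure)
  qed
  have inner: "(\<integral>\<^sup>+\<omega>. f (s, rest k \<omega>) \<partial>M) = ennreal (exceed_left (t - mass k * s) (x k) z)" if s: "0 \<le> s" for s
  proof -
    have ys: "y k * ennreal s = ennreal (mass k * s)"
      using s mass_pos[OF k] by (simp add: ennreal_mass[OF k, symmetric] ennreal_mult less_imp_le)
    have ms: "0 \<le> mass k * s" using s mass_pos[OF k] by (simp add: less_imp_le)
    show ?thesis
    proof (cases "mass k * s \<le> t")
      case le: True
      have t_eq: "ennreal t = ennreal (mass k * s) + ennreal (t - mass k * s)"
        using le ms by (simp flip: ennreal_plus)
      have "f (s, rest k \<omega>) = (if ennreal (t - mass k * s) < weight (config \<omega>) {z<..<x k} then 1 else 0)" for \<omega>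
        unfolding f_def fst_conv snd_conv rest ys t_eq by (simp add: ennreal_add_left_cancel_less)
      then show ?thesis unfolding exceed_left_def by (simp add: nn)
    next
      \<comment> \<open>Trap \<open>k\<close> alone exceeds the level here; correspondingly the
        remaining level is negative and \<open>exceed_left\<close> equals 1.\<close>
      case False
      then have "ennreal t < ennreal (mass k * s)" using t by (simp add: ennreal_less_iff)
      then have "f (s, rest k \<omega>) = 1" for \<omega>
        unfolding f_def fst_conv snd_conv rest ys by (auto intro: less_le_trans)
      then show ?thesis using False True by (simp add: exceed_left_nonpos emeasure_space_1)
    qed
  qed
  have "ennreal (exceed t (x k) z) = (\<integral>\<^sup>+\<omega>. (if ennreal t < weight (config \<omega>) {z<..x k} then 1 else 0) \<partial>M)"
    unfolding exceed_def by (rule nn[symmetric]) measurable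
  also have "\<dots> = (\<integral>\<^sup>+\<omega>. f (\<zeta> k \<omega>, rest k \<omega>) \<partial>M)"
    using True by (simp add: f_def weight_config_split[OF k])
  also have "\<dots> = (\<integral>\<^sup>+s. ennreal (exponential_density 1 s) * (\<integral>\<^sup>+\<omega>. f (s, rest k \<omega>) \<partial>M) \<partial>lborel)"
    by (rule nn_integral_resample(1)[OF k f])
  also have "\<dots> = (\<integral>\<^sup>+s. ennreal (exponential_density 1 s) * ennreal (exceed_left (t - mass k * s) (x k) z) \<partial>lborel)"
  proof (intro nn_integral_cong)
    fix s
    show "ennreal (exponential_density 1 s) * (\<integral>\<^sup>+\<omega>. f (s, rest k \<omega>) \<partial>M)
      = ennreal (exponential_density 1 s) * ennreal (exceed_left (t - mass k * s) (x k) z)"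
      by (cases "0 \<le> s") (auto simp: inner exponential_density_def)
  qed
  finally show ?thesis .
qed

section \<open>The expectation in terms of passage probabilities\<close>

lemma inverse_process_eq:
  "inverse_process (random_trap_measure K x y \<zeta> \<omega>) t b = Inf {a. weight (config \<omega>) {a<..b} \<le> ennreal t}"
  unfolding inverse_process_def random_trap_measure_def
  by (simp add: weight_eq_emeasure config_def[abs_def])

lemma less_inverse_process_iff:
  assumes "regular (config \<omega>)"
  shows "z < inverse_process (random_trap_measure K x y \<zeta> \<omega>) t b \<longleftrightarrow> ennreal t < weight (config \<omega>) {z<..b}"
  unfolding inverse_process_eq using assms
  by (intro less_inverse_iff) (simp add: regular_def)

text \<open>Irregular configurations are included: where the mass of \<open>{..b}\<close> is at most
  \<open>t\<close>, the set under the infimum is \<open>UNIV\<close>, and \<open>Inf UNIV\<close> is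
  a fixed, if unspecified, real.\<close>

lemma inverse_process_measurable [measurable]:
  "(\<lambda>\<omega>. inverse_process (random_trap_measure K x y \<zeta> \<omega>) t b) \<in> borel_measurable M"
proof (subst borel_measurable_iff_greater, intro allI)
  fix z :: real
  let ?Z = "\<lambda>\<omega>. inverse_process (random_trap_measure K x y \<zeta> \<omega>) t b"
  have "z < ?Z \<omega> \<longleftrightarrow> (if ennreal t < weight (config \<omega>) {..b} then ennreal t < weight (config \<omega>) {z<..b} else z < Inf UNIV)" for \<omega>
  proof (cases "ennreal t < weight (config \<omega>) {..b}")
    case True
    then show ?thesis unfolding inverse_process_eq by (simp add: less_inverse_iff)
  next
    case False
    have "weight (config \<omega>) {a<..b} \<le> ennreal t" for a
    proof -
      have "weight (config \<omega>) {a<..b} \<le> weight (config \<omega>) {..b}" by (intro weight_mono) auto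
      also have "\<dots> \<le> ennreal t" using False by (simp add: not_less)
      finally show ?thesis .
    qed
    then have "{a. weight (config \<omega>) {a<..b} \<le> ennreal t} = UNIV" by auto
    then show ?thesis using False unfolding inverse_process_eq by simp
  qed
  then show "{\<omega>\<in>space M. z < ?Z \<omega>} \<in> sets M"
    by (simp only:) measurable
qed

text \<open>Both integrals measure, under the product of \<open>m\<close> and \<open>M\<close>, the
  pairs of \<open>z\<close> and \<open>\<omega>\<close> with \<open>\<tau>((z,b]) > t\<close>; the
  rest is Tonelli.\<close>

lemma integral_exceed:
  fixes m :: "real measure" and t b :: real
  assumes m: "finite_borel_measure m"
  defines "g \<equiv> (\<lambda>\<omega>. measure m {z. ennreal t < weight (config \<omega>) {z<..b}})"
  shows "g \<in> borel_measurable M" "integrable M g" "(\<integral>\<omega>. g \<omega> \<partial>M) = (\<integral>z. exceed t b z \<partial>m)"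
proof -
  interpret m: finite_borel_measure m by fact
  interpret P: pair_sigma_finite m M ..
  note [measurable_cong] = m.M_is_borel
  let ?f = "\<lambda>z \<omega>. if ennreal t < weight (config \<omega>) {z<..b} then 1 else 0 :: ennreal"
  have w [measurable]: "(\<lambda>p. weight (config (snd p)) {fst p<..b}) \<in> borel_measurable (m \<Otimes>\<^sub>M M)"
    by (rule borel_measurable_weight_config; simp; measurable)
  have f [measurable]: "case_prod ?f \<in> borel_measurable (m \<Otimes>\<^sub>M M)"
    unfolding case_prod_unfold by measurable
  have sec: "{z. ennreal t < weight (config \<omega>) {z<..b}} \<in> sets m" for \<omega>
  proof -
    have [measurable]: "(\<lambda>z. weight (config \<omega>) {z<..b}) \<in> borel_measurable borel"
      by (rule borel_measurable_weight; simp)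
    have "{z. ennreal t < weight (config \<omega>) {z<..b}} \<in> sets borel" by measurable
    then show ?thesis by (simp add: m.M_is_borel)
  qed
  have g: "ennreal (g \<omega>) = (\<integral>\<^sup>+z. ?f z \<omega> \<partial>m)" for \<omega>
  proof -
    have "(\<integral>\<^sup>+z. ?f z \<omega> \<partial>m) = (\<integral>\<^sup>+z. indicator {z. ennreal t < weight (config \<omega>) {z<..b}} z \<partial>m)"
      by (intro nn_integral_cong) auto
    also have "\<dots> = ennreal (g \<omega>)" using sec by (simp add: g_def m.emeasure_eq_measure)
    finally show ?thesis by simp
  qed
  have "(\<lambda>\<omega>. \<integral>\<^sup>+z. ?f z \<omega> \<partial>m) \<in> borel_measurable M"
    by (rule m.borel_measurable_nn_integral) (use f in \<open>simp add: measurable_pair_swap_iff[of _ m M]\<close>)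
  then have "(\<lambda>\<omega>. enn2real (\<integral>\<^sup>+z. ?f z \<omega> \<partial>m)) \<in> borel_measurable M" by measurable
  then show meas: "g \<in> borel_measurable M" by (simp add: g[symmetric] g_def)
  have g0: "0 \<le> g \<omega>" "g \<omega> \<le> measure m (space m)" for \<omega> by (simp_all add: g_def m.bounded_measure)
  show int: "integrable M g"
    using meas g0 by (intro integrable_const_bound[where B = "measure m (space m)"]) auto
  have ex: "ennreal (exceed t b z) = (\<integral>\<^sup>+\<omega>. ?f z \<omega> \<partial>M)" for z
  proof -
    have "(\<integral>\<^sup>+\<omega>. ?f z \<omega> \<partial>M) = (\<integral>\<^sup>+\<omega>. indicator {\<omega>\<in>space M. ennreal t < weight (config \<omega>) {z<..b}} \<omega> \<partial>M)"
      by (intro nn_integral_cong) auto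
    also have "\<dots> = ennreal (exceed t b z)" by (simp add: exceed_def emeasure_eq_measure)
    finally show ?thesis by simp
  qed
  have em: "exceed t b \<in> borel_measurable m" by measurable
  have "ennreal (\<integral>\<omega>. g \<omega> \<partial>M) = (\<integral>\<^sup>+\<omega>. ennreal (g \<omega>) \<partial>M)"
    using g0 by (intro nn_integral_eq_integral[symmetric] int) auto
  also have "\<dots> = (\<integral>\<^sup>+z. \<integral>\<^sup>+\<omega>. ?f z \<omega> \<partial>M \<partial>m)"
    unfolding g by (rule P.Fubini'[OF f])
  also have "\<dots> = ennreal (\<integral>z. exceed t b z \<partial>m)"
    unfolding ex[symmetric] by (rule m.integrable_unit_interval(2)[OF em]) (rule exceed_bounds)+
  finally show "(\<integral>\<omega>. g \<omega> \<partial>M) = (\<integral>z. exceed t b z \<partial>m)"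
    using g0(1) m.integrable_unit_interval(3)[OF em] exceed_bounds
    by (subst (asm) ennreal_inj) (auto intro!: integral_nonneg_AE)
qed

text \<open>Almost surely the points \<open>z\<close> with \<open>\<tau>((z,b]) > t\<close> form
  exactly the half-line below \<open>Z\<^sup>*(t;b)\<close>, so the representation of
  \<open>u\<close> applies at that point.\<close>

lemma trap_expectation_eq:
  assumes m: "finite_borel_measure m\<^sub>1" "finite_borel_measure m\<^sub>2"
    and u: "\<And>w. u w = measure m\<^sub>1 {..<w} - measure m\<^sub>2 {..<w}" and [measurable]: "u \<in> borel_measurable borel"
  shows "trap_expectation M K x y \<zeta> u t b = (\<integral>z. exceed t b z \<partial>m\<^sub>1) - (\<integral>z. exceed t b z \<partial>m\<^sub>2)"
proof -
  let ?Z = "\<lambda>\<omega>. inverse_process (random_trap_measure K x y \<zeta> \<omega>) t b"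
  let ?g = "\<lambda>m \<omega>. measure m {z. ennreal t < weight (config \<omega>) {z<..b}}"
  note g1 = integral_exceed[OF m(1), of t b] and g2 = integral_exceed[OF m(2), of t b]
  have "trap_expectation M K x y \<zeta> u t b = (\<integral>\<omega>. u (?Z \<omega>) \<partial>M)"
    by (simp add: trap_expectation_def)
  also have "\<dots> = (\<integral>\<omega>. ?g m\<^sub>1 \<omega> - ?g m\<^sub>2 \<omega> \<partial>M)"
  proof (rule integral_cong_AE)
    show "AE \<omega> in M. u (?Z \<omega>) = ?g m\<^sub>1 \<omega> - ?g m\<^sub>2 \<omega>"
      using AE_regular
    proof (rule eventually_mono)
      fix \<omega> assume "regular (config \<omega>)"
      then have "{..<?Z \<omega>} = {z. ennreal t < weight (config \<omega>) {z<..b}}"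
        by (auto simp: less_inverse_process_iff)
      then show "u (?Z \<omega>) = ?g m\<^sub>1 \<omega> - ?g m\<^sub>2 \<omega>" by (simp add: u)
    qed
  qed (use g1(1) g2(1) in measurable)
  also have "\<dots> = (\<integral>z. exceed t b z \<partial>m\<^sub>1) - (\<integral>z. exceed t b z \<partial>m\<^sub>2)"
    using g1 g2 by (simp add: Bochner_Integration.integral_diff)
  finally show ?thesis .
qed

text \<open>For \<open>t > 0\<close> its distribution function at \<open>b\<close> is the
  \<open>m\<close>-integral of \<open>exceed t b\<close>, so \<open>v(t,dx)\<close> will be the
  difference of the jump measures of \<open>m\<^sub>1\<close> and \<open>m\<^sub>2\<close>.\<close>

definition jump_measure :: "real measure \<Rightarrow> real \<Rightarrow> real measure" where
  "jump_measure m t = atomic_measure K x (\<lambda>k. \<integral>\<^sup>+z. ennreal (jump t k z) \<partial>m)"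

section \<open>Total mass, distribution function and atoms of the jump measure, and the time
  derivative\<close>

context
  fixes m assumes m: "finite_borel_measure m"
begin

interpretation m: finite_borel_measure m by (rule m)

lemma measurable_m: "f \<in> borel_measurable borel \<Longrightarrow> f \<in> borel_measurable m"
  using m.M_is_borel by (simp cong: measurable_cong_sets)

lemma emeasure_jump_measure:
  assumes A: "A \<in> sets borel"
  shows "emeasure (jump_measure m t) A = (\<integral>\<^sup>+z. (\<Sum>k. if k \<in> K \<and> x k \<in> A then ennreal (jump t k z) else 0) \<partial>m)"
proof -
  have "emeasure (jump_measure m t) A
      = (\<Sum>k. \<integral>\<^sup>+z. (if k \<in> K \<and> x k \<in> A then ennreal (jump t k z) else 0) \<partial>m)"
    unfolding jump_measure_def emeasure_atomic_measure[OF A] by (intro suminf_cong) auto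
  also have "\<dots> = (\<integral>\<^sup>+z. (\<Sum>k. if k \<in> K \<and> x k \<in> A then ennreal (jump t k z) else 0) \<partial>m)"
    by (rule nn_integral_suminf[symmetric]) (auto intro!: measurable_m)
  finally show ?thesis .
qed

text \<open>For each \<open>z\<close> the jumps add up to the probability of a union of disjoint
  events. The bound is uniform in \<open>t\<close>, which is what the supremum in clause (iv)
  requires.\<close>

lemma emeasure_jump_measure_UNIV_le: "emeasure (jump_measure m t) UNIV \<le> emeasure m UNIV"
proof -
  have "(\<Sum>k. if k \<in> K \<and> x k \<in> UNIV then ennreal (jump t k z) else 0) \<le> 1" for z
  proof -
    have s: "(\<lambda>k. if k \<in> K then jump t k z else 0) sums
      prob {\<omega>\<in>space M. \<exists>k\<in>K. weight (config \<omega>) {z<..<x k} \<le> ennreal t \<and> ennreal t < weight (config \<omega>) {z<..x k}}" (is "_ sums ?p")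
      by (rule jump_sums) simp
    have "(\<lambda>k. ennreal (if k \<in> K then jump t k z else 0)) sums ennreal ?p"
      by (rule sums_ennreal[THEN iffD2, OF _ _ s]) (auto simp: jump_bounds)
    then have "(\<Sum>k. ennreal (if k \<in> K then jump t k z else 0)) = ennreal ?p" by (rule sums_unique[symmetric])
    moreover have "(\<lambda>k. if k \<in> K \<and> x k \<in> UNIV then ennreal (jump t k z) else 0) = (\<lambda>k. ennreal (if k \<in> K then jump t k z else 0))"
      by auto
    ultimately show ?thesis by simp
  qed
  then have "emeasure (jump_measure m t) UNIV \<le> (\<integral>\<^sup>+z. 1 \<partial>m)"
    by (subst emeasure_jump_measure) (simp, rule nn_integral_mono)
  then show ?thesis by (simp add: m.borel_UNIV)
qed

lemma finite_borel_jump_measure: "finite_borel_measure (jump_measure m t)"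
proof -
  have "emeasure (jump_measure m t) UNIV < \<infinity>"
    by (rule le_less_trans[OF emeasure_jump_measure_UNIV_le]) (simp add: less_top[symmetric])
  then show ?thesis
    unfolding jump_measure_def by (intro finite_borel_measure_atomic_measure) (simp add: emeasure_atomic_measure)
qed

lemma cdf_jump_measure:
  assumes t: "0 < t"
  shows "cdf (jump_measure m t) b = (\<integral>z. exceed t b z \<partial>m)"
proof -
  interpret j: finite_borel_measure "jump_measure m t" by (rule finite_borel_jump_measure)
  have "(\<Sum>k. if k \<in> K \<and> x k \<in> {..b} then ennreal (jump t k z) else 0) = ennreal (exceed t b z)" for z
  proof -
    have "(\<lambda>k. ennreal (if k \<in> K \<and> x k \<le> b then jump t k z else 0)) sums ennreal (exceed t b z)"
      by (rule sums_ennreal[THEN iffD2, OF _ _ exceed_sums_jump[OF t]]) (auto simp: jump_bounds exceed_bounds)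
    moreover have "(\<lambda>k. ennreal (if k \<in> K \<and> x k \<le> b then jump t k z else 0)) = (\<lambda>k. if k \<in> K \<and> x k \<in> {..b} then ennreal (jump t k z) else 0)"
      by auto
    ultimately show ?thesis by (simp add: sums_iff)
  qed
  then have "emeasure (jump_measure m t) {..b} = (\<integral>\<^sup>+z. ennreal (exceed t b z) \<partial>m)"
    by (subst emeasure_jump_measure) auto
  also have "\<dots> = ennreal (\<integral>z. exceed t b z \<partial>m)"
    by (rule m.integrable_unit_interval(2)) (auto intro!: measurable_m exceed_bounds)
  finally show ?thesis
    unfolding cdf_def j.emeasure_eq_measure
    by (subst (asm) ennreal_inj) (auto intro!: integral_nonneg_AE exceed_bounds)
qed

lemma measure_jump_measure_point:
  assumes k: "k \<in> K"
  shows "measure (jump_measure m t) {x k} = (\<integral>z. jump t k z \<partial>m)"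
proof -
  interpret j: finite_borel_measure "jump_measure m t" by (rule finite_borel_jump_measure)
  have "emeasure (jump_measure m t) {x k}
      = (\<Sum>i. if i = k then \<integral>\<^sup>+z. ennreal (jump t k z) \<partial>m else 0)"
    unfolding jump_measure_def using k inj_onD[OF inj _ _ k]
    by (subst emeasure_atomic_measure) (auto intro!: suminf_cong)
  also have "\<dots> = (\<integral>\<^sup>+z. ennreal (jump t k z) \<partial>m)"
    using sums_single[of k "\<lambda>_. \<integral>\<^sup>+z. ennreal (jump t k z) \<partial>m"] by (simp add: sums_iff)
  also have "\<dots> = ennreal (\<integral>z. jump t k z \<partial>m)"
    by (rule m.integrable_unit_interval(2)) (auto intro!: measurable_m jump_bounds)
  finally show ?thesis
    unfolding j.emeasure_eq_measure
    by (subst (asm) ennreal_inj) (auto intro!: integral_nonneg_AE jump_bounds)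
qed

text \<open>Integrated over \<open>z\<close>, the exponential average is the resolvent
  \<open>\<Phi>\<close> of \<open>\<psi>\<close>, and \<open>\<psi> - \<Phi>\<close> is minus the
  integrated jump. \<open>\<Phi>\<close> is differentiable on the whole line but agrees with the
  left-hand function only at nonnegative times, hence the derivative within
  \<open>{0..}\<close>.\<close>

lemma integral_exceed_derivative:
  assumes k: "k \<in> K" and t: "0 \<le> t"
  shows "((\<lambda>s. \<integral>z. exceed s (x k) z \<partial>m) has_vector_derivative - (\<integral>z. jump t k z \<partial>m) / mass k)
    (at t within {0..})"
proof -
  define \<psi> where "\<psi> r = (\<integral>z. exceed_left r (x k) z \<partial>m)" for r
  define \<Phi> where "\<Phi> t = (\<integral>s. exponential_density 1 s * \<psi> (t - mass k * s) \<partial>lborel)" for t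
  note e = m.integrable_unit_interval[OF measurable_m[OF exceed_measurable(1)] exceed_bounds(1,2)]
  note el = m.integrable_unit_interval[OF measurable_m[OF exceed_measurable(2)] exceed_bounds(3,4)]
  have cont: "continuous_on UNIV \<psi>"
  proof (rule continuous_at_imp_continuous_on, intro ballI, unfold continuous_at_sequentially comp_def, intro allI impI)
    fix r :: real and R :: "nat \<Rightarrow> real" assume R: "R \<longlonglongrightarrow> r"
    show "(\<lambda>n. \<psi> (R n)) \<longlonglongrightarrow> \<psi> r"
      unfolding \<psi>_def
    proof (rule integral_dominated_convergence[where w = "\<lambda>_. 1"])
      show "AE z in m. (\<lambda>n. exceed_left (R n) (x k) z) \<longlonglongrightarrow> exceed_left r (x k) z"
        using continuous_on_tendsto_compose[OF continuous_on_exceed_left R] by simp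
    qed (auto simp: exceed_bounds intro!: measurable_m)
  qed
  have [measurable]: "\<psi> \<in> borel_measurable borel"
    by (rule borel_measurable_continuous_onI[OF cont])
  have bdd: "\<bar>\<psi> r\<bar> \<le> measure m (space m)" for r
    using el(3,4)[of r "x k"] by (simp add: \<psi>_def)
  have eq: "(\<integral>z. exceed s (x k) z \<partial>m) = \<Phi> s" if s: "0 \<le> s" for s
  proof -
    interpret P: pair_sigma_finite lborel m ..
    note [measurable_cong] = m.M_is_borel
    let ?f = "\<lambda>r z. ennreal (exponential_density 1 r) * ennreal (exceed_left (s - mass k * r) (x k) z)"
    have [measurable]: "(\<lambda>p. exceed_left (s - mass k * fst p) (x k) (snd p)) \<in> borel_measurable (lborel \<Otimes>\<^sub>M m)"
      using measurable_compose[OF _ exceed_measurable2(2)[of "x k"], of "\<lambda>p. (s - mass k * fst p, snd p)" "lborel \<Otimes>\<^sub>M m"]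
      by simp
    have f: "case_prod ?f \<in> borel_measurable (lborel \<Otimes>\<^sub>M m)"
      unfolding case_prod_unfold by measurable
    have "ennreal (\<integral>z. exceed s (x k) z \<partial>m) = (\<integral>\<^sup>+z. \<integral>\<^sup>+r. ?f r z \<partial>lborel \<partial>m)"
      unfolding e(2)[symmetric] exceed_eq_nn_integral[OF k s] ..
    also have "\<dots> = (\<integral>\<^sup>+r. \<integral>\<^sup>+z. ?f r z \<partial>m \<partial>lborel)"
      by (rule P.Fubini'[OF f])
    also have "\<dots> = (\<integral>\<^sup>+r. ennreal (exponential_density 1 r * \<psi> (s - mass k * r)) \<partial>lborel)"
      by (intro nn_integral_cong, subst nn_integral_cmult)
         (auto intro!: measurable_m simp: el(2) \<psi>_def ennreal_mult' exponential_density_nonneg)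
    finally have "(\<integral>\<^sup>+r. ennreal (exponential_density 1 r * \<psi> (s - mass k * r)) \<partial>lborel)
        = ennreal (\<integral>z. exceed s (x k) z \<partial>m)" by simp
    moreover have "\<Phi> s = enn2real (\<integral>\<^sup>+r. ennreal (exponential_density 1 r * \<psi> (s - mass k * r)) \<partial>lborel)"
      unfolding \<Phi>_def
      by (rule integral_eq_nn_integral) (auto simp: exponential_density_nonneg \<psi>_def el(3))
    ultimately show ?thesis using e(3) by simp
  qed
  have "(\<Phi> has_vector_derivative (\<psi> t - \<Phi> t) / mass k) (at t within {0..})"
    using resolvent_has_vector_derivative[OF cont bdd mass_pos[OF k], of t]
    unfolding \<Phi>_def[abs_def] by (rule has_vector_derivative_at_within)
  then have "((\<lambda>s. \<integral>z. exceed s (x k) z \<partial>m) has_vector_derivative (\<psi> t - \<Phi> t) / mass k) (at t within {0..})"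
    by (rule has_vector_derivative_transform[rotated 2]) (use t eq in auto)
  moreover have "\<psi> t - \<Phi> t = - (\<integral>z. jump t k z \<partial>m)"
    unfolding eq[OF t, symmetric] \<psi>_def jump_def using e(1) el(1)
    by (simp add: Bochner_Integration.integral_diff)
  ultimately show ?thesis by simp
qed

end

text \<open>At time 0 every point to the left of the trap is already passed before the trap is
  reached, so the two probabilities agree. This is the vanishing initial derivative.\<close>

lemma jump_0: "jump 0 k = (\<lambda>z. 0)"
proof
  fix z
  show "jump 0 k z = 0"
    using exceed_left_nonpos[of z "x k" 0] exceed_eq_0[of "x k" z 0]
    by (cases "z < x k") (auto simp: jump_def exceed_0)
qed

section \<open>The expectation solves the evolution equation\<close>

theorem trap_evolution_trap_expectation:
  assumes m1: "finite_borel_measure m\<^sub>1" and m2: "finite_borel_measure m\<^sub>2"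
    and u: "\<And>w. u w = measure m\<^sub>1 {..<w} - measure m\<^sub>2 {..<w}" and um: "u \<in> borel_measurable borel"
  shows "trap_evolution (x ` K) (trap_measure K x y) u (trap_expectation M K x y \<zeta> u)"
proof -
  interpret m1: finite_borel_measure m\<^sub>1 by (rule m1)
  interpret m2: finite_borel_measure m\<^sub>2 by (rule m2)
  let ?v = "trap_expectation M K x y \<zeta> u"
  let ?\<sigma> = "trap_measure K x y"
  let ?q = "\<lambda>t k. (\<integral>z. jump t k z \<partial>m\<^sub>1) - (\<integral>z. jump t k z \<partial>m\<^sub>2)"
  note v = trap_expectation_eq[OF m1 m2 u um]
  note em = measurable_m[OF m1 exceed_measurable(1)] measurable_m[OF m2 exceed_measurable(1)]
  note e1 = m1.integrable_unit_interval[OF em(1) exceed_bounds(1,2)]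
  note e2 = m2.integrable_unit_interval[OF em(2) exceed_bounds(1,2)]
  note j1 = m1.integrable_unit_interval[OF measurable_m[OF m1 jump_measurable] jump_bounds]
  note j2 = m2.integrable_unit_interval[OF measurable_m[OF m2 jump_measurable] jump_bounds]
  have deriv: "((\<lambda>s. ?v s (x k)) has_vector_derivative - ?q t k / mass k) (at t within {0..})"
    if "k \<in> K" "0 \<le> t" for k t
    using has_vector_derivative_diff[OF integral_exceed_derivative[OF m1 that] integral_exceed_derivative[OF m2 that]]
    unfolding v by (simp add: diff_divide_distrib)
  have time: "time_deriv ?v t (x k) = - ?q t k / mass k" if "k \<in> K" "0 \<le> t" for k t
    unfolding time_deriv_def
  proof (rule vector_derivative_within[OF _ deriv[OF that]])
    \<comment> \<open>The derivative within \<open>{0..}\<close> is unique because \<open>t\<close>,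
      including \<open>t = 0\<close>, is a limit point of that set.\<close>
    have "t islimpt {0..t + 1}" using that by (intro islimpt_Icc[THEN iffD2]) auto
    then show "at t within {0..} \<noteq> bot"
      unfolding trivial_limit_within by (auto elim: islimpt_subset)
  qed
  have "\<forall>b. ?v 0 b = u b"
  proof
    fix b
    have "(\<integral>z. exceed 0 b z \<partial>m) = measure m {..<b}" if "finite_borel_measure m" for m
    proof -
      interpret m: finite_borel_measure m by fact
      have "(\<integral>z. exceed 0 b z \<partial>m) = (\<integral>z. indicator {..<b} z \<partial>m)"
        by (intro Bochner_Integration.integral_cong) (auto simp: exceed_0)
      then show ?thesis by (simp add: m.M_is_borel m.borel_UNIV)
    qed
    then show "?v 0 b = u b" using m1 m2 by (simp add: v u)
  qed
  moreover have "bounded {?v t z |t z. 0 \<le> t}"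
  proof -
    have "\<bar>?v t z\<bar> \<le> measure m\<^sub>1 (space m\<^sub>1) + measure m\<^sub>2 (space m\<^sub>2)" for t z
      using e1(3,4)[of t z] e2(3,4)[of t z] unfolding v by linarith
    then show ?thesis
      by (intro boundedI[of _ "measure m\<^sub>1 (space m\<^sub>1) + measure m\<^sub>2 (space m\<^sub>2)"]) auto
  qed
  moreover have st: "right_cont_left_limits (?v t) \<and> bounded_variation (?v t) \<and>
      signed_absolutely_continuous ?\<sigma> (stieltjes_measure (?v t)) \<and>
      (\<forall>k\<in>K. signed_RN_deriv ?\<sigma> (stieltjes_measure (?v t)) (x k) = ?q t k / mass k)" if t: "0 < t" for t
  proof -
    let ?n1 = "jump_measure m\<^sub>1 t" and ?n2 = "jump_measure m\<^sub>2 t"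
    note n = finite_borel_jump_measure[OF m1, of t] finite_borel_jump_measure[OF m2, of t]
    have vt: "?v t = (\<lambda>b. cdf ?n1 b - cdf ?n2 b)"
      by (simp add: fun_eq_iff v cdf_jump_measure[OF m1 t] cdf_jump_measure[OF m2 t])
    note props = cdf_diff_properties[OF n, folded vt]
    have ac: "signed_absolutely_continuous ?\<sigma> (stieltjes_measure (?v t))"
      unfolding signed_absolutely_continuous_def
    proof
      fix A assume "A \<in> null_sets ?\<sigma>"
      then have A: "A \<in> sets borel" and "emeasure ?\<sigma> A = 0" by (auto simp: trap_measure_def null_sets_def)
      then have "(\<Sum>k. if k \<in> K \<and> x k \<in> A then y k else 0) = 0"
        by (simp add: trap_measure_def emeasure_atomic_measure)
      \<comment> \<open>A null set of the trap measure contains no trap, as each \<open>y k\<close>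
        is positive, and both jump measures are carried by the traps.\<close>
      then have "k \<in> K \<Longrightarrow> x k \<notin> A" for k
        using y_pos[of k] by (auto simp: suminf_eq_zero_iff split: if_splits)
      then have "emeasure (jump_measure m t) A = 0" for m
        unfolding jump_measure_def using A by (subst emeasure_atomic_measure) (auto simp: suminf_eq_zero_iff)
      then show "stieltjes_measure (?v t) A = 0" by (simp add: props(3)[OF A] measure_def)
    qed
    have "signed_RN_deriv ?\<sigma> (stieltjes_measure (?v t)) (x k) = ?q t k / mass k" if k: "k \<in> K" for k
      by (simp add: signed_RN_deriv_trap_measure[OF stieltjes_measure(1)[OF props(1,2)] ac k] props(3)
          measure_jump_measure_point[OF m1 k] measure_jump_measure_point[OF m2 k])
    then show ?thesis using props(1,2) ac by blast
  qed
  moreover have "\<forall>z\<in>x ` K. (\<lambda>t. ?v t z) differentiable_on {0..} \<and>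
      (\<forall>t\<ge>0. - time_deriv ?v t z = (if t = 0 then 0 else signed_RN_deriv ?\<sigma> (stieltjes_measure (?v t)) z))"
  proof
    fix z assume "z \<in> x ` K"
    then obtain k where k: "k \<in> K" and z: "z = x k" by auto
    have "(\<lambda>t. ?v t z) differentiable_on {0..}"
      unfolding differentiable_on_def z using deriv[OF k] by (auto intro: differentiableI_vector)
    moreover have "- time_deriv ?v t z = (if t = 0 then 0 else signed_RN_deriv ?\<sigma> (stieltjes_measure (?v t)) z)"
      if "0 \<le> t" for t
    proof (cases "t = 0")
      case True
      then show ?thesis using k by (simp add: z time jump_0)
    next
      case False
      then show ?thesis using st[of t] k that unfolding z time[OF k that] by (simp add: minus_divide_left)
    qed
    ultimately show "(\<lambda>t. ?v t z) differentiable_on {0..} \<and>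
      (\<forall>t\<ge>0. - time_deriv ?v t z = (if t = 0 then 0 else signed_RN_deriv ?\<sigma> (stieltjes_measure (?v t)) z))" by blast
  qed
  moreover have "(SUP t\<in>{0..}. \<integral>\<^sup>+z\<in>x ` K. ennreal \<bar>time_deriv ?v t z\<bar> \<partial>?\<sigma>) < \<infinity>"
  proof -
    have "(\<integral>\<^sup>+z\<in>x ` K. ennreal \<bar>time_deriv ?v t z\<bar> \<partial>?\<sigma>) \<le> emeasure m\<^sub>1 UNIV + emeasure m\<^sub>2 UNIV" if t: "0 \<le> t" for t
    proof -
      have "(\<integral>\<^sup>+z\<in>x ` K. ennreal \<bar>time_deriv ?v t z\<bar> \<partial>?\<sigma>)
          = (\<Sum>k. if k \<in> K then y k * ennreal \<bar>time_deriv ?v t (x k)\<bar> else 0)"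
        by (rule nn_integral_traps)
      also have "\<dots> \<le> (\<Sum>k. (if k \<in> K \<and> x k \<in> UNIV then \<integral>\<^sup>+z. ennreal (jump t k z) \<partial>m\<^sub>1 else 0)
          + (if k \<in> K \<and> x k \<in> UNIV then \<integral>\<^sup>+z. ennreal (jump t k z) \<partial>m\<^sub>2 else 0))"
      proof (intro suminf_le)
        fix k
        have "y k * ennreal \<bar>time_deriv ?v t (x k)\<bar>
            \<le> (\<integral>\<^sup>+z. ennreal (jump t k z) \<partial>m\<^sub>1) + (\<integral>\<^sup>+z. ennreal (jump t k z) \<partial>m\<^sub>2)" if k: "k \<in> K"
        proof -
          \<comment> \<open>The trap mass cancels the denominator of the time derivative. What
            remains is the atom of \<open>v(t,dx)\<close>, bounded by the two jump
            integrals.\<close>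
          have "y k * ennreal \<bar>time_deriv ?v t (x k)\<bar> = ennreal (mass k * \<bar>time_deriv ?v t (x k)\<bar>)"
            using mass_pos[OF k] by (simp add: ennreal_mult ennreal_mass[OF k] less_imp_le)
          also have "mass k * \<bar>time_deriv ?v t (x k)\<bar> = \<bar>?q t k\<bar>"
            using mass_pos[OF k] by (simp add: time[OF k t] abs_divide abs_minus_commute)
          also have "ennreal \<bar>?q t k\<bar> \<le> ennreal ((\<integral>z. jump t k z \<partial>m\<^sub>1) + (\<integral>z. jump t k z \<partial>m\<^sub>2))"
            using j1(3)[of t k] j2(3)[of t k] by (intro ennreal_leI) linarith
          also have "\<dots> = (\<integral>\<^sup>+z. ennreal (jump t k z) \<partial>m\<^sub>1) + (\<integral>\<^sup>+z. ennreal (jump t k z) \<partial>m\<^sub>2)"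
            using j1(2,3)[of t k] j2(2,3)[of t k] by (simp add: ennreal_plus)
          finally show ?thesis .
        qed
        then show "(if k \<in> K then y k * ennreal \<bar>time_deriv ?v t (x k)\<bar> else 0)
          \<le> (if k \<in> K \<and> x k \<in> UNIV then \<integral>\<^sup>+z. ennreal (jump t k z) \<partial>m\<^sub>1 else 0)
          + (if k \<in> K \<and> x k \<in> UNIV then \<integral>\<^sup>+z. ennreal (jump t k z) \<partial>m\<^sub>2 else 0)" by simp
      qed auto
      also have "\<dots> = emeasure (jump_measure m\<^sub>1 t) UNIV + emeasure (jump_measure m\<^sub>2 t) UNIV"
        unfolding jump_measure_def by (simp only: emeasure_atomic_measure sets.top space_borel[symmetric]) (rule suminf_add[symmetric]; simp)
      also have "\<dots> \<le> emeasure m\<^sub>1 UNIV + emeasure m\<^sub>2 UNIV"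
        by (intro add_mono emeasure_jump_measure_UNIV_le m1 m2)
      finally show ?thesis .
    qed
    then have "(SUP t\<in>{0..}. \<integral>\<^sup>+z\<in>x ` K. ennreal \<bar>time_deriv ?v t z\<bar> \<partial>?\<sigma>) \<le> emeasure m\<^sub>1 UNIV + emeasure m\<^sub>2 UNIV"
      by (intro SUP_least) auto
    also have "\<dots> < \<infinity>"
      using m1.emeasure_finite[of UNIV] m2.emeasure_finite[of UNIV] by (simp add: less_top[symmetric])
    finally show ?thesis .
  qed
  ultimately show ?thesis
    unfolding trap_evolution_def by blast
qed

end

section \<open>Trap processes as configurations\<close>

lemma borel_Times_ennreal:
  fixes A :: "real set" and B :: "ennreal set"
  assumes "A \<in> sets borel" "B \<in> sets borel"
  shows "A \<times> B \<in> sets borel"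
  using pair_measureI[OF assms] by (simp only: borel_prod)

lemma point_process_measurable:
  assumes "\<forall>k\<in>K. 0 < y k"
  shows "(\<lambda>k. (x k, y k)) \<in> measurable (count_space K)
    (restrict_space borel (UNIV \<times> {0<..}) :: (real \<times> ennreal) measure)"
  using assms by (auto simp: space_restrict_space)

text \<open>Points are counted through their indices, so coinciding points count with multiplicity;
  this lets the condition on single fibres yield injectivity of \<open>x\<close>.\<close>

lemma emeasure_point_process:
  assumes y: "\<forall>k\<in>K. 0 < y k" and A: "A \<in> sets borel" and B: "B \<in> sets borel" "B \<subseteq> {0<..}"
  shows "emeasure (point_process K x y) (A \<times> B) = emeasure (count_space K) {k\<in>K. x k \<in> A \<and> y k \<in> B}"
proof -
  have "A \<times> B \<in> sets (restrict_space borel (UNIV \<times> {0<..}))"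
    using borel_Times_ennreal[OF A B(1)] B(2)
    by (subst sets_restrict_space_iff) (auto intro!: borel_Times_ennreal)
  then have "emeasure (point_process K x y) (A \<times> B)
      = emeasure (count_space K) ((\<lambda>k. (x k, y k)) -` (A \<times> B) \<inter> K)"
    unfolding point_process_def by (subst emeasure_distr[OF point_process_measurable[OF y]]) auto
  also have "(\<lambda>k. (x k, y k)) -` (A \<times> B) \<inter> K = {k\<in>K. x k \<in> A \<and> y k \<in> B}" by auto
  finally show ?thesis .
qed

lemma emeasure_point_process_finite_iff:
  assumes "\<forall>k\<in>K. 0 < y k" "A \<in> sets borel" "B \<in> sets borel" "B \<subseteq> {0<..}"
  shows "emeasure (point_process K x y) (A \<times> B) < \<infinity> \<longleftrightarrow> finite {k\<in>K. x k \<in> A \<and> y k \<in> B}"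
  unfolding emeasure_point_process[OF assms]
  by (subst emeasure_count_space) (auto simp: of_nat_less_top)

lemma trap_locations_point_process:
  assumes y: "\<forall>k\<in>K. 0 < y k" and fin: "\<And>k. k \<in> K \<Longrightarrow> y k < \<infinity>"
  shows "trap_locations (point_process K x y) = x ` K"
proof -
  have "0 < emeasure (point_process K x y) ({z} \<times> {0<..<\<infinity>}) \<longleftrightarrow> z \<in> x ` K" for z
  proof -
    have "emeasure (point_process K x y) ({z} \<times> {0<..<\<infinity>}) = emeasure (count_space K) {k\<in>K. x k \<in> {z} \<and> y k \<in> {0<..<\<infinity>}}"
      by (rule emeasure_point_process[OF y]) auto
    moreover have "{k\<in>K. x k \<in> {z} \<and> y k \<in> {0<..<\<infinity>}} = {k\<in>K. x k = z}" using y fin by auto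
    ultimately show ?thesis by (auto simp: emeasure_count_space_eq_0 zero_less_iff_neq_zero)
  qed
  then show ?thesis by (auto simp: trap_locations_def)
qed

text \<open>Two indices at the same position would give a fibre mass of at least 2, against
  condition (2). Local finiteness of the trap measure combines the Radon property for deep traps
  with condition (4) for shallow ones.\<close>

lemma trap_config_point_process:
  assumes y: "\<forall>k\<in>K. 0 < y k" and W: "point_process K x y \<in> dense_trap_processes"
  shows "trap_config K x y"
proof -
  let ?W = "point_process K x y"
  have T: "?W \<in> trap_processes" and dense: "closure (trap_locations ?W) = UNIV"
    using W by (simp_all add: dense_trap_processes_def)
  note T = T[unfolded trap_processes_def mem_Collect_eq, THEN conjunct2]
  have comp: "\<And>C. compact C \<Longrightarrow> C \<subseteq> UNIV \<times> {0<..} \<Longrightarrow> emeasure ?W C < \<infinity>"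
    using T[THEN conjunct1] by blast
  note T = T[THEN conjunct2]
  have inf0: "emeasure ?W (UNIV \<times> {\<infinity>}) = 0" by (rule T[THEN conjunct1])
  note T = T[THEN conjunct2]
  have one: "(SUP z. emeasure ?W ({z} \<times> {0<..})) = 1" by (rule T[THEN conjunct1])
  note T = T[THEN conjunct2]
  have left: "\<exists>\<epsilon>::real. 0 < \<epsilon> \<and> (\<forall>L::real. emeasure ?W ({..-L} \<times> {ennreal \<epsilon>..<\<infinity>}) = \<infinity>)"
    using T[THEN conjunct1] by blast
  have small: "(\<integral>\<^sup>+p\<in>{-L..L} \<times> {0<..<ennreal \<epsilon>}. snd p \<partial>?W) < \<infinity>" if "\<epsilon> > 0" for \<epsilon> L :: real
    using T[THEN conjunct2] that by blast
  have fin: "y k < \<infinity>" if "k \<in> K" for k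
  proof (rule ccontr)
    assume "\<not> y k < \<infinity>"
    then have "k \<in> {k\<in>K. x k \<in> UNIV \<and> y k \<in> {\<infinity>}}" using that by (simp add: less_top[symmetric])
    moreover have "emeasure (count_space K) {k\<in>K. x k \<in> UNIV \<and> y k \<in> {\<infinity>}} = 0"
      using inf0 by (subst (asm) emeasure_point_process[OF y]) auto
    ultimately show False by (auto simp: emeasure_count_space_eq_0)
  qed
  show ?thesis
  proof
    show "inj_on x K"
    proof (rule inj_onI, rule ccontr)
      fix i j assume ij: "i \<in> K" "j \<in> K" "x i = x j" "i \<noteq> j"
      have "2 = emeasure (count_space K) {i, j}" using ij by (subst emeasure_count_space_finite) auto
      also have "\<dots> \<le> emeasure (count_space K) {k\<in>K. x k \<in> {x i} \<and> y k \<in> {0<..}}"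
        using ij y by (intro emeasure_mono) auto
      also have "\<dots> = emeasure ?W ({x i} \<times> {0<..})"
        by (rule emeasure_point_process[OF y, symmetric]) auto
      also have "\<dots> \<le> (SUP z. emeasure ?W ({z} \<times> {0<..}))" by (intro SUP_upper) simp
      finally show False unfolding one by simp
    qed
    show "0 < y k" "y k < \<infinity>" if "k \<in> K" for k using that y fin by auto
    show "\<exists>k\<in>K. a < x k \<and> x k < b" if "a < b" for a b
    proof -
      have "{a<..<b} \<inter> closure (x ` K) \<noteq> {}"
        using dense that by (simp add: trap_locations_point_process[OF y fin])
      then have "{a<..<b} \<inter> x ` K \<noteq> {}" by (simp add: open_Int_closure_eq_empty)
      then show ?thesis by auto
    qed
    show "\<exists>e>0. \<forall>L. infinite {k\<in>K. x k \<le> L \<and> ennreal e \<le> y k}"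
    proof -
      obtain e :: real where e: "0 < e" "\<And>L. emeasure ?W ({..-L} \<times> {ennreal e..<\<infinity>}) = \<infinity>"
        using left by blast
      have "infinite {k\<in>K. x k \<le> L \<and> ennreal e \<le> y k}" for L
      proof -
        have "{ennreal e..<\<infinity>} \<subseteq> {0<..}" using e(1) by (auto simp: less_le_trans[of 0 "ennreal e"])
        then have "infinite {k\<in>K. x k \<in> {..- (- L)} \<and> y k \<in> {ennreal e..<\<infinity>}}"
          using e(2)[of "- L"] by (subst emeasure_point_process_finite_iff[OF y, symmetric]) auto
        then show ?thesis by (rule infinite_super[rotated]) auto
      qed
      then show ?thesis using e(1) by auto
    qed
    show "emeasure (trap_measure K x y) {a..b} < \<infinity>" for a b
    proof -
      define L where "L = max \<bar>a\<bar> \<bar>b\<bar>"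
      \<comment> \<open>The threshold 1 is arbitrary. In the window the traps of mass at least 1 are
        finitely many, because \<open>{1..}\<close> is compact in the extended half-line; those of
        smaller mass are summable.\<close>
      let ?B = "{k\<in>K. x k \<in> {-L..L} \<and> y k \<in> {1..}}"
      have "compact ({1..} :: ennreal set)"
        by (simp add: compact_eq_closed)
      then have "emeasure ?W ({-L..L} \<times> {1..}) < \<infinity>"
        by (intro comp compact_Times) (auto simp: less_le_trans[of 0 1])
      then have finB: "finite ?B"
        by (subst (asm) emeasure_point_process_finite_iff[OF y]) (auto simp: less_le_trans[of 0 1])
      let ?f = "\<lambda>p. snd p * indicator ({-L..L} \<times> {0<..<ennreal 1}) p"
      have "?f \<in> borel_measurable (borel :: (real \<times> ennreal) measure)"
        using borel_Times_ennreal[of "{-L..L}" "{0<..<ennreal 1}"]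
        by (intro borel_measurable_times_ennreal borel_measurable_indicator)
           (auto simp: borel_prod[symmetric])
      then have "?f \<in> borel_measurable (restrict_space borel (UNIV \<times> {0<..}))"
        by (rule measurable_restrict_space1)
      then have "(\<integral>\<^sup>+p. ?f p \<partial>?W)
          = (\<integral>\<^sup>+k. y k * indicator ({-L..L} \<times> {0<..<ennreal 1}) (x k, y k) \<partial>count_space K)"
        unfolding point_process_def
        by (subst nn_integral_distr[OF point_process_measurable[OF y]]) simp_all
      also have "\<dots> = (\<Sum>k. if k \<in> K \<and> x k \<in> {-L..L} \<and> y k < 1 then y k else 0)"
        by (subst nn_integral_count_space_indicator)
           (use y in \<open>auto simp: nn_integral_count_space_nat indicator_def intro!: suminf_cong\<close>)
      finally have s: "(\<Sum>k. if k \<in> K \<and> x k \<in> {-L..L} \<and> y k < 1 then y k else 0) < \<infinity>"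
        using small[of 1 L] by simp
      have "emeasure (trap_measure K x y) {a..b} \<le> emeasure (trap_measure K x y) {-L..L}"
        by (intro emeasure_mono) (auto simp: L_def trap_measure_def)
      also have "\<dots> = (\<Sum>k. (if k \<in> K \<and> x k \<in> {-L..L} \<and> y k < 1 then y k else 0) + (if k \<in> ?B then y k else 0))"
        unfolding trap_measure_def
        by (subst emeasure_atomic_measure) (auto intro!: suminf_cong simp: not_less)
      also have "\<dots> = (\<Sum>k. if k \<in> K \<and> x k \<in> {-L..L} \<and> y k < 1 then y k else 0) + (\<Sum>k. if k \<in> ?B then y k else 0)"
        by (rule suminf_add[symmetric]) auto
      also have "(\<Sum>k. if k \<in> ?B then y k else 0) = (\<Sum>k\<in>?B. y k)"
        by (subst suminf_finite[OF finB]) auto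
      also have "(\<Sum>k. if k \<in> K \<and> x k \<in> {-L..L} \<and> y k < 1 then y k else 0) + (\<Sum>k\<in>?B. y k) < \<infinity>"
        using s finB fin by (auto simp: less_top)
      finally show ?thesis .
    qed
  qed
qed

text \<open>The decomposition fixes only the increments of \<open>u\<close>. Compact support anchors
  them at minus infinity, where both distribution functions vanish; continuity then replaces their
  values by left limits, that is, by the masses of open half-lines.\<close>

lemma compact_support_bounded_variation_representation:
  fixes u :: "real \<Rightarrow> real"
  assumes cont: "continuous_on UNIV u" and supp: "compact (closure {z. u z \<noteq> 0})"
    and bv: "bounded_variation u"
  obtains m\<^sub>1 m\<^sub>2 where "finite_borel_measure m\<^sub>1" "finite_borel_measure m\<^sub>2"
    "\<And>w. u w = measure m\<^sub>1 {..<w} - measure m\<^sub>2 {..<w}"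
proof -
  have isCont: "isCont u z" for z using cont by (simp add: continuous_on_eq_continuous_at)
  have rc: "continuous (at_right z) u" for z
    by (rule continuous_at_imp_continuous_at_within[OF isCont])
  obtain m\<^sub>1 m\<^sub>2 where m: "finite_borel_measure m\<^sub>1" "finite_borel_measure m\<^sub>2"
    and d: "\<And>a b. a \<le> b \<Longrightarrow> u b - u a = measure m\<^sub>1 {a<..b} - measure m\<^sub>2 {a<..b}"
    by (rule bounded_variation_decomposition[OF bv rc]) (rule that)
  interpret m1: finite_borel_measure m\<^sub>1 by fact
  interpret m2: finite_borel_measure m\<^sub>2 by fact
  have u_cdf: "u b = cdf m\<^sub>1 b - cdf m\<^sub>2 b" for b
  proof -
    have "bounded {z. u z \<noteq> 0}"
      using compact_imp_bounded[OF supp] closure_subset by (rule bounded_subset)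
    then obtain R where R: "\<And>z. u z \<noteq> 0 \<Longrightarrow> \<bar>z\<bar> \<le> R" by (auto simp: bounded_iff)
    have "\<forall>\<^sub>F a in at_bot. cdf m\<^sub>1 b - cdf m\<^sub>2 b - (cdf m\<^sub>1 a - cdf m\<^sub>2 a) = u b"
      using eventually_le_at_bot[of "min b (- R) - 1"]
    proof eventually_elim
      case (elim a)
      then have "u a = 0" using R[of a] by linarith
      moreover have "a < b" using elim by simp
      ultimately show ?case
        using d[of a b] m1.cdf_diff_eq[of a b] m2.cdf_diff_eq[of a b] by linarith
    qed
    moreover have "((\<lambda>a. cdf m\<^sub>1 b - cdf m\<^sub>2 b - (cdf m\<^sub>1 a - cdf m\<^sub>2 a)) \<longlongrightarrow> cdf m\<^sub>1 b - cdf m\<^sub>2 b - (0 - 0)) at_bot"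
      by (intro tendsto_diff tendsto_const m1.cdf_lim_at_bot m2.cdf_lim_at_bot)
    ultimately have "((\<lambda>a. u b) \<longlongrightarrow> cdf m\<^sub>1 b - cdf m\<^sub>2 b - (0 - 0)) (at_bot :: real filter)"
      by (rule Lim_transform_eventually[rotated])
    then show ?thesis
      by (simp add: tendsto_const_iff)
  qed
  show ?thesis
  proof (rule that[OF m])
    fix w
    show "u w = measure m\<^sub>1 {..<w} - measure m\<^sub>2 {..<w}"
    proof (rule tendsto_unique[of "at_left w"])
      show "(u \<longlongrightarrow> u w) (at_left w)"
        using isCont[of w] unfolding isCont_def by (rule tendsto_within_subset) simp
      show "(u \<longlongrightarrow> measure m\<^sub>1 {..<w} - measure m\<^sub>2 {..<w}) (at_left w)"
        using tendsto_diff[OF m1.cdf_at_left m2.cdf_at_left] by (simp add: u_cdf[abs_def])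
    qed simp
  qed
qed

theorem lemmaA1:
  fixes K :: "nat set" and x :: "nat \<Rightarrow> real" and y :: "nat \<Rightarrow> ennreal"
    and W :: "(real \<times> ennreal) measure"
    and M :: "'w measure" and \<zeta> :: "nat \<Rightarrow> 'w \<Rightarrow> real"
    and u :: "real \<Rightarrow> real"
  assumes "\<forall>k\<in>K. 0 < y k"
    and "W = point_process K x y"
    and "W \<in> dense_trap_processes"
    and "prob_space M"
    and "prob_space.indep_vars M (\<lambda>_. borel) \<zeta> K"
    and "\<forall>k\<in>K. distributed M lborel (\<zeta> k) (exponential_density 1)"
    and "continuous_on UNIV u"
    and "\<forall>z. 0 \<le> u z"
    and "compact (closure {z. u z \<noteq> 0})"
    and "bounded_variation u"
  shows "trap_evolution (trap_locations W) (trap_measure K x y) u (trap_expectation M K x y \<zeta> u)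
    \<and> (\<forall>v. trap_evolution (trap_locations W) (trap_measure K x y) u v \<longrightarrow>
         (\<forall>t\<ge>0. \<forall>z. v t z = trap_expectation M K x y \<zeta> u t z))"
proof -
  have y: "\<forall>k\<in>K. 0 < y k" by fact
  have W: "W = point_process K x y" by fact
  have config: "trap_config K x y"
    using trap_config_point_process[OF y] assms(2,3) by simp
  have traps: "random_traps K x y M \<zeta>"
    using config assms(4-6) by (intro random_traps.intro random_traps_axioms.intro) auto
  have J: "trap_locations W = x ` K"
    unfolding W by (rule trap_locations_point_process[OF y trap_config.y_fin[OF config]])
  obtain m\<^sub>1 m\<^sub>2 where m: "finite_borel_measure m\<^sub>1" "finite_borel_measure m\<^sub>2"
    "\<And>w. u w = measure m\<^sub>1 {..<w} - measure m\<^sub>2 {..<w}"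
    by (rule compact_support_bounded_variation_representation[OF assms(7,9,10)]) (rule that)
  have evo: "trap_evolution (x ` K) (trap_measure K x y) u (trap_expectation M K x y \<zeta> u)"
    by (rule random_traps.trap_evolution_trap_expectation[OF traps m borel_measurable_continuous_onI[OF assms(7)]])
  then show ?thesis
    unfolding J using trap_config.trap_evolution_unique[OF config _ evo] by blast
qed

end
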